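(* Let $n\ge 2$ and $k\in\{1,\ldots,n-1\}$. Assume that $f\in C_{k+\delta}(\mathbb{R}^n)$ for some $\delta>0$. Then $f$ can be recovered from its $k$-plane transform $\hat f$ by $$f(x)=(4\pi)^{-\frac{k}{2}}\,\frac{\Gamma\left(\frac{n-k}{2}\right)}{\Gamma\left(\frac{n}{2}\right)}\,\lim_{s\to -k_+} \Big(I^{s}\big((\hat f)^{\vee}\big)\Big)(x),\qquad x\in\mathbb{R}^n,$$ where the limit is over real $s>-k$ tending to $-k$.
   Context: Functions are complex-valued. For $a>0$, $C_a(\mathbb{R}^n)$ is the set of continuous functions $f$ on $\mathbb{R}^n$ with $f(x)=O(|x|^{-a})$ as $|x|\to\infty$. $k$-plane transform: $\hat f(\xi)=\int_{\xi} f(x)\,dm(x)$ for every $k$-dimensional affine subspace ($k$-plane) $\xi$ of $\mathbb{R}^n$, where $dm$ is Lebesgue (Euclidean) measure on $\xi$. Dual transform: for a continuous function $\varphi$ on the set of $k$-planes, $\varphi^{\vee}(x)=\int_{\xi\ni x}\varphi(\xi)\,d\mu(\xi)$, where $\mu$ is the probability measure on the set of $k$-planes through $x$ invariant under rotations about $x$. Riesz potentials: $H_n(\alpha)=2^{\alpha}\pi^{n/2}\Gamma(\alpha/2)/\Gamma((n-\alpha)/2)$. For $g\in C_b(\mathbb{R}^n)$ with $b>0$, $x\in\mathbb{R}^n$ and $\alpha\in\mathbb{C}\setminus\{n,n+2,n+4,\ldots\}$ with $0<\operatorname{Re}\alpha<b$, $$(I^{\alpha}g)(x)=\frac{1}{H_n(\alpha)}\int_{\mathbb{R}^n}g(y)|x-y|^{\alpha-n}\,dy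 .$$ For $\operatorname{Re}\alpha\le 0$, $(I^{\alpha}g)(x)$ denotes the value at $\alpha$ of the analytic continuation of the map $\alpha\mapsto(I^{\alpha}g)(x)$ from $\{0<\operatorname{Re}\alpha<b\}$ to a larger strip $\{c<\operatorname{Re}\alpha<b\}$, $c<0$. If, in a neighborhood of $x$, $g$ is $C^l$ with all order-$l$ derivatives Hölder continuous of index $\epsilon\in(0,1)$, then this (meromorphic) continuation exists on $\{-l-\epsilon<\operatorname{Re}\alpha<b\}$, with poles only in $\{n,n+2,\ldots\}$. Here $I^{s}$, for real $s>-k$ near $-k$, is taken in this sense. *)

theory Defs
  imports "HOL-Analysis.Analysis" "HOL-Library.Landau_Symbols"
begin

definition C_decay :: "real \<Rightarrow> (real ^ 'n \<Rightarrow> complex) set" where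
  "C_decay a = {f. continuous_on UNIV f \<and>
     f \<in> O[at_infinity](\<lambda>x. complex_of_real (norm x powr (- a)))}"

definition kplanes :: "nat \<Rightarrow> (real ^ 'n) set set" where
  "kplanes k = {\<xi>. affine \<xi> \<and> aff_dim \<xi> = int k}"

definition orthonormal_frame :: "nat \<Rightarrow> (nat \<Rightarrow> real ^ 'n) \<Rightarrow> bool" where
  "orthonormal_frame k b \<longleftrightarrow> (\<forall>i<k. \<forall>j<k. b i \<bullet> b j = (if i = j then 1 else 0))"

definition frame_map :: "nat \<Rightarrow> real ^ 'n \<Rightarrow> (nat \<Rightarrow> real ^ 'n) \<Rightarrow> (nat \<Rightarrow> real) \<Rightarrow> real ^ 'n" where
  "frame_map k p b t = p + (\<Sum>i<k. t i *\<^sub>R b i)"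

text \<open>Lebesgue measure on a \<open>k\<close>-plane \<open>\<xi>\<close>, as a measure on the ambient space: the image of
  \<open>k\<close>-dimensional Lebesgue measure under Cartesian coordinates (a point \<open>p \<in> \<xi>\<close> and an
  orthonormal basis \<open>b\<close> of the direction of \<open>\<xi>\<close>). It does not depend on the choice of
  coordinates.\<close>

definition kplane_lborel :: "nat \<Rightarrow> (real ^ 'n) set \<Rightarrow> (real ^ 'n) measure" where
  "kplane_lborel k \<xi> = (SOME M. \<exists>p b. orthonormal_frame k b \<and> \<xi> = range (frame_map k p b) \<and>
     M = distr (\<Pi>\<^sub>M i\<in>{..<k}. lborel) borel (frame_map k p b))"

definition kplane_transform :: "nat \<Rightarrow> (real ^ 'n \<Rightarrow> complex) \<Rightarrow> (real ^ 'n) set \<Rightarrow> complex" where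
  "kplane_transform k f \<xi> = (LINT x|kplane_lborel k \<xi>. f x)"

definition kplanes_through :: "nat \<Rightarrow> real ^ 'n \<Rightarrow> (real ^ 'n) set set" where
  "kplanes_through k x = {\<xi> \<in> kplanes k. x \<in> \<xi>}"

text \<open>The usual topology of the Grassmannian of \<open>k\<close>-planes through \<open>x\<close>: a plane \<open>\<xi>\<close> is
  identified with the orthogonal projection \<open>closest_point \<xi>\<close> onto it, and projections carry
  the topology of pointwise convergence (the topology of the function type), which on affine
  maps is the finite-dimensional one.\<close>

definition grassmann_topology :: "nat \<Rightarrow> real ^ 'n \<Rightarrow> (real ^ 'n) set topology" where
  "grassmann_topology k x = pullback_topology (kplanes_through k x) closest_point euclidean"

definition rotate_about :: "real ^ 'n \<Rightarrow> real ^ 'n ^ 'n \<Rightarrow> real ^ 'n \<Rightarrow> real ^ 'n" where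
  "rotate_about x A y = x + A *v (y - x)"

definition rotation_invariant_prob :: "nat \<Rightarrow> real ^ 'n \<Rightarrow> (real ^ 'n) set measure \<Rightarrow> bool" where
  "rotation_invariant_prob k x \<mu> \<longleftrightarrow>
     space \<mu> = kplanes_through k x \<and>
     sets \<mu> = sigma_sets (kplanes_through k x) {U. openin (grassmann_topology k x) U} \<and>
     emeasure \<mu> (space \<mu>) = 1 \<and>
     (\<forall>A. rotation_matrix A \<longrightarrow> distr \<mu> \<mu> ((`) (rotate_about x A)) = \<mu>)"

text \<open>For \<open>1 \<le> k < n\<close> there is exactly one such measure, since the rotations about \<open>x\<close> act
  transitively on the \<open>k\<close>-planes through \<open>x\<close>.\<close>

definition kplane_prob :: "nat \<Rightarrow> real ^ 'n \<Rightarrow> (real ^ 'n) set measure" where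
  "kplane_prob k x = (SOME \<mu>. rotation_invariant_prob k x \<mu>)"

definition dual_kplane_transform ::
    "nat \<Rightarrow> ((real ^ 'n) set \<Rightarrow> complex) \<Rightarrow> real ^ 'n \<Rightarrow> complex" where
  "dual_kplane_transform k \<phi> x = (LINT \<xi>|kplane_prob k x. \<phi> \<xi>)"

definition riesz_H :: "nat \<Rightarrow> complex \<Rightarrow> complex" where
  "riesz_H n \<alpha> = 2 powr \<alpha> * complex_of_real pi powr (of_nat n / 2) *
     Gamma (\<alpha> / 2) / Gamma ((of_nat n - \<alpha>) / 2)"

definition riesz_integral :: "(real ^ 'n \<Rightarrow> complex) \<Rightarrow> real ^ 'n \<Rightarrow> complex \<Rightarrow> complex" where
  "riesz_integral g x \<alpha> = 1 / riesz_H CARD('n) \<alpha> *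
     (LINT y|lborel. g y * complex_of_real (norm (x - y)) powr (\<alpha> - of_nat CARD('n)))"

definition riesz_poles :: "nat \<Rightarrow> complex set" where
  "riesz_poles n = {of_nat (n + 2 * j) | j. True}"

definition riesz_continuation ::
    "(real ^ 'n \<Rightarrow> complex) \<Rightarrow> real ^ 'n \<Rightarrow> real \<Rightarrow> real \<Rightarrow> (complex \<Rightarrow> complex) \<Rightarrow> bool" where
  "riesz_continuation g x c b F \<longleftrightarrow>
     c < 0 \<and> 0 < b \<and> g \<in> C_decay b \<and>
     F holomorphic_on ({\<alpha>. c < Re \<alpha> \<and> Re \<alpha> < b} - riesz_poles CARD('n)) \<and>
     (\<forall>\<alpha>. 0 < Re \<alpha> \<and> Re \<alpha> < b \<and> \<alpha> \<notin> riesz_poles CARD('n) \<longrightarrow> F \<alpha> = riesz_integral g x \<alpha>)"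

text \<open>By the identity theorem the continued value depends neither on \<open>F\<close> nor on the strip,
  so the definite description below picks out the value as soon as some continuation to a strip
  containing \<open>\<alpha>\<close> exists.\<close>

definition riesz_potential :: "complex \<Rightarrow> (real ^ 'n \<Rightarrow> complex) \<Rightarrow> real ^ 'n \<Rightarrow> complex" where
  "riesz_potential \<alpha> g x =
     (if 0 < Re \<alpha> then riesz_integral g x \<alpha>
      else (THE v. \<exists>c b F. riesz_continuation g x c b F \<and> c < Re \<alpha> \<and> v = F \<alpha>))"

end

theory Submission
  imports Defs "HOL-Probability.Distributions" "HOL-Complex_Analysis.Conformal_Mappings"
begin

text \<open>
  Fix \<open>x\<close>. Integrating the measures of the \<open>k\<close>-planes \<open>\<xi> \<ni> x\<close> against an invariant probability on the
  Grassmannian gives a measure on \<open>\<real>\<^sup>n\<close> that is invariant under rotations about \<open>x\<close> and gives the ball of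
  radius \<open>r\<close> about \<open>x\<close> the mass \<open>\<omega>\<^sub>k r\<^sup>k\<close>. A rotation invariant measure is determined by the masses of the
  balls about \<open>x\<close>, hence this one has a density proportional to \<open>\<bar>y - x\<bar> powr (k - n)\<close>. So the dual transform
  of the \<open>k\<close>-plane transform of \<open>f\<close> is a multiple of the Riesz potential \<open>I\<^sup>k f\<close>. The Riesz kernels
  compose according to \<open>I\<^sup>\<alpha> I\<^sup>k = I\<^sup>\<alpha>\<^sup>+\<^sup>k\<close>, because they are superpositions of Gaussians. Therefore the
  continuation to \<open>- k < Re \<alpha>\<close> is a multiple of \<open>I\<^sup>\<alpha>\<^sup>+\<^sup>k f\<close>, an absolutely convergent integral, and for
  \<open>\<alpha> \<rightarrow> - k\<close> the kernels of \<open>I\<^sup>\<alpha>\<^sup>+\<^sup>k\<close> form an approximate identity.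
\<close>

section \<open>Orthonormal coordinates and Gaussian integrals\<close>

text \<open>The definitions fix the measure of a plane, the probability on the Grassmannian and the
  continued value by choice or definite description, so each has to be pinned down before anything
  can be computed. For a plane, a Gaussian weight in the normal directions gives a formula in which
  only the projection \<open>closest_point \<xi>\<close> occurs: it is free of coordinates, and
  measurable in the plane because the Grassmannian carries the topology of projections. For the
  probability, existence needs a construction, after which every invariant probability is treated
  alike. For the continuation, the identity theorem makes the value unique.

  The constant of the formula is the inverse of \<open>kplane_const n k * riesz_H_real n k\<close>.
  The first factor, a quotient of two sphere areas, comes from comparing balls; the second is left
  over when the kernels of orders \<alpha> and k are composed and normalised. Composition holds for
  total order below n, so the decay of \<open>f\<close> is first weakened to an order at most n.
  Kernel identities are proved for real exponents, with nonnegative integrals, and reach complex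
  ones by analytic continuation.\<close>

lemma nn_integral_lborel_affine:
  fixes f :: "'a::euclidean_space \<Rightarrow> ennreal"
  assumes [measurable]: "f \<in> borel_measurable borel" and c: "c \<noteq> 0"
  shows "(\<integral>\<^sup>+x. f x \<partial>lborel) = ennreal (\<bar>c\<bar> ^ DIM('a)) * (\<integral>\<^sup>+x. f (t + c *\<^sub>R x) \<partial>lborel)"
  by (subst lborel_affine[OF c, of t], subst nn_integral_density, simp_all,
      subst nn_integral_distr, simp_all add: nn_integral_cmult)

lemma nn_integral_lborel_translate:
  fixes f :: "'a::euclidean_space \<Rightarrow> ennreal"
  assumes "f \<in> borel_measurable borel"
  shows "(\<integral>\<^sup>+x. f (t + x) \<partial>lborel) = (\<integral>\<^sup>+x. f x \<partial>lborel)"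
  using nn_integral_lborel_affine[OF assms, of 1 t] by simp

lemma nn_integral_lborel_reflect:
  fixes f :: "'a::euclidean_space \<Rightarrow> ennreal"
  assumes "f \<in> borel_measurable borel"
  shows "(\<integral>\<^sup>+x. f (t - x) \<partial>lborel) = (\<integral>\<^sup>+x. f x \<partial>lborel)"
  using nn_integral_lborel_affine[OF assms, of "-1" t] by simp

text \<open>The argument is the uniqueness proof for Haar measure: with \<open>B\<close> the unit ball, evaluate
  \<open>\<integral>\<integral> 1\<^sub>A(T x) 1\<^sub>B(T x + y) dy dx\<close> in both orders.\<close>

lemma distr_lborel_orthogonal:
  fixes T :: "'a::euclidean_space \<Rightarrow> 'a"
  assumes T: "orthogonal_transformation T"
  shows "distr lborel borel T = lborel"
proof (rule measure_eqI)
  fix A assume "A \<in> sets (distr lborel borel T)"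
  then have [measurable]: "A \<in> sets borel" by simp
  have lin: "linear T" and nrm: "norm (T x) = norm x" for x
    using T by (auto simp: orthogonal_transformation)
  have [measurable]: "T \<in> borel_measurable borel"
    using lin by (simp add: borel_measurable_continuous_onI linear_continuous_on linear_linear)
  define B where "B = cball (0::'a) 1"
  have [measurable]: "B \<in> sets borel" by (simp add: B_def)
  have BT: "indicator B (T x) = (indicator B x :: ennreal)" for x
    by (simp add: B_def indicator_def nrm)
  have eB: "emeasure lborel B = ennreal (unit_ball_vol DIM('a))"
    unfolding B_def by (subst emeasure_cball) auto
  then have B0: "emeasure lborel B \<noteq> 0" "emeasure lborel B \<noteq> \<infinity>"
    using unit_ball_vol_pos[of "real DIM('a)"] by (simp_all add: less_imp_neq[symmetric])
  have surj: "T (inv T y) = y" for y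
    using orthogonal_transformation_surj[OF T] by (simp add: surj_f_inv_f)
  have "emeasure (distr lborel borel T) A * emeasure lborel B =
      (\<integral>\<^sup>+x. indicator A (T x) * (\<integral>\<^sup>+y. indicator B (T x + y) \<partial>lborel) \<partial>lborel)"
  proof -
    have "(\<integral>\<^sup>+y. indicator B (T x + y) \<partial>lborel) = emeasure lborel B" for x
      by (subst nn_integral_lborel_translate) auto
    then have "(\<integral>\<^sup>+x. indicator A (T x) * (\<integral>\<^sup>+y. indicator B (T x + y) \<partial>lborel) \<partial>lborel)
       = (\<integral>\<^sup>+x. indicator A (T x) \<partial>lborel) * emeasure lborel B"
      by (simp add: nn_integral_multc)
    also have "(\<integral>\<^sup>+x. indicator A (T x) \<partial>lborel) = emeasure (distr lborel borel T) A"
      by (subst nn_integral_indicator[symmetric], simp, subst nn_integral_distr) auto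
    finally show ?thesis by simp
  qed
  also have "\<dots> = (\<integral>\<^sup>+x. (\<integral>\<^sup>+y. indicator A (T x) * indicator B (T x + y) \<partial>lborel) \<partial>lborel)"
    by (subst nn_integral_cmult) auto
  also have "\<dots> = (\<integral>\<^sup>+y. (\<integral>\<^sup>+x. indicator A (T x) * indicator B (T x + y) \<partial>lborel) \<partial>lborel)"
    by (rule lborel_pair.Fubini') measurable
  \<comment> \<open>Translating \<open>x\<close> by \<open>- inv T y\<close> replaces
    \<open>T x\<close> by \<open>T x - y\<close>, by linearity; this moves \<open>y\<close> from the
    indicator of \<open>B\<close> to that of \<open>A\<close>.\<close>
  also have "\<dots> = (\<integral>\<^sup>+y. (\<integral>\<^sup>+x. indicator A (T x - y) * indicator B (T x) \<partial>lborel) \<partial>lborel)"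
  proof (rule nn_integral_cong)
    fix y
    show "(\<integral>\<^sup>+x. indicator A (T x) * indicator B (T x + y) \<partial>lborel)
        = (\<integral>\<^sup>+x. indicator A (T x - y) * indicator B (T x) \<partial>lborel)"
      by (subst nn_integral_lborel_translate[of _ "- inv T y", symmetric])
        (auto simp: linear_diff[OF lin] surj)
  qed
  also have "\<dots> = (\<integral>\<^sup>+x. (\<integral>\<^sup>+y. indicator A (T x - y) * indicator B (T x) \<partial>lborel) \<partial>lborel)"
    by (rule lborel_pair.Fubini'[symmetric]) measurable
  also have "\<dots> = (\<integral>\<^sup>+x. emeasure lborel A * indicator B x \<partial>lborel)"
  proof (rule nn_integral_cong)
    fix x
    have "(\<integral>\<^sup>+y. indicator A (T x - y) \<partial>lborel) = emeasure lborel A"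
      by (subst nn_integral_lborel_reflect) auto
    then show "(\<integral>\<^sup>+y. indicator A (T x - y) * indicator B (T x) \<partial>lborel) = emeasure lborel A * indicator B x"
      by (simp add: BT nn_integral_multc)
  qed
  also have "\<dots> = emeasure lborel A * emeasure lborel B"
    by (simp add: nn_integral_cmult)
  finally show "emeasure (distr lborel borel T) A = emeasure lborel A"
    using B0 by (simp add: mult.commute[of _ "emeasure lborel B"] ennreal_mult_cancel_left)
qed simp

section \<open>Orthonormal frames and Lebesgue measure in their coordinates\<close>

lemma frame_map_measurable [measurable]:
  "frame_map k p b \<in> borel_measurable (\<Pi>\<^sub>M i\<in>{..<k}. lborel)"
  unfolding frame_map_def by measurable

lemma frame_map_inner:
  assumes "orthonormal_frame k b" "i < k"
  shows "(frame_map k p b t - p) \<bullet> b i = t i"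
proof -
  have "(frame_map k p b t - p) \<bullet> b i = (\<Sum>j<k. t j * (b j \<bullet> b i))"
    by (simp add: frame_map_def inner_sum_left)
  also have "\<dots> = (\<Sum>j<k. if j = i then t j else 0)"
    using assms by (intro sum.cong) (auto simp: orthonormal_frame_def)
  finally show ?thesis using assms(2) by (simp add: sum.delta)
qed

lemma orthonormal_frame_norm:
  assumes "orthonormal_frame k b"
  shows "(norm (\<Sum>i<k. t i *\<^sub>R b i))\<^sup>2 = (\<Sum>i<k. (t i)\<^sup>2)"
proof -
  have "(norm (\<Sum>i<k. t i *\<^sub>R b i))\<^sup>2 = (\<Sum>i<k. t i * ((\<Sum>j<k. t j *\<^sub>R b j) \<bullet> b i))"
    by (simp add: power2_norm_eq_inner inner_sum_right)
  also have "\<dots> = (\<Sum>i<k. (t i)\<^sup>2)"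
    using frame_map_inner[OF assms, of _ 0 t] by (intro sum.cong) (auto simp: frame_map_def power2_eq_square)
  finally show ?thesis .
qed

lemma orthonormal_frame_inj: "orthonormal_frame k b \<Longrightarrow> inj_on b {..<k}"
  by (intro inj_onI) (metis lessThan_iff orthonormal_frame_def zero_neq_one)

lemma orthonormal_frame_independent:
  fixes b :: "nat \<Rightarrow> real ^ 'n"
  assumes "orthonormal_frame k b"
  shows "independent (b ` {..<k})"
proof (rule pairwise_orthogonal_independent)
  show "pairwise orthogonal (b ` {..<k})"
    using assms by (auto simp: pairwise_def orthogonal_def orthonormal_frame_def)
  show "0 \<notin> b ` {..<k}"
    using assms by (fastforce simp: orthonormal_frame_def)
qed

text \<open>By counting, the frame spans the whole space. The difference of the two sides is
  orthogonal to every \<open>b i\<close>, hence to itself.\<close>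

lemma orthonormal_frame_span:
  fixes b :: "nat \<Rightarrow> real ^ 'n"
  assumes "orthonormal_frame CARD('n) b"
  shows "(\<Sum>i<CARD('n). (y \<bullet> b i) *\<^sub>R b i) = y"
proof -
  let ?B = "b ` {..<CARD('n)}" and ?z = "y - (\<Sum>i<CARD('n). (y \<bullet> b i) *\<^sub>R b i)"
  have "card ?B = CARD('n)"
    using card_image[OF orthonormal_frame_inj[OF assms]] by simp
  then have "dim ?B = DIM(real ^ 'n)"
    using orthonormal_frame_independent[OF assms] by (simp add: dim_eq_card_independent)
  then have "span ?B = UNIV" by (simp only: dim_eq_full)
  moreover have "orthogonal ?z x" if "x \<in> ?B" for x
  proof -
    from that obtain i where i: "i < CARD('n)" "x = b i" by auto
    have "(\<Sum>i<CARD('n). (y \<bullet> b i) *\<^sub>R b i) \<bullet> b i = y \<bullet> b i"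
      using frame_map_inner[OF assms i(1), of 0 "\<lambda>i. y \<bullet> b i"] by (simp add: frame_map_def)
    then show ?thesis by (simp add: i orthogonal_def inner_diff_left)
  qed
  ultimately have "orthogonal ?z ?z"
    using orthogonal_to_span[of ?z ?B ?z] by auto
  then show ?thesis by (simp add: orthogonal_self)
qed

lemma orthonormal_frame_of_subspace:
  fixes S :: "(real ^ 'n) set"
  assumes "subspace S"
  obtains b where "orthonormal_frame (dim S) b" "span (b ` {..<dim S}) = S"
proof -
  obtain B where B: "B \<subseteq> S" "pairwise orthogonal B" "\<And>x. x \<in> B \<Longrightarrow> norm x = 1"
    "independent B" "card B = dim S" "span B = S"
    using orthonormal_basis_subspace[OF assms] by metis
  have "finite B" using B(4) independent_imp_finite by auto
  then obtain b where b: "bij_betw b {..<dim S} B"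
    using B(5) by (metis ex_bij_betw_nat_finite atLeast0LessThan)
  have "orthonormal_frame (dim S) b"
    unfolding orthonormal_frame_def
  proof (intro allI impI)
    fix i j assume ij: "i < dim S" "j < dim S"
    then have "b i \<in> B" "b j \<in> B" using b by (auto simp: bij_betw_def)
    moreover have "i \<noteq> j \<Longrightarrow> b i \<noteq> b j"
      using b ij by (auto simp: bij_betw_def inj_on_def)
    ultimately show "b i \<bullet> b j = (if i = j then 1 else 0)"
      using B(2) B(3)[of "b i"] by (auto simp: pairwise_def orthogonal_def norm_eq_1)
  qed
  moreover have "span (b ` {..<dim S}) = S" using b B(6) by (simp add: bij_betw_def)
  ultimately show thesis by (rule that)
qed

lemma orthonormal_frame_extend:
  fixes b :: "nat \<Rightarrow> real ^ 'n"
  assumes b: "orthonormal_frame k b"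
  obtains c where "orthonormal_frame CARD('n) c" "\<And>i. i < k \<Longrightarrow> c i = b i" "k \<le> CARD('n)"
proof -
  let ?V = "span (b ` {..<k})"
  define S where "S = {y. \<forall>x\<in>?V. orthogonal x y}"
  have S: "subspace S" unfolding S_def by (rule subspace_orthogonal_to_vectors)
  obtain d where d: "orthonormal_frame (dim S) d" "span (d ` {..<dim S}) = S"
    using orthonormal_frame_of_subspace[OF S] by blast
  have dV: "dim ?V = k"
    using orthonormal_frame_independent[OF b] card_image[OF orthonormal_frame_inj[OF b]]
    by (simp add: dim_eq_card_independent)
  have "dim {y \<in> UNIV. \<forall>x\<in>?V. orthogonal x y} + dim ?V = dim (UNIV :: (real^'n) set)"
    by (rule dim_subspace_orthogonal_to_vectors) auto
  then have dS: "dim S + k = CARD('n)" using dV by (simp add: S_def)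
  define c where "c i = (if i < k then b i else d (i - k))" for i
  have bd: "b i \<bullet> d j = 0" if "i < k" "j < dim S" for i j
  proof -
    have "d j \<in> S" using d(2) that by (metis imageI lessThan_iff span_base)
    moreover have "b i \<in> ?V" using that by (simp add: span_base)
    ultimately show ?thesis by (simp add: S_def orthogonal_def)
  qed
  have "orthonormal_frame CARD('n) c"
    unfolding orthonormal_frame_def
  proof (intro allI impI)
    fix i j assume ij: "i < CARD('n)" "j < CARD('n)"
    show "c i \<bullet> c j = (if i = j then 1 else 0)"
    proof (cases "i < k"; cases "j < k")
      assume "i < k" "j < k" then show ?thesis using b by (auto simp: c_def orthonormal_frame_def)
    next
      assume "i < k" "\<not> j < k" then show ?thesis using bd[of i "j - k"] ij dS by (auto simp: c_def)
    next
      assume "\<not> i < k" "j < k" then show ?thesis using bd[of j "i - k"] ij dS by (auto simp: c_def inner_commute)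
    next
      assume "\<not> i < k" "\<not> j < k"
      then show ?thesis using d(1) ij dS by (auto simp: c_def orthonormal_frame_def)
    qed
  qed
  then show thesis using dS by (intro that[of c]) (auto simp: c_def)
qed

text \<open>The volumes of boxes characterise \<open>lborel\<close>, which settles the standard
  frame. Any other frame differs from it by an orthogonal map and a translation, and both preserve
  \<open>lborel\<close>.\<close>

lemma distr_frame_map_full:
  fixes b :: "nat \<Rightarrow> real ^ 'n"
  assumes b: "orthonormal_frame CARD('n) b"
  shows "distr (\<Pi>\<^sub>M i\<in>{..<CARD('n)}. lborel) borel (frame_map CARD('n) p b) = lborel"
proof -
  let ?n = "CARD('n)"
  interpret product_sigma_finite "\<lambda>_::nat. lborel :: real measure" by standard
  obtain \<sigma> :: "nat \<Rightarrow> 'n" where \<sigma>: "bij_betw \<sigma> {..<?n} UNIV"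
    by (metis ex_bij_betw_nat_finite finite_class.finite_UNIV atLeast0LessThan)
  define e where "e i = axis (\<sigma> i) (1::real)" for i
  have e: "orthonormal_frame ?n e"
    using \<sigma> by (auto simp: orthonormal_frame_def e_def inner_axis_axis bij_betw_def inj_on_def)
  have std: "lborel = distr (\<Pi>\<^sub>M i\<in>{..<?n}. lborel) borel (frame_map ?n 0 e)"
  proof (rule lborel_eqI)
    fix l u :: "real^'n" assume lu: "\<And>b. b \<in> Basis \<Longrightarrow> l \<bullet> b \<le> u \<bullet> b"
    have "e ` {..<?n} = (\<lambda>i. axis i 1) ` (\<sigma> ` {..<?n})" by (simp add: e_def image_image)
    then have e_basis: "bij_betw e {..<?n} Basis"
      using orthonormal_frame_inj[OF e] \<sigma> by (auto simp: bij_betw_def Basis_vec_def)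
    have coord: "frame_map ?n 0 e t \<bullet> e i = t i" if "i < ?n" for i t
      using frame_map_inner[OF e that, of 0 t] by simp
    have "emeasure (distr (\<Pi>\<^sub>M i\<in>{..<?n}. lborel) borel (frame_map ?n 0 e)) (box l u)
      = emeasure (\<Pi>\<^sub>M i\<in>{..<?n}. lborel) (frame_map ?n 0 e -` box l u \<inter> space (\<Pi>\<^sub>M i\<in>{..<?n}. lborel))"
      by (rule emeasure_distr) auto
    also have "frame_map ?n 0 e -` box l u \<inter> space (\<Pi>\<^sub>M i\<in>{..<?n}. lborel)
      = (\<Pi>\<^sub>E i\<in>{..<?n}. {l \<bullet> e i<..<u \<bullet> e i})"
    proof -
      have "y \<in> box l u \<longleftrightarrow> (\<forall>i<?n. l \<bullet> e i < y \<bullet> e i \<and> y \<bullet> e i < u \<bullet> e i)" for y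
        unfolding mem_box e_basis[THEN bij_betw_imp_surj_on, symmetric] by auto
      then show ?thesis by (auto simp: space_PiM coord PiE_def Pi_def)
    qed
    also have "emeasure (\<Pi>\<^sub>M i\<in>{..<?n}. lborel) \<dots> = (\<Prod>i<?n. emeasure lborel {l \<bullet> e i<..<u \<bullet> e i})"
      by (subst emeasure_PiM) auto
    also have "\<dots> = (\<Prod>i<?n. ennreal ((u - l) \<bullet> e i))"
    proof (intro prod.cong refl)
      fix i assume "i \<in> {..<?n}"
      then have "e i \<in> Basis" using e_basis by (auto simp: bij_betw_def)
      then show "emeasure lborel {l \<bullet> e i<..<u \<bullet> e i} = ennreal ((u - l) \<bullet> e i)"
        using lu by (simp add: inner_diff_left)
    qed
    also have "\<dots> = (\<Prod>b\<in>Basis. ennreal ((u - l) \<bullet> b))"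
      by (rule prod.reindex_bij_betw[OF e_basis])
    also have "\<dots> = ennreal (\<Prod>b\<in>Basis. (u - l) \<bullet> b)"
      using lu by (intro prod_ennreal) (auto simp: inner_diff_left)
    finally show "emeasure (distr (\<Pi>\<^sub>M i\<in>{..<?n}. lborel) borel (frame_map ?n 0 e)) (box l u)
        = ennreal (\<Prod>b\<in>Basis. (u - l) \<bullet> b)" .
  qed simp
  define T where "T y = (\<Sum>i<?n. (y \<bullet> e i) *\<^sub>R b i)" for y
  have "linear T"
    unfolding T_def
    by (intro linearI) (auto simp: inner_add_left scaleR_add_left sum.distrib scaleR_sum_right)
  moreover have "norm (T y) = norm y" for y
  proof -
    have "(norm (T y))\<^sup>2 = (norm y)\<^sup>2"
      using orthonormal_frame_norm[OF b, of "\<lambda>i. y \<bullet> e i"] orthonormal_frame_norm[OF e, of "\<lambda>i. y \<bullet> e i"]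
      by (simp add: T_def orthonormal_frame_span[OF e])
    then show ?thesis by simp
  qed
  ultimately have T: "orthogonal_transformation T" by (simp add: orthogonal_transformation)
  have fm: "frame_map ?n p b t = p + T (frame_map ?n 0 e t)" for t
    using frame_map_inner[OF e, of _ 0 t] by (simp add: T_def) (simp add: frame_map_def)
  have fm': "frame_map ?n p b = (\<lambda>t. p + T (frame_map ?n 0 e t))"
    by (rule ext) (rule fm)
  have [measurable]: "T \<in> borel_measurable borel"
    using \<open>linear T\<close> by (simp add: borel_measurable_continuous_onI linear_continuous_on linear_linear)
  have "(lborel :: (real^'n) measure) = distr lborel borel ((+) p)"
    using lborel_affine[of 1 p] by (simp add: density_1)
  also have "distr lborel borel ((+) p) = distr (distr lborel borel T) borel ((+) p)"
    by (simp add: distr_lborel_orthogonal[OF T])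
  also have "\<dots> = distr lborel borel (\<lambda>y. p + T y)"
    by (subst distr_distr) (auto simp: o_def)
  also have "\<dots> = distr (distr (\<Pi>\<^sub>M i\<in>{..<?n}. lborel) borel (frame_map ?n 0 e)) borel (\<lambda>y. p + T y)"
    by (simp only: std[symmetric])
  also have "\<dots> = distr (\<Pi>\<^sub>M i\<in>{..<?n}. lborel) borel (frame_map ?n p b)"
    by (subst distr_distr) (simp_all add: o_def fm')
  finally show ?thesis ..
qed

section \<open>Gaussian integrals\<close>

lemma nn_integral_gauss_real:
  assumes "a > 0"
  shows "(\<integral>\<^sup>+t. ennreal (exp (- (a * t\<^sup>2))) \<partial>lborel) = ennreal (sqrt (pi / a))"
proof -
  have "has_bochner_integral lborel (\<lambda>x::real. exp (- x\<^sup>2)) (2 * (sqrt pi / 2))"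
    using has_bochner_integral_even_function[OF gaussian_moment_0] by simp
  then have g: "(\<integral>\<^sup>+t. ennreal (exp (- t\<^sup>2)) \<partial>lborel) = ennreal (sqrt pi)"
    by (subst nn_integral_eq_integral) (auto simp: has_bochner_integral_iff)
  have "(\<integral>\<^sup>+t. ennreal (exp (- (a * t\<^sup>2))) \<partial>lborel)
     = ennreal (1 / sqrt a) * (\<integral>\<^sup>+t. ennreal (exp (- (a * (0 + (1 / sqrt a) *\<^sub>R t)\<^sup>2))) \<partial>lborel)"
    using assms by (subst nn_integral_lborel_affine[of _ "1 / sqrt a" 0]) auto
  also have "(\<lambda>t. ennreal (exp (- (a * (0 + (1 / sqrt a) *\<^sub>R t)\<^sup>2)))) = (\<lambda>t. ennreal (exp (- t\<^sup>2)))"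
    using assms by (auto simp: power_divide)
  finally show ?thesis using assms g by (simp add: real_sqrt_divide ennreal_mult'[symmetric] )
qed

lemma nn_integral_gauss_PiM:
  fixes I :: "nat set"
  assumes "finite I" "a > 0"
  shows "(\<integral>\<^sup>+t. ennreal (exp (- (a * (\<Sum>i\<in>I. (t i)\<^sup>2)))) \<partial>(\<Pi>\<^sub>M i\<in>I. lborel)) = ennreal ((pi / a) powr (card I / 2))"
proof -
  interpret product_sigma_finite "\<lambda>_::nat. lborel :: real measure" by standard
  have "(\<integral>\<^sup>+t. ennreal (exp (- (a * (\<Sum>i\<in>I. (t i)\<^sup>2)))) \<partial>(\<Pi>\<^sub>M i\<in>I. lborel))
    = (\<integral>\<^sup>+t. (\<Prod>i\<in>I. ennreal (exp (- (a * (t i)\<^sup>2)))) \<partial>(\<Pi>\<^sub>M i\<in>I. lborel))"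
  proof (rule nn_integral_cong)
    fix t :: "nat \<Rightarrow> real"
    have "exp (- (a * (\<Sum>i\<in>I. (t i)\<^sup>2))) = exp (\<Sum>i\<in>I. - (a * (t i)\<^sup>2))"
      by (simp add: sum_negf sum_distrib_left)
    also have "\<dots> = (\<Prod>i\<in>I. exp (- (a * (t i)\<^sup>2)))" using assms by (intro exp_sum)
    finally show "ennreal (exp (- (a * (\<Sum>i\<in>I. (t i)\<^sup>2)))) = (\<Prod>i\<in>I. ennreal (exp (- (a * (t i)\<^sup>2))))"
      by (simp add: prod_ennreal)
  qed
  also have "\<dots> = (\<Prod>i\<in>I. (\<integral>\<^sup>+t. ennreal (exp (- (a * t\<^sup>2))) \<partial>lborel))"
    using assms by (intro product_nn_integral_prod) auto
  also have "\<dots> = ennreal (sqrt (pi / a)) ^ card I"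
    using assms by (simp add: nn_integral_gauss_real)
  also have "\<dots> = ennreal (sqrt (pi / a) ^ card I)" using assms by (simp add: ennreal_power)
  also have "sqrt (pi / a) ^ card I = (pi / a) powr (card I / 2)"
  proof -
    have "sqrt (pi / a) ^ card I = ((pi / a) powr (1 / 2)) powr real (card I)"
      using assms by (subst powr_realpow) (auto simp: powr_half_sqrt)
    then show ?thesis by (simp add: powr_powr)
  qed
  finally show ?thesis .
qed

text \<open>Completing the frame to an orthonormal basis turns an integral over a \<open>k\<close>-plane into one over the whole
  space, with a Gaussian weight in the normal directions. The right-hand side no longer mentions the frame
  and, as the plane enters only through its projection, it is measurable in the plane as well.\<close>

lemma nn_integral_frame:
  fixes b :: "nat \<Rightarrow> real ^ 'n" and p :: "real ^ 'n"
  assumes b: "orthonormal_frame k b"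
    and [measurable]: "F \<in> borel_measurable borel"
  defines "P \<equiv> \<lambda>y. frame_map k p b (\<lambda>i. (y - p) \<bullet> b i)"
  shows "(\<integral>\<^sup>+t. F (frame_map k p b t) \<partial>(\<Pi>\<^sub>M i\<in>{..<k}. lborel))
    = (\<integral>\<^sup>+y. ennreal (exp (- (pi * (norm (y - P y))\<^sup>2))) * F (P y) \<partial>lborel)"
proof -
  let ?n = "CARD('n)"
  interpret product_sigma_finite "\<lambda>_::nat. lborel :: real measure" by standard
  obtain c where c: "orthonormal_frame ?n c" "\<And>i. i < k \<Longrightarrow> c i = b i" "k \<le> ?n"
    using orthonormal_frame_extend[OF b] by blast
  let ?I = "{..<k}" and ?J = "{k..<?n}"
  have IJ: "?I \<union> ?J = {..<?n}" "?I \<inter> ?J = {}" using c(3) by auto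
  have [measurable]: "P \<in> borel_measurable borel"
    unfolding P_def frame_map_def by measurable
  have P: "P (frame_map ?n p c t) = frame_map k p b t" for t
  proof -
    have "(frame_map ?n p c t - p) \<bullet> b i = t i" if "i < k" for i
      using frame_map_inner[OF c(1), of i p t] c(2,3) that by simp
    then show ?thesis by (simp add: P_def frame_map_def)
  qed
  have D: "(norm (frame_map ?n p c t - P (frame_map ?n p c t)))\<^sup>2 = (\<Sum>i\<in>?J. (t i)\<^sup>2)" for t
  proof -
    let ?t = "\<lambda>i. if i < k then 0 else t i"
    have "frame_map ?n p c t = p + ((\<Sum>i\<in>?I. t i *\<^sub>R c i) + (\<Sum>i\<in>?J. t i *\<^sub>R c i))"
      unfolding frame_map_def IJ(1)[symmetric] using IJ(2) by (subst sum.union_disjoint) auto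
    moreover have "(\<Sum>i\<in>?I. t i *\<^sub>R c i) = (\<Sum>i\<in>?I. t i *\<^sub>R b i)"
      using c(2) by (intro sum.cong) auto
    ultimately have "frame_map ?n p c t - P (frame_map ?n p c t) = (\<Sum>i\<in>?J. t i *\<^sub>R c i)"
      unfolding P by (simp add: frame_map_def)
    also have "\<dots> = (\<Sum>i<?n. ?t i *\<^sub>R c i)"
      by (rule sum.mono_neutral_cong_left) auto
    finally have "(norm (frame_map ?n p c t - P (frame_map ?n p c t)))\<^sup>2 = (\<Sum>i<?n. (?t i)\<^sup>2)"
      using orthonormal_frame_norm[OF c(1), of ?t] by simp
    also have "\<dots> = (\<Sum>i\<in>?J. (t i)\<^sup>2)"
      by (rule sum.mono_neutral_cong_right) auto
    finally show ?thesis .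
  qed
  let ?G = "\<lambda>y. ennreal (exp (- (pi * (norm (y - P y))\<^sup>2))) * F (P y)"
  have "(\<integral>\<^sup>+y. ?G y \<partial>lborel)
      = (\<integral>\<^sup>+y. ?G y \<partial>distr (\<Pi>\<^sub>M i\<in>{..<?n}. lborel) borel (frame_map ?n p c))"
    by (simp only: distr_frame_map_full[OF c(1)])
  also have "\<dots> = (\<integral>\<^sup>+t. ?G (frame_map ?n p c t) \<partial>(\<Pi>\<^sub>M i\<in>{..<?n}. lborel))"
    by (rule nn_integral_distr) measurable
  also have "\<dots> = (\<integral>\<^sup>+t. ennreal (exp (- (pi * (\<Sum>i\<in>?J. (t i)\<^sup>2)))) * F (frame_map k p b t) \<partial>(\<Pi>\<^sub>M i\<in>{..<?n}. lborel))"
    by (simp only: D) (simp only: P)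
  also have "\<dots> = (\<integral>\<^sup>+s. (\<integral>\<^sup>+t. ennreal (exp (- (pi * (\<Sum>i\<in>?J. (t i)\<^sup>2)))) * F (frame_map k p b s)
      \<partial>(\<Pi>\<^sub>M i\<in>?J. lborel)) \<partial>(\<Pi>\<^sub>M i\<in>?I. lborel))"
  proof -
    let ?M = "\<Pi>\<^sub>M i\<in>{..<?n}. lborel :: real measure"
    have cm: "(\<lambda>t. t i) \<in> borel_measurable ?M" if "i < ?n" for i
      using measurable_component_singleton[of i "{..<?n}" "\<lambda>_. lborel :: real measure"] that by simp
    have "(\<lambda>t. frame_map k p b t) \<in> borel_measurable ?M"
      using c(3) unfolding frame_map_def
      by (intro borel_measurable_add borel_measurable_sum borel_measurable_scaleR cm) auto
    then have F: "(\<lambda>t. F (frame_map k p b t)) \<in> borel_measurable ?M"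
      by (rule measurable_compose) fact
    have "(\<lambda>t. \<Sum>i\<in>?J. (t i)\<^sup>2) \<in> borel_measurable ?M"
      by (intro borel_measurable_sum borel_measurable_power cm) simp
    then have "(\<lambda>t. ennreal (exp (- (pi * (\<Sum>i\<in>?J. (t i)\<^sup>2))))) \<in> borel_measurable ?M"
      by (rule measurable_compose) measurable
    from borel_measurable_times_ennreal[OF this F]
    have "(\<lambda>t. ennreal (exp (- (pi * (\<Sum>i\<in>?J. (t i)\<^sup>2)))) * F (frame_map k p b t)) \<in> borel_measurable ?M" .
    then have fe: "(\<integral>\<^sup>+t. ennreal (exp (- (pi * (\<Sum>i\<in>?J. (t i)\<^sup>2)))) * F (frame_map k p b t) \<partial>?M)
       = (\<integral>\<^sup>+s. (\<integral>\<^sup>+t. ennreal (exp (- (pi * (\<Sum>i\<in>?J. (merge ?I ?J (s, t) i)\<^sup>2)))) * F (frame_map k p b (merge ?I ?J (s, t)))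
            \<partial>(\<Pi>\<^sub>M i\<in>?J. lborel)) \<partial>(\<Pi>\<^sub>M i\<in>?I. lborel))"
      using product_nn_integral_fold[OF IJ(2)] unfolding IJ(1) by simp
    have m1: "frame_map k p b (merge ?I ?J (s, t)) = frame_map k p b s" for s t
      unfolding frame_map_def by (intro arg_cong2[where f = "(+)"] sum.cong) (auto simp: merge_def)
    have m2: "(\<Sum>i\<in>?J. (merge ?I ?J (s, t) i)\<^sup>2) = (\<Sum>i\<in>?J. (t i)\<^sup>2)" for s t
      by (intro sum.cong) (auto simp: merge_def)
    show ?thesis using fe unfolding m1 m2 .
  qed
  \<comment> \<open>The factor pi in the exponent normalises the Gaussian: over the normal
    coordinates it integrates to a power of \<open>pi / pi\<close>, that is, to 1.\<close>
  also have "\<dots> = (\<integral>\<^sup>+s. F (frame_map k p b s) \<partial>(\<Pi>\<^sub>M i\<in>?I. lborel))"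
    by (subst nn_integral_multc) (auto simp: nn_integral_gauss_PiM)
  finally show ?thesis ..
qed

lemma nn_integral_gauss:
  assumes "a > 0"
  shows "(\<integral>\<^sup>+y. ennreal (exp (- (a * (norm (y - z :: real ^ 'n))\<^sup>2))) \<partial>lborel) = ennreal ((pi / a) powr (CARD('n) / 2))"
proof -
  obtain c :: "nat \<Rightarrow> real ^ 'n" where c: "orthonormal_frame CARD('n) c"
  proof -
    \<comment> \<open>Extending the empty frame produces an orthonormal basis of the whole
      space.\<close>
    have "orthonormal_frame 0 (\<lambda>_. 0 :: real ^ 'n)" by (simp add: orthonormal_frame_def)
    then show thesis by (rule orthonormal_frame_extend) (rule that)
  qed
  have "(norm (frame_map CARD('n) z c t - z))\<^sup>2 = (\<Sum>i<CARD('n). (t i)\<^sup>2)" for t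
    using orthonormal_frame_norm[OF c] by (simp add: frame_map_def)
  note D = this
  have "(\<integral>\<^sup>+y. ennreal (exp (- (a * (norm (y - z))\<^sup>2))) \<partial>lborel)
      = (\<integral>\<^sup>+y. ennreal (exp (- (a * (norm (y - z))\<^sup>2))) \<partial>distr (\<Pi>\<^sub>M i\<in>{..<CARD('n)}. lborel) borel (frame_map CARD('n) z c))"
    by (simp only: distr_frame_map_full[OF c])
  also have "\<dots> = (\<integral>\<^sup>+t. ennreal (exp (- (a * (norm (frame_map CARD('n) z c t - z))\<^sup>2))) \<partial>(\<Pi>\<^sub>M i\<in>{..<CARD('n)}. lborel))"
    by (rule nn_integral_distr) measurable
  also have "\<dots> = ennreal ((pi / a) powr (CARD('n) / 2))"
    unfolding D by (subst nn_integral_gauss_PiM) (use assms in auto)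
  finally show ?thesis .
qed

section \<open>Affine planes and their rotations\<close>

text \<open>Pythagoras: the distance from \<open>y\<close> is minimal at the point \<open>q\<close>
  of the plane for which \<open>y - q\<close> is normal to the plane. The projections onto frames,
  row planes and rotated planes are all identified by this criterion.\<close>

lemma closest_point_translate_subspace:
  fixes V :: "'a::euclidean_space set"
  assumes V: "subspace V" and q: "q - x \<in> V" and orth: "\<And>v. v \<in> V \<Longrightarrow> (y - q) \<bullet> v = 0"
  shows "closest_point ((+) x ` V) y = q"
proof (rule closest_point_unique[symmetric])
  show "convex ((+) x ` V)" using V by (simp add: subspace_imp_convex convex_translation)
  show "closed ((+) x ` V)" using V by (simp add: closed_subspace closed_translation)
  show "q \<in> (+) x ` V" using q by (auto intro: image_eqI[of _ _ "q - x"])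
  show "\<forall>z\<in>(+) x ` V. dist y q \<le> dist y z"
  proof
    fix z assume "z \<in> (+) x ` V"
    then obtain v where v: "z = x + v" "v \<in> V" by auto
    have "(q - x) - v \<in> V" using V q v by (simp add: subspace_diff)
    then have "(y - q) \<bullet> (q - z) = 0" using orth v by (simp add: diff_diff_eq)
    then have "orthogonal (y - q) (q - z)" by (simp add: orthogonal_def)
    then have "(norm ((y - q) + (q - z)))\<^sup>2 = (norm (y - q))\<^sup>2 + (norm (q - z))\<^sup>2"
      by (rule norm_add_Pythagorean)
    then have "(norm (y - q))\<^sup>2 \<le> (norm (y - z))\<^sup>2" by simp
    then show "dist y q \<le> dist y z" by (simp add: dist_norm)
  qed
qed

lemma range_frame_map:
  assumes "orthonormal_frame k b"
  shows "range (frame_map k p b) = (+) p ` span (b ` {..<k})"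
proof -
  have "(\<Sum>v\<in>b ` {..<k}. u v *\<^sub>R v) = (\<Sum>i<k. u (b i) *\<^sub>R b i)" for u
    using sum.reindex[OF orthonormal_frame_inj[OF assms]] by simp
  then have "span (b ` {..<k}) = range (\<lambda>u. \<Sum>i<k. u (b i) *\<^sub>R b i)"
    by (simp add: span_finite)
  \<comment> \<open>\<open>span_finite\<close> indexes the coefficients by vectors; as
    \<open>b\<close> is injective on the indices, they can be indexed by numbers instead.\<close>
  also have "\<dots> = range (\<lambda>t. \<Sum>i<k. t i *\<^sub>R b i)"
  proof (intro equalityI subsetI)
    fix y assume "y \<in> range (\<lambda>t. \<Sum>i<k. t i *\<^sub>R b i)"
    then obtain t where t: "y = (\<Sum>i<k. t i *\<^sub>R b i)" by auto
    have "y = (\<Sum>i<k. (t \<circ> the_inv_into {..<k} b) (b i) *\<^sub>R b i)"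
      unfolding t by (intro sum.cong) (simp_all add: the_inv_into_f_f[OF orthonormal_frame_inj[OF assms]])
    then show "y \<in> range (\<lambda>u. \<Sum>i<k. u (b i) *\<^sub>R b i)" by blast
  next
    fix y assume "y \<in> range (\<lambda>u. \<Sum>i<k. u (b i) *\<^sub>R b i)"
    then obtain u where "y = (\<Sum>i<k. (u \<circ> b) i *\<^sub>R b i)" by auto
    then show "y \<in> range (\<lambda>t. \<Sum>i<k. t i *\<^sub>R b i)" by blast
  qed
  finally have "span (b ` {..<k}) = range (\<lambda>t. \<Sum>i<k. t i *\<^sub>R b i)" .
  then show ?thesis by (simp add: frame_map_def[abs_def] image_image)
qed

lemma frame_projection_orthogonal:
  assumes "orthonormal_frame k b" "v \<in> span (b ` {..<k})"
  shows "(y - frame_map k p b (\<lambda>i. (y - p) \<bullet> b i)) \<bullet> v = 0"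
proof -
  have "orthogonal (y - frame_map k p b (\<lambda>i. (y - p) \<bullet> b i)) w" if w: "w \<in> b ` {..<k}" for w
  proof -
    obtain i where i: "i < k" "w = b i" using w by blast
    then show ?thesis using frame_map_inner[OF assms(1) i(1), of p "\<lambda>i. (y - p) \<bullet> b i"]
      by (simp add: orthogonal_def inner_diff_left)
  qed
  then show ?thesis using orthogonal_to_span[OF assms(2)] by (auto simp: orthogonal_def)
qed

lemma closest_point_frame:
  assumes "orthonormal_frame k b"
  shows "closest_point (range (frame_map k p b)) y = frame_map k p b (\<lambda>i. (y - p) \<bullet> b i)"
  unfolding range_frame_map[OF assms]
proof (rule closest_point_translate_subspace)
  let ?q = "frame_map k p b (\<lambda>i. (y - p) \<bullet> b i)"
  show "?q - p \<in> span (b ` {..<k})"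
    unfolding frame_map_def add_diff_cancel_left' by (intro span_sum span_scale span_base) simp
  show "(y - ?q) \<bullet> v = 0" if "v \<in> span (b ` {..<k})" for v
    by (rule frame_projection_orthogonal[OF assms that])
qed simp

lemma kplanes_through_iff:
  fixes x :: "real ^ 'n"
  shows "\<xi> \<in> kplanes_through k x \<longleftrightarrow> (\<exists>V. subspace V \<and> dim V = k \<and> \<xi> = (+) x ` V)"
proof
  assume "\<xi> \<in> kplanes_through k x"
  then have \<xi>: "affine \<xi>" "aff_dim \<xi> = int k" "x \<in> \<xi>" by (auto simp: kplanes_through_def kplanes_def)
  let ?V = "(\<lambda>y. y - x) ` \<xi>"
  have "subspace ?V" using affine_diffs_subspace_subtract \<xi> by blast
  moreover have "dim ?V = k" using aff_dim_dim_affine_diffs[of \<xi> x] \<xi> by simp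
  moreover have "\<xi> = (+) x ` ?V" by (auto simp: image_image)
  ultimately show "\<exists>V. subspace V \<and> dim V = k \<and> \<xi> = (+) x ` V" by blast
next
  assume "\<exists>V. subspace V \<and> dim V = k \<and> \<xi> = (+) x ` V"
  then obtain V where V: "subspace V" "dim V = k" "\<xi> = (+) x ` V" by blast
  have "affine \<xi>" using V by (simp add: subspace_imp_affine affine_translation[symmetric])
  moreover have "aff_dim \<xi> = int k" using V by (simp add: aff_dim_translation_eq aff_dim_subspace)
  moreover have "x \<in> \<xi>" using V subspace_0 by (force intro: image_eqI[of _ _ 0])
  ultimately show "\<xi> \<in> kplanes_through k x" by (simp add: kplanes_through_def kplanes_def)
qed

lemma kplanes_through_frame:
  fixes x :: "real ^ 'n"
  assumes "\<xi> \<in> kplanes_through k x"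
  obtains b where "orthonormal_frame k b" "\<xi> = range (frame_map k x b)"
proof -
  obtain V where V: "subspace V" "dim V = k" "\<xi> = (+) x ` V"
    using assms kplanes_through_iff by blast
  obtain b where "orthonormal_frame k b" "span (b ` {..<k}) = V"
    using orthonormal_frame_of_subspace[OF V(1)] V(2) by metis
  then show thesis using that[of b] V(3) range_frame_map by blast
qed

text \<open>On the right the frame occurs only through the plane. This gives both the independence
  of the Cartesian coordinates and a description by the projection, the object that the topology of
  the Grassmannian controls.\<close>

lemma distr_frame_map:
  fixes b :: "nat \<Rightarrow> real ^ 'n" and p :: "real ^ 'n"
  assumes b: "orthonormal_frame k b"
  defines "\<xi> \<equiv> range (frame_map k p b)"
  shows "closest_point \<xi> \<in> borel_measurable borel"
    and "distr (\<Pi>\<^sub>M i\<in>{..<k}. lborel) borel (frame_map k p b)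
      = distr (density lborel (\<lambda>y. ennreal (exp (- (pi * (norm (y - closest_point \<xi> y))\<^sup>2))))) borel (closest_point \<xi>)"
proof -
  have cp: "closest_point \<xi> = (\<lambda>y. frame_map k p b (\<lambda>i. (y - p) \<bullet> b i))"
    by (rule ext) (simp add: \<xi>_def closest_point_frame[OF b])
  show [measurable]: "closest_point \<xi> \<in> borel_measurable borel"
    unfolding cp frame_map_def by measurable
  show "distr (\<Pi>\<^sub>M i\<in>{..<k}. lborel) borel (frame_map k p b)
      = distr (density lborel (\<lambda>y. ennreal (exp (- (pi * (norm (y - closest_point \<xi> y))\<^sup>2))))) borel (closest_point \<xi>)"
    (is "?L = ?R")
  proof (rule measure_eqI)
    fix B assume "B \<in> sets ?L"
    then have [measurable]: "B \<in> sets borel" by simp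
    have "emeasure ?L B = (\<integral>\<^sup>+t. indicator B (frame_map k p b t) \<partial>(\<Pi>\<^sub>M i\<in>{..<k}. lborel))"
      by (subst nn_integral_indicator[symmetric], simp, subst nn_integral_distr) auto
    also have "\<dots> = (\<integral>\<^sup>+y. ennreal (exp (- (pi * (norm (y - closest_point \<xi> y))\<^sup>2))) * indicator B (closest_point \<xi> y) \<partial>lborel)"
      unfolding cp by (rule nn_integral_frame[OF b]) measurable
    also have "\<dots> = emeasure ?R B"
      by (subst nn_integral_indicator[symmetric], simp, subst nn_integral_distr, simp, simp, subst nn_integral_density) auto
    finally show "emeasure ?L B = emeasure ?R B" .
  qed simp
qed

text \<open>Resolves the choice in \<open>kplane_lborel\<close>: by the Gaussian formula, all frames
  of the same plane induce the same measure.\<close>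

lemma kplane_lborel_eq:
  fixes p :: "real ^ 'n"
  assumes b: "orthonormal_frame k b" and \<xi>: "\<xi> = range (frame_map k p b)"
  shows "kplane_lborel k \<xi> = distr (\<Pi>\<^sub>M i\<in>{..<k}. lborel) borel (frame_map k p b)"
proof -
  have "\<exists>p' b'. orthonormal_frame k b' \<and> \<xi> = range (frame_map k p' b') \<and>
     kplane_lborel k \<xi> = distr (\<Pi>\<^sub>M i\<in>{..<k}. lborel) borel (frame_map k p' b')"
    unfolding kplane_lborel_def using b \<xi>
    by (rule_tac someI[where x = "distr (\<Pi>\<^sub>M i\<in>{..<k}. lborel) borel (frame_map k p b)"]) blast
  then obtain p' b' where b': "orthonormal_frame k b'" "\<xi> = range (frame_map k p' b')"
    "kplane_lborel k \<xi> = distr (\<Pi>\<^sub>M i\<in>{..<k}. lborel) borel (frame_map k p' b')" by blast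
  show ?thesis
    unfolding b'(3) distr_frame_map(2)[OF b'(1)] distr_frame_map(2)[OF b] b'(2)[symmetric] \<xi>[symmetric] ..
qed

lemma measurable_closest_point:
  assumes "\<xi> \<in> kplanes_through k x"
  shows "closest_point \<xi> \<in> borel_measurable borel"
  using kplanes_through_frame[OF assms] distr_frame_map(1) by metis

lemma kplane_lborel_gauss:
  assumes "\<xi> \<in> kplanes_through k x"
  shows "kplane_lborel k \<xi> =
    distr (density lborel (\<lambda>y. ennreal (exp (- (pi * (norm (y - closest_point \<xi> y))\<^sup>2))))) borel (closest_point \<xi>)"
proof -
  obtain b where b: "orthonormal_frame k b" "\<xi> = range (frame_map k x b)"
    using kplanes_through_frame[OF assms] .
  show ?thesis unfolding kplane_lborel_eq[OF b] unfolding b(2) by (rule distr_frame_map(2)[OF b(1)])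
qed

lemma emeasure_kplane_cball:
  assumes "\<xi> \<in> kplanes_through k x" "r > 0"
  shows "emeasure (kplane_lborel k \<xi>) (cball x r) = ennreal (unit_ball_vol k * r ^ k)"
proof -
  obtain b where b: "orthonormal_frame k b" "\<xi> = range (frame_map k x b)"
    using kplanes_through_frame[OF assms(1)] .
  let ?M = "\<Pi>\<^sub>M i\<in>{..<k}. lborel :: real measure"
  have "norm (frame_map k x b t - x) = sqrt (\<Sum>i<k. (t i)\<^sup>2)" for t
    using orthonormal_frame_norm[OF b(1), of t] by (simp add: frame_map_def real_sqrt_unique)
  then have "frame_map k x b -` cball x r \<inter> space ?M = {t. sqrt (\<Sum>i<k. (t i)\<^sup>2) \<le> r} \<inter> space ?M"
    by (auto simp: dist_norm norm_minus_commute)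
  then show ?thesis
    unfolding kplane_lborel_eq[OF b] using emeasure_cball_aux[of "{..<k}" r] assms(2)
    by (subst emeasure_distr) simp_all
qed

section \<open>Rotations about a point and their action on planes\<close>

lemma rotation_matrix_orthogonal:
  assumes "rotation_matrix (A :: real^'n^'n)"
  shows "A ** transpose A = mat 1" "transpose A ** A = mat 1" "orthogonal_transformation ((*v) A)"
    "rotation_matrix (transpose A)"
  using assms
  by (auto simp: rotation_matrix_def orthogonal_matrix_def orthogonal_transformation_matrix det_transpose)

lemma rotate_about_inverse:
  assumes "rotation_matrix A"
  shows "rotate_about x A (rotate_about x (transpose A) y) = y"
    "rotate_about x (transpose A) (rotate_about x A y) = y"
  using rotation_matrix_orthogonal(1,2)[OF assms]
  by (simp_all add: rotate_about_def matrix_vector_mul_assoc del: transpose_matrix_vector)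

lemma rotate_about_continuous: "continuous_on S (rotate_about x A)"
  unfolding rotate_about_def[abs_def]
  by (intro continuous_intros linear_continuous_on_compose[OF _ matrix_vector_mul_linear])

lemma rotate_about_measurable [measurable]: "rotate_about x A \<in> borel_measurable borel"
  by (intro borel_measurable_continuous_onI rotate_about_continuous)

text \<open>Rotating a plane conjugates its projection. The action on planes thereby becomes an
  action on functions, where continuity can be tested pointwise.\<close>

lemma rotate_kplane:
  assumes A: "rotation_matrix A" and \<xi>: "\<xi> \<in> kplanes_through k x"
  shows "rotate_about x A ` \<xi> \<in> kplanes_through k x"
    and "closest_point (rotate_about x A ` \<xi>) = (\<lambda>y. rotate_about x A (closest_point \<xi> (rotate_about x (transpose A) y)))"
proof -
  obtain V where V: "subspace V" "dim V = k" "\<xi> = (+) x ` V"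
    using \<xi> kplanes_through_iff by blast
  note AT = rotation_matrix_orthogonal[OF A]
  have lin: "linear ((*v) A)" by (rule matrix_vector_mul_linear)
  have "inj ((*v) A)" using AT(3) by (rule orthogonal_transformation_inj)
  then have dimA: "dim ((*v) A ` V) = k" using V(2) lin by (simp add: dim_image_eq inj_on_subset)
  have sub: "subspace ((*v) A ` V)" using V(1) lin by (simp add: linear_subspace_image)
  have img: "rotate_about x A ` \<xi> = (+) x ` ((*v) A ` V)"
    by (auto simp: V(3) rotate_about_def image_image)
  show "rotate_about x A ` \<xi> \<in> kplanes_through k x"
    unfolding kplanes_through_iff using dimA sub img by blast
  show "closest_point (rotate_about x A ` \<xi>) = (\<lambda>y. rotate_about x A (closest_point \<xi> (rotate_about x (transpose A) y)))"
  proof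
    fix y
    obtain b where b: "orthonormal_frame k b" "\<xi> = range (frame_map k x b)"
      using kplanes_through_frame[OF \<xi>] .
    let ?z = "rotate_about x (transpose A) y"
    let ?q = "closest_point \<xi> ?z"
    have V': "V = span (b ` {..<k})"
      using range_frame_map[OF b(1), of x] b(2) V(3) by (metis inj_image_eq_iff inj_on_add)
    have q: "?q = frame_map k x b (\<lambda>i. (?z - x) \<bullet> b i)" using closest_point_frame[OF b(1), of x ?z] b(2) by simp
    have qV: "?q - x \<in> V"
      unfolding q V' frame_map_def add_diff_cancel_left' by (intro span_sum span_scale span_base) simp
    have orth: "(?z - ?q) \<bullet> v = 0" if "v \<in> V" for v
      unfolding q by (rule frame_projection_orthogonal[OF b(1)]) (use that V' in simp)
    show "closest_point (rotate_about x A ` \<xi>) y = rotate_about x A ?q"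
      unfolding img
    proof (rule closest_point_translate_subspace[OF sub])
      show "rotate_about x A ?q - x \<in> (*v) A ` V" using qV by (auto simp: rotate_about_def)
      fix v assume "v \<in> (*v) A ` V"
      then obtain w where w: "v = A *v w" "w \<in> V" by auto
      have "y - rotate_about x A ?q = rotate_about x A ?z - rotate_about x A ?q"
        by (simp add: rotate_about_inverse[OF A])
      also have "\<dots> = A *v (?z - ?q)"
        using matrix_vector_mult_diff_distrib[of A "?z - x" "?q - x"] by (simp add: rotate_about_def[of x A])
      finally show "(y - rotate_about x A ?q) \<bullet> v = 0"
        using AT(3) orth[OF w(2)] w(1) by (simp add: orthogonal_transformation_def)
    qed
  qed
qed

lemma grassmann_open_iff:
  "openin (grassmann_topology k x) U \<longleftrightarrow> (\<exists>W. open W \<and> U = closest_point -` W \<inter> kplanes_through k x)"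
  by (simp add: grassmann_topology_def openin_pullback_topology)

text \<open>On projections the rotation acts as the conjugation \<open>\<Phi>\<close>, which is
  continuous for pointwise convergence. Hence preimages of the open generators are open.\<close>

lemma measurable_rotate_image:
  assumes \<mu>: "space \<mu> = kplanes_through k x"
    "sets \<mu> = sigma_sets (kplanes_through k x) {U. openin (grassmann_topology k x) U}"
    and A: "rotation_matrix A"
  shows "(`) (rotate_about x A) \<in> measurable \<mu> \<mu>"
proof (rule measurable_sigma_sets[OF \<mu>(2)])
  show "{U. openin (grassmann_topology k x) U} \<subseteq> Pow (kplanes_through k x)"
    unfolding grassmann_open_iff by blast
  show "(`) (rotate_about x A) \<in> space \<mu> \<rightarrow> kplanes_through k x"
    using rotate_kplane(1)[OF A] by (simp add: \<mu>(1))
  fix U assume "U \<in> {U. openin (grassmann_topology k x) U}"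
  then obtain W where W: "open W" "U = closest_point -` W \<inter> kplanes_through k x"
    by (auto simp: grassmann_open_iff)
  define \<Phi> where "\<Phi> = (\<lambda>\<phi> y. rotate_about x A (\<phi> (rotate_about x (transpose A) y)))"
  have "continuous_on UNIV (\<lambda>\<phi>. \<Phi> \<phi> y)" for y
    unfolding \<Phi>_def
    by (rule continuous_on_compose2[OF rotate_about_continuous[of UNIV x A] continuous_on_product_coordinates]) simp
  then have "continuous_on UNIV \<Phi>"
    by (rule continuous_on_coordinatewise_then_product)
  then have "open (\<Phi> -` W)" by (rule open_vimage[OF W(1)])
  moreover have "(`) (rotate_about x A) -` U \<inter> space \<mu> = closest_point -` (\<Phi> -` W) \<inter> kplanes_through k x"
  proof -
    have "rotate_about x A ` \<xi> \<in> U \<longleftrightarrow> \<Phi> (closest_point \<xi>) \<in> W" if "\<xi> \<in> kplanes_through k x" for \<xi>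
      using rotate_kplane[OF A that] by (simp only: \<Phi>_def W(2) Int_iff vimage_eq simp_thms)
    then show ?thesis unfolding \<mu>(1) by (simp only: set_eq_iff Int_iff vimage_eq) metis
  qed
  ultimately have op: "openin (grassmann_topology k x) ((`) (rotate_about x A) -` U \<inter> space \<mu>)"
    unfolding grassmann_open_iff by (intro exI[of _ "\<Phi> -` W"] conjI)
  show "(`) (rotate_about x A) -` U \<inter> space \<mu> \<in> sets \<mu>"
    unfolding \<mu>(2) by (rule sigma_sets.Basic, rule CollectI, rule op)
qed

lemma measurable_closest_point_kplane:
  fixes x :: "real ^ 'n"
  assumes \<mu>: "space \<mu> = kplanes_through k x"
    "sets \<mu> = sigma_sets (kplanes_through k x) {U. openin (grassmann_topology k x) U}"
  shows "(\<lambda>\<xi>. closest_point \<xi> y) \<in> borel_measurable \<mu>"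
proof (rule borel_measurableI)
  fix S :: "(real ^ 'n) set" assume "open S"
  then have "open ((\<lambda>\<phi>. \<phi> y) -` S :: (real ^ 'n \<Rightarrow> real ^ 'n) set)"
    by (rule open_vimage) simp
  moreover have "(\<lambda>\<xi>. closest_point \<xi> y) -` S \<inter> space \<mu> = closest_point -` ((\<lambda>\<phi>. \<phi> y) -` S) \<inter> kplanes_through k x"
    by (auto simp: \<mu>)
  ultimately have "openin (grassmann_topology k x) ((\<lambda>\<xi>. closest_point \<xi> y) -` S \<inter> space \<mu>)"
    using grassmann_open_iff by blast
  then show "(\<lambda>\<xi>. closest_point \<xi> y) -` S \<inter> space \<mu> \<in> sets \<mu>"
    using \<mu> by (simp add: sigma_sets.Basic)
qed

section \<open>Existence of the invariant probability\<close>

lemma continuous_on_det: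
  fixes M :: "'a::topological_space \<Rightarrow> real ^ 'n ^ 'n"
  assumes "\<And>i j. continuous_on S (\<lambda>v. M v $ i $ j)"
  shows "continuous_on S (\<lambda>v. det (M v))"
  unfolding det_def by (intro continuous_intros assms)

lemma matrix_inv_det:
  fixes M :: "real ^ 'n ^ 'n"
  assumes "det M \<noteq> 0"
  shows "M ** matrix_inv M = mat 1" "matrix_inv M ** M = mat 1"
proof -
  have "\<exists>N. M ** N = mat 1 \<and> N ** M = mat 1"
    using assms by (simp add: invertible_det_nz[symmetric] invertible_def)
  then have "M ** matrix_inv M = mat 1 \<and> matrix_inv M ** M = mat 1"
    unfolding matrix_inv_def by (rule someI_ex)
  then show "M ** matrix_inv M = mat 1" "matrix_inv M ** M = mat 1" by auto
qed

text \<open>Cramer's rule writes the entries of the inverse as quotients of determinants, so that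
  their continuity reduces to that of \<open>det\<close>.\<close>

lemma matrix_inv_cramer:
  fixes M :: "real ^ 'n ^ 'n"
  assumes "det M \<noteq> 0"
  shows "matrix_inv M $ j $ i = det (\<chi> a c. if c = j then (if a = i then 1 else 0) else M $ a $ c) / det M"
proof -
  have "M ** matrix_inv M = mat 1"
    by (rule matrix_inv_det(1)[OF assms])
  then have "M *v (matrix_inv M *v axis i 1) = axis i 1"
    by (simp add: matrix_vector_mul_assoc)
  then have "matrix_inv M *v axis i 1 = (\<chi> k. det (\<chi> a c. if c = k then axis i 1 $ a else M $ a $ c) / det M)"
    using cramer[OF assms] by blast
  then have "(matrix_inv M *v axis i 1) $ j = det (\<chi> a c. if c = j then axis i 1 $ a else M $ a $ c) / det M"
    by simp
  moreover have "(\<chi> a c. if c = j then axis i 1 $ a else M $ a $ c) =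
      (\<chi> a c. if c = j then (if a = i then 1 else 0) else M $ a $ c)"
    by (simp add: vec_eq_iff axis_def)
  moreover have "(matrix_inv M *v axis i 1) $ j = matrix_inv M $ j $ i"
    by (simp only: matrix_vector_mult_basis column_def vec_lambda_beta)
  ultimately show ?thesis by simp
qed

lemma continuous_on_matrix_inv:
  fixes M :: "'a::topological_space \<Rightarrow> real ^ 'n ^ 'n"
  assumes M: "\<And>i j. continuous_on S (\<lambda>v. M v $ i $ j)" and nz: "\<And>v. v \<in> S \<Longrightarrow> det (M v) \<noteq> 0"
  shows "continuous_on S (\<lambda>v. matrix_inv (M v) $ j $ i)"
proof -
  have "continuous_on S (\<lambda>v. det (\<chi> a c. if c = j then (if a = i then 1 else 0) else M v $ a $ c) / det (M v))"
  proof (intro continuous_on_divide continuous_on_det M)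
    fix a c
    show "continuous_on S (\<lambda>v. (\<chi> a c. if c = j then (if a = i then 1 else 0) else M v $ a $ c) $ a $ c)"
      by (cases "c = j") (simp_all add: M)
  qed (use nz in auto)
  then show ?thesis
    by (rule continuous_on_eq) (simp only: matrix_inv_cramer[OF nz])
qed

text \<open>A full square matrix is carried along although the plane depends on the rows in
  \<open>J\<close>: its determinant tests the independence of these rows, and its inverse supplies
  the equations that cut out their span.\<close>

definition row_plane :: "'n set \<Rightarrow> real ^ 'n \<Rightarrow> real ^ 'n ^ 'n \<Rightarrow> (real ^ 'n) set" where
  "row_plane J x M = (+) x ` span ((\<lambda>i. M $ i) ` J)"

text \<open>The projection onto the span of the rows \<open>i \<in> J\<close> is the solution of a nonsingular linear
  system whose coefficients depend continuously on \<open>M\<close>: the rows \<open>i \<notin> J\<close> of the system say that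
  the coordinates with respect to the other rows of \<open>M\<close> vanish.\<close>

definition row_system :: "'n set \<Rightarrow> real ^ 'n ^ 'n \<Rightarrow> real ^ 'n ^ 'n" where
  "row_system J M = (\<chi> i. if i \<in> J then M $ i else (\<chi> j. matrix_inv M $ j $ i))"

lemma row_system_span:
  fixes M :: "real ^ 'n ^ 'n"
  assumes nz: "det M \<noteq> 0" and q: "\<And>i. i \<notin> J \<Longrightarrow> (row_system J M *v q) $ i = 0"
  shows "q \<in> span ((\<lambda>i. M $ i) ` J)"
proof -
  define c where "c = q v* matrix_inv M"
  have c0: "c $ i = 0" if "i \<notin> J" for i
    using q[OF that] that
    by (simp add: c_def row_system_def matrix_vector_mult_def vector_matrix_mult_def mult.commute)
  have "matrix_inv M ** M = mat 1"
    by (rule matrix_inv_det(2)[OF nz])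
  then have "q = c v* M" by (simp add: c_def vector_matrix_mul_assoc)
  also have "c v* M = (\<Sum>i\<in>UNIV. c $ i *\<^sub>R M $ i)"
    by (simp add: vec_eq_iff vector_matrix_mult_def mult.commute)
  also have "\<dots> = (\<Sum>i\<in>J. c $ i *\<^sub>R M $ i)"
    using c0 by (intro sum.mono_neutral_right) auto
  finally show ?thesis by (simp add: span_sum span_scale span_base)
qed

lemma row_system_component:
  "i \<in> J \<Longrightarrow> (row_system J M *v q) $ i = M $ i \<bullet> q"
  by (simp add: row_system_def matrix_vector_mult_def inner_vec_def)

text \<open>A vector in the kernel lies in the span of the rows in \<open>J\<close> and is
  orthogonal to each of them, hence to itself.\<close>

lemma det_row_system:
  fixes M :: "real ^ 'n ^ 'n"
  assumes nz: "det M \<noteq> 0"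
  shows "det (row_system J M) \<noteq> 0"
proof -
  have "q = 0" if q: "row_system J M *v q = 0" for q
  proof -
    have "q \<in> span ((\<lambda>i. M $ i) ` J)" using row_system_span[OF nz] q by simp
    moreover have "orthogonal q w" if w: "w \<in> (\<lambda>i. M $ i) ` J" for w
      using w q row_system_component[of _ J M q] by (auto simp: orthogonal_def inner_commute)
    ultimately have "orthogonal q q" using orthogonal_to_span by blast
    then show ?thesis by (simp add: orthogonal_self)
  qed
  then have "\<exists>B. B ** row_system J M = mat 1" using matrix_left_invertible_ker by blast
  then have "invertible (row_system J M)" by (simp add: invertible_left_inverse)
  then show ?thesis by (simp add: invertible_det_nz)
qed

text \<open>The equations with \<open>i \<in> J\<close> prescribe the inner products of the
  projection with the spanning rows; the homogeneous ones force it into their span.\<close>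

lemma closest_point_row_plane:
  fixes M :: "real ^ 'n ^ 'n"
  assumes nz: "det M \<noteq> 0"
  shows "closest_point (row_plane J x M) z
    = x + matrix_inv (row_system J M) *v (\<chi> i. if i \<in> J then M $ i \<bullet> (z - x) else 0)"
proof -
  let ?L = "row_system J M" and ?b = "\<chi> i. if i \<in> J then M $ i \<bullet> (z - x) else 0"
  define q where "q = matrix_inv ?L *v ?b"
  have "?L ** matrix_inv ?L = mat 1"
    by (rule matrix_inv_det(1)[OF det_row_system[OF nz]])
  then have Lq: "?L *v q = ?b" by (simp add: q_def matrix_vector_mul_assoc)
  have "closest_point ((+) x ` span ((\<lambda>i. M $ i) ` J)) z = x + q"
  proof (rule closest_point_translate_subspace)
    show "x + q - x \<in> span ((\<lambda>i. M $ i) ` J)" using row_system_span[OF nz] Lq by simp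
    have "orthogonal (z - (x + q)) w" if w: "w \<in> (\<lambda>i. M $ i) ` J" for w
    proof -
      obtain i where i: "i \<in> J" "w = M $ i" using w by blast
      have "M $ i \<bullet> q = M $ i \<bullet> (z - x)" using row_system_component[OF i(1), of M q] i(1) Lq by simp
      then show ?thesis by (simp add: i orthogonal_def inner_commute inner_diff_right inner_add_right)
    qed
    then show "(z - (x + q)) \<bullet> v = 0" if "v \<in> span ((\<lambda>i. M $ i) ` J)" for v
      using orthogonal_to_span[OF that] by (auto simp: orthogonal_def)
  qed simp
  then show ?thesis by (simp add: row_plane_def q_def)
qed

lemma row_plane_kplane:
  fixes M :: "real ^ 'n ^ 'n"
  assumes nz: "det M \<noteq> 0"
  shows "row_plane J x M \<in> kplanes_through (card J) x"
proof -
  have inj: "inj (\<lambda>i. M $ i)"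
  proof (rule injI, rule ccontr)
    fix i j assume "M $ i = M $ j" "i \<noteq> j"
    then have "det M = 0" by (intro det_identical_rows[of i j]) (auto simp: row_def)
    then show False using nz by simp
  qed
  have "q \<in> span (range (\<lambda>i. M $ i))" for q
    using row_system_span[OF nz, of UNIV q] by simp
  then have "independent (range (\<lambda>i. M $ i))"
    using inj by (intro card_le_dim_spanning[of _ UNIV]) (auto simp: card_image)
  then have "independent ((\<lambda>i. M $ i) ` J)" by (metis image_mono independent_mono subset_UNIV)
  then have "dim (span ((\<lambda>i. M $ i) ` J)) = card J"
    using inj by (simp add: dim_eq_card_independent card_image inj_on_subset)
  then show ?thesis unfolding kplanes_through_iff row_plane_def using subspace_span by blast
qed

lemma rotate_row_plane:
  "rotate_about x A ` row_plane J x M = row_plane J x (\<chi> i. A *v (M $ i))"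
proof -
  have "(*v) A ` span ((\<lambda>i. M $ i) ` J) = span ((\<lambda>i. A *v (M $ i)) ` J)"
    by (subst span_linear_image[symmetric]) (simp_all add: image_image)
  then show ?thesis
    by (simp add: row_plane_def image_image rotate_about_def flip: image_image[of _ "(*v) A"])
qed

lemma det_rotate_rows:
  fixes A M :: "real ^ 'n ^ 'n"
  assumes "rotation_matrix A"
  shows "det (\<chi> i. A *v (M $ i)) = det M"
proof -
  have "(\<chi> i. A *v (M $ i)) = M ** transpose A"
    by (simp add: vec_eq_iff matrix_matrix_mult_def matrix_vector_mult_def transpose_def mult.commute)
  then show ?thesis using assms by (simp add: det_mul det_transpose rotation_matrix_def)
qed

text \<open>The law of \<open>x\<close> plus the span of \<open>k\<close> fixed rows of a random invertible matrix, uniform with respect to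
  Lebesgue measure in the unit ball. The matrix is encoded as a vector indexed by pairs, so that a rotation of
  its rows is an orthogonal transformation of a Euclidean space.\<close>

lemma rotation_invariant_prob_exists:
  fixes x :: "real ^ 'n"
  assumes k: "k \<le> CARD('n)"
  shows "\<exists>\<mu>. rotation_invariant_prob k x \<mu>"
proof -
  obtain J :: "'n set" where J: "card J = k"
    using obtain_subset_with_card_n[OF k] by metis
  let ?K = "kplanes_through k x"
  let ?G = "{U. openin (grassmann_topology k x) U}"
  define mx :: "real ^ ('n \<times> 'n) \<Rightarrow> real ^ 'n ^ 'n" where "mx v = (\<chi> i j. v $ (i, j))" for v
  define \<Omega> where "\<Omega> = ball 0 1 \<inter> {v. det (mx v) \<noteq> 0}"
  \<comment> \<open>At singular matrices \<open>T\<close> takes a default plane, which makes it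
    total and Borel; \<open>\<Omega>\<close> contains no such matrix.\<close>
  define T where "T v = (if det (mx v) \<noteq> 0 then row_plane J x (mx v) else row_plane J x (mat 1))" for v
  have TK: "T v \<in> ?K" for v
    unfolding T_def using row_plane_kplane[of _ J x] J by auto
  have mx_cont: "continuous_on S (\<lambda>v. mx v $ i $ j)" for S i j
    unfolding mx_def by (auto intro!: continuous_intros)
  have det_cont: "continuous_on UNIV (\<lambda>v. det (mx v))" by (intro continuous_on_det mx_cont)
  have open_D: "open {v. det (mx v) \<noteq> 0}"
    by (rule open_Collect_neq[OF det_cont continuous_on_const])
  then have open_\<Omega>: "open \<Omega>" unfolding \<Omega>_def by (intro open_Int) auto
  then have [measurable]: "\<Omega> \<in> sets borel" by simp
  have "\<exists>v. v \<in> \<Omega>"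
  proof -
    \<comment> \<open>\<open>w\<close> encodes the identity matrix, and \<open>c\<close> shrinks it
      into the unit ball. So the open set \<open>\<Omega>\<close> is nonempty and has positive
      measure.\<close>
    define w :: "real ^ ('n \<times> 'n)" where "w = (\<chi> p. if fst p = snd p then 1 else 0)"
    define c where "c = 1 / (1 + norm w)"
    have c: "c > 0" unfolding c_def by (simp add: add_pos_nonneg)
    have "det (mx (c *\<^sub>R w)) = (\<Prod>i\<in>UNIV. mx (c *\<^sub>R w) $ i $ i)"
      by (rule det_diagonal) (simp add: mx_def w_def)
    then have "det (mx (c *\<^sub>R w)) \<noteq> 0" using c by (simp add: mx_def w_def)
    moreover have "norm (c *\<^sub>R w) < 1" by (simp add: c_def divide_simps add_pos_nonneg)
    ultimately have "c *\<^sub>R w \<in> \<Omega>" unfolding \<Omega>_def by (simp only: Int_iff mem_ball_0 mem_Collect_eq simp_thms)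
    then show ?thesis ..
  qed
  then obtain v0 where "v0 \<in> \<Omega>" by blast
  then obtain e where e: "e > 0" "cball v0 e \<subseteq> \<Omega>" using open_\<Omega> open_contains_cball by blast
  have "0 < emeasure lborel (cball v0 e)"
    using e(1) by (subst emeasure_cball) (auto intro!: mult_pos_pos)
  also have "\<dots> \<le> emeasure lborel \<Omega>" using e(2) by (intro emeasure_mono) auto
  finally have pos: "emeasure lborel \<Omega> \<noteq> 0" by simp
  have "emeasure lborel \<Omega> \<le> emeasure lborel (ball (0 :: real ^ ('n \<times> 'n)) 1)"
    by (intro emeasure_mono) (auto simp: \<Omega>_def)
  also have "\<dots> < \<infinity>" by (simp add: emeasure_ball)
  finally have fin: "emeasure lborel \<Omega> \<noteq> \<infinity>" by simp
  have cp_cont: "continuous_on {v. det (mx v) \<noteq> 0} (\<lambda>v. closest_point (row_plane J x (mx v)))"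
  proof (rule continuous_on_coordinatewise_then_product)
    fix z :: "real ^ 'n"
    let ?D = "{v. det (mx v) \<noteq> 0}"
    have rs: "continuous_on ?D (\<lambda>v. row_system J (mx v) $ i $ j)" for i j
    proof (cases "i \<in> J")
      case False
      have "continuous_on ?D (\<lambda>v. matrix_inv (mx v) $ j $ i)"
        by (rule continuous_on_matrix_inv[OF mx_cont]) simp
      with False show ?thesis by (simp add: row_system_def)
    qed (simp add: row_system_def mx_cont)
    have "continuous_on ?D (\<lambda>v. matrix_inv (row_system J (mx v)) $ i $ j)" for i j
      by (rule continuous_on_matrix_inv[OF rs]) (auto simp: det_row_system)
    moreover have "continuous_on ?D (\<lambda>v. (if i \<in> J then mx v $ i \<bullet> (z - x) else 0))" for i
      by (cases "i \<in> J") (auto simp: inner_vec_def intro!: continuous_intros mx_cont)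
    ultimately have "continuous_on ?D (\<lambda>v. x + matrix_inv (row_system J (mx v)) *v (\<chi> i. if i \<in> J then mx v $ i \<bullet> (z - x) else 0))"
      unfolding matrix_vector_mult_def
      by (intro continuous_on_add continuous_on_const continuous_on_vec_lambda continuous_on_sum continuous_on_mult) simp_all
    then show "continuous_on ?D (\<lambda>v. closest_point (row_plane J x (mx v)) z)"
      by (rule continuous_on_eq) (simp add: closest_point_row_plane)
  qed
  define \<sigma> where "\<sigma> = sigma ?K ?G"
  have GK: "?G \<subseteq> Pow ?K" unfolding grassmann_open_iff by blast
  have sets_\<sigma>: "sets \<sigma> = sigma_sets ?K ?G" and space_\<sigma>: "space \<sigma> = ?K"
    unfolding \<sigma>_def using GK by (auto simp: sets_measure_of space_measure_of)
  have T: "T \<in> measurable borel \<sigma>"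
  proof (rule measurable_sigma_sets[OF sets_\<sigma> GK])
    show "T \<in> space borel \<rightarrow> ?K" using TK by simp
    fix U assume "U \<in> ?G"
    then obtain W where W: "open W" "U = closest_point -` W \<inter> ?K" unfolding grassmann_open_iff by blast
    let ?D = "{v. det (mx v) \<noteq> 0}"
    let ?P = "?D \<inter> (\<lambda>v. closest_point (row_plane J x (mx v))) -` W"
    have "open ?P" using continuous_open_preimage[OF cp_cont open_D W(1)] .
    \<comment> \<open>Both pieces are Borel: the first is open because the projection depends
      continuously on an invertible matrix, the second is empty or the closed set of singular
      matrices.\<close>
    moreover have "T -` U = ?P \<union> (if row_plane J x (mat 1) \<in> U then - ?D else {})"
    proof (intro set_eqI)
      fix v
      show "v \<in> T -` U \<longleftrightarrow> v \<in> ?P \<union> (if row_plane J x (mat 1) \<in> U then - ?D else {})"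
        using TK[of v] by (cases "det (mx v) = 0") (simp_all add: T_def W(2))
    qed
    ultimately show "T -` U \<inter> space borel \<in> sets borel" using open_D by auto
  qed
  define u where "u = uniform_measure lborel \<Omega>"
  have sets_u: "sets u = sets borel" by (simp add: u_def)
  have Tu: "T \<in> measurable u \<sigma>"
    using T unfolding measurable_cong_sets[OF sets_u refl] .
  interpret u: prob_space u unfolding u_def by (rule prob_space_uniform_measure) (use pos fin in auto)
  define \<mu> where "\<mu> = distr u \<sigma> T"
  have sm: "space \<mu> = ?K" "sets \<mu> = sigma_sets ?K ?G" by (simp_all add: \<mu>_def sets_\<sigma> space_\<sigma>)
  have "prob_space \<mu>" unfolding \<mu>_def by (rule u.prob_space_distr[OF Tu])
  then have e1: "emeasure \<mu> (space \<mu>) = 1" by (rule prob_space.emeasure_space_1)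
  have em: "emeasure \<mu> B = emeasure lborel (\<Omega> \<inter> T -` B) / emeasure lborel \<Omega>" if B: "B \<in> sets \<mu>" for B
  proof -
    have "T -` B \<in> sets borel" using measurable_sets[OF T, of B] B by (simp add: \<mu>_def)
    then show ?thesis unfolding \<mu>_def using B Tu
      by (subst emeasure_distr) (simp_all add: \<mu>_def u_def)
  qed
  have "distr \<mu> \<mu> ((`) (rotate_about x A)) = \<mu>" if A: "rotation_matrix A" for A
  proof (rule measure_eqI)
    let ?F = "(`) (rotate_about x A)"
    have F: "?F \<in> measurable \<mu> \<mu>" by (rule measurable_rotate_image[OF sm A])
    fix B assume "B \<in> sets (distr \<mu> \<mu> ?F)"
    then have B: "B \<in> sets \<mu>" by simp
    then have FB: "?F -` B \<inter> ?K \<in> sets \<mu>" using measurable_sets[OF F B] sm by simp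
    \<comment> \<open>\<open>S\<close> applies \<open>A\<close> to every row. The squared norm of a
      matrix is the sum of those of its rows, so \<open>S\<close> is orthogonal and preserves
      \<open>lborel\<close>.\<close>
    define S :: "real ^ ('n \<times> 'n) \<Rightarrow> real ^ ('n \<times> 'n)" where "S v = (\<chi> p. (A *v (mx v $ fst p)) $ snd p)" for v
    have mxS: "mx (S v) = (\<chi> i. A *v (mx v $ i))" for v
      by (simp add: vec_eq_iff mx_def S_def)
    have "linear S" unfolding S_def mx_def
      by (rule linearI) (auto simp: vec_eq_iff matrix_vector_mult_def algebra_simps sum.distrib sum_distrib_left)
    moreover have nS: "norm (S v) = norm v" for v
    proof -
      have sq: "(norm w)\<^sup>2 = (\<Sum>i\<in>UNIV. (norm (mx w $ i))\<^sup>2)" for w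
        unfolding power2_norm_eq_inner inner_vec_def mx_def
        by (simp add: sum.cartesian_product flip: UNIV_Times_UNIV)
      have "(norm (S v))\<^sup>2 = (norm v)\<^sup>2"
        unfolding sq mxS using rotation_matrix_orthogonal(3)[OF A] by (simp add: orthogonal_transformation)
      then show ?thesis by simp
    qed
    ultimately have S: "orthogonal_transformation S" by (simp add: orthogonal_transformation)
    have [measurable]: "S \<in> borel_measurable borel"
      using \<open>linear S\<close> by (simp add: borel_measurable_continuous_onI linear_continuous_on linear_linear)
    have detS: "det (mx (S v)) = det (mx v)" for v unfolding mxS by (rule det_rotate_rows[OF A])
    have TS: "T (S v) = ?F (T v)" if "det (mx v) \<noteq> 0" for v
      using that by (simp add: T_def detS rotate_row_plane) (simp add: mxS)
    \<comment> \<open>\<open>S\<close> leaves \<open>\<Omega>\<close> invariant and intertwines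
      \<open>T\<close> with the rotation of planes there; the invariance of \<open>lborel\<close> is
      thus passed on to \<open>\<mu>\<close>.\<close>
    have pre: "\<Omega> \<inter> T -` (?F -` B \<inter> ?K) = S -` (\<Omega> \<inter> T -` B)"
    proof (intro set_eqI)
      fix v
      show "v \<in> \<Omega> \<inter> T -` (?F -` B \<inter> ?K) \<longleftrightarrow> v \<in> S -` (\<Omega> \<inter> T -` B)"
        by (cases "det (mx v) = 0") (simp_all add: \<Omega>_def detS nS TS TK)
    qed
    have TB: "T -` B \<in> sets borel" using measurable_sets[OF T, of B] B by (simp add: \<mu>_def)
    have "emeasure (distr \<mu> \<mu> ?F) B = emeasure \<mu> (?F -` B \<inter> ?K)"
      using F B by (simp add: emeasure_distr sm(1))
    also have "\<dots> = emeasure lborel (S -` (\<Omega> \<inter> T -` B)) / emeasure lborel \<Omega>"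
      unfolding em[OF FB] pre ..
    also have "emeasure lborel (S -` (\<Omega> \<inter> T -` B)) = emeasure (distr lborel borel S) (\<Omega> \<inter> T -` B)"
      using TB by (subst emeasure_distr) auto
    also have "\<dots> = emeasure lborel (\<Omega> \<inter> T -` B)" by (simp add: distr_lborel_orthogonal[OF S])
    also have "\<dots> / emeasure lborel \<Omega> = emeasure \<mu> B" by (rule em[OF B, symmetric])
    finally show "emeasure (distr \<mu> \<mu> ?F) B = emeasure \<mu> B" .
  qed simp
  then show ?thesis unfolding rotation_invariant_prob_def using sm e1 by blast
qed

section \<open>Radial integrals\<close>

text \<open>The image of \<open>lborel\<close> under \<open>norm\<close> gives \<open>{..r}\<close>
  the volume of the ball of radius \<open>r\<close>. The weight is the derivative of that volume,
  and the half-lines generate the Borel sets.\<close>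

lemma nn_integral_radial:
  fixes F :: "real \<Rightarrow> ennreal"
  assumes [measurable]: "F \<in> borel_measurable borel"
  shows "(\<integral>\<^sup>+y. F (norm y) \<partial>(lborel :: 'a::euclidean_space measure))
    = (\<integral>\<^sup>+r. ennreal (DIM('a) * unit_ball_vol DIM('a) * r ^ (DIM('a) - 1)) * indicator {0..} r * F r \<partial>lborel)"
proof -
  let ?n = "DIM('a)"
  let ?g = "\<lambda>r. ennreal (?n * unit_ball_vol ?n * r ^ (?n - 1)) * indicator {0..} r"
  have pre: "norm -` {..r} = (cball 0 r :: 'a set)" for r by auto
  have E: "emeasure (distr (lborel :: 'a measure) borel norm) {..r} = emeasure (density lborel ?g) {..r}" for r :: real
  proof (cases "r \<ge> 0")
    case True
    have "emeasure (density lborel ?g) {..r} = (\<integral>\<^sup>+s. ennreal (?n * unit_ball_vol ?n * s ^ (?n - 1)) * indicator {0..r} s \<partial>lborel)"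
      by (subst emeasure_density) (auto simp: indicator_def intro!: nn_integral_cong)
    also have "\<dots> = ennreal (unit_ball_vol ?n * r ^ ?n - unit_ball_vol ?n * 0 ^ ?n)"
      by (rule nn_integral_FTC_Icc) (use True in \<open>auto intro!: derivative_eq_intros mult_nonneg_nonneg\<close>)
    also have "\<dots> = emeasure (distr (lborel :: 'a measure) borel norm) {..r}"
      using True by (simp add: emeasure_distr pre emeasure_cball)
    finally show ?thesis ..
  next
    case False
    have "emeasure (density lborel ?g) {..r} = (\<integral>\<^sup>+s. ?g s * indicator {..r} s \<partial>lborel)"
      by (rule emeasure_density) auto
    also have "\<dots> = (\<integral>\<^sup>+s. 0 \<partial>(lborel :: real measure))"
      by (rule nn_integral_cong) (use False in \<open>auto simp: indicator_def\<close>)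
    finally have "emeasure (density lborel ?g) {..r} = 0" by simp
    then show ?thesis using False by (simp add: emeasure_distr pre)
  qed
  have "distr (lborel :: 'a measure) borel norm = density lborel ?g"
  proof (rule measure_eqI_generator_eq[where E = "range (\<lambda>r::real. {..r})" and \<Omega> = UNIV and A = "\<lambda>n. {..real n}"])
    show "Int_stable (range (\<lambda>r::real. {..r}))"
    proof (rule Int_stableI_image)
      fix a b :: real
      show "\<exists>c\<in>UNIV. {..a} \<inter> {..b} = {..c}" by (rule bexI[of _ "min a b"]) auto
    qed
    show "(\<Union>n. {..real n}) = UNIV" using real_arch_simple by (auto simp: set_eq_iff)
    show "emeasure (distr (lborel :: 'a measure) borel norm) {..real n} \<noteq> \<infinity>" for n
      by (simp add: emeasure_distr pre emeasure_cball)
    show "sets (distr (lborel :: 'a measure) borel norm) = sigma_sets UNIV (range (\<lambda>r::real. {..r}))"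
      "sets (density lborel ?g) = sigma_sets UNIV (range (\<lambda>r::real. {..r}))"
      by (simp_all add: borel_eq_atMost)
  qed (auto simp only: E)
  then have "(\<integral>\<^sup>+r. F r \<partial>distr (lborel :: 'a measure) borel norm) = (\<integral>\<^sup>+r. F r \<partial>density lborel ?g)" by simp
  then show ?thesis by (simp add: nn_integral_distr nn_integral_density)
qed

text \<open>With the exponent written as \<open>s - DIM('a)\<close>, the radial weight is
  \<open>r powr (s - 1)\<close> in every dimension.\<close>

lemma nn_integral_radial_powr:
  fixes F :: "real \<Rightarrow> ennreal" and s :: real
  assumes [measurable]: "F \<in> borel_measurable borel"
  shows "(\<integral>\<^sup>+y. ennreal (norm y powr (s - DIM('a))) * F (norm y) \<partial>(lborel :: 'a::euclidean_space measure))
    = ennreal (DIM('a) * unit_ball_vol DIM('a)) * (\<integral>\<^sup>+r. ennreal (r powr (s - 1)) * indicator {0<..} r * F r \<partial>lborel)"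
proof -
  let ?n = "DIM('a)"
  have *: "r ^ (?n - 1) * r powr (s - ?n) = r powr (s - 1)" if "r > 0" for r
    using that DIM_positive[where 'a='a]
    by (simp add: powr_realpow[symmetric] powr_add[symmetric] of_nat_diff)
  have "(\<integral>\<^sup>+y. ennreal (norm y powr (s - ?n)) * F (norm y) \<partial>(lborel :: 'a measure))
    = (\<integral>\<^sup>+r. ennreal (?n * unit_ball_vol ?n * r ^ (?n - 1)) * indicator {0..} r * (ennreal (r powr (s - ?n)) * F r) \<partial>lborel)"
    by (rule nn_integral_radial) measurable
  also have "\<dots> = (\<integral>\<^sup>+r. ennreal (?n * unit_ball_vol ?n) * (ennreal (r powr (s - 1)) * indicator {0<..} r * F r) \<partial>lborel)"
  proof (rule nn_integral_cong)
    fix r :: real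
    consider "r > 0" | "r = 0" | "r < 0" by linarith
    then show "ennreal (?n * unit_ball_vol ?n * r ^ (?n - 1)) * indicator {0..} r * (ennreal (r powr (s - ?n)) * F r)
      = ennreal (?n * unit_ball_vol ?n) * (ennreal (r powr (s - 1)) * indicator {0<..} r * F r)"
    proof cases
      case 1
      then show ?thesis
        unfolding *[OF 1, symmetric] by (simp add: ennreal_mult' mult_ac)
    qed auto
  qed
  also have "\<dots> = ennreal (?n * unit_ball_vol ?n) * (\<integral>\<^sup>+r. ennreal (r powr (s - 1)) * indicator {0<..} r * F r \<partial>lborel)"
    by (rule nn_integral_cmult) measurable
  finally show ?thesis .
qed

lemma nn_integral_powr_0:
  assumes "s > 0" "R \<ge> 0"
  shows "(\<integral>\<^sup>+r. ennreal (r powr (s - 1)) * indicator {0<..} r * indicator {..R} r \<partial>lborel) = ennreal (R powr s / s)"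
proof -
  have "((\<lambda>r. r powr (s - 1)) has_integral (R powr (s - 1 + 1) / (s - 1 + 1))) {0..R}"
    using assms by (intro has_integral_powr_from_0) auto
  then have "(\<integral>\<^sup>+r. ennreal (indicator {0..R} r * r powr (s - 1)) \<partial>lborel) = ennreal (R powr s / s)"
    by (intro nn_integral_has_integral_lebesgue) auto
  also have "(\<integral>\<^sup>+r. ennreal (indicator {0..R} r * r powr (s - 1)) \<partial>lborel)
    = (\<integral>\<^sup>+r. ennreal (r powr (s - 1)) * indicator {0<..} r * indicator {..R} r \<partial>lborel)"
    by (intro nn_integral_cong) (auto simp: indicator_def)
  finally show ?thesis .
qed

lemma nn_integral_powr_inf:
  assumes "s < 0"
  shows "(\<integral>\<^sup>+r. ennreal (r powr (s - 1)) * indicator {1..} r \<partial>lborel) = ennreal (- 1 / s)"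
proof -
  have "((\<lambda>r. r powr (s - 1)) has_integral (- (1 powr (s - 1 + 1)) / (s - 1 + 1))) {1..}"
    using assms by (intro has_integral_powr_to_inf) auto
  then have "(\<integral>\<^sup>+r. ennreal (indicator {1..} r * r powr (s - 1)) \<partial>lborel) = ennreal (- 1 / s)"
    by (intro nn_integral_has_integral_lebesgue) auto
  also have "(\<integral>\<^sup>+r. ennreal (indicator {1..} r * r powr (s - 1)) \<partial>lborel)
    = (\<integral>\<^sup>+r. ennreal (r powr (s - 1)) * indicator {1..} r \<partial>lborel)"
    by (intro nn_integral_cong) (auto simp: indicator_def)
  finally show ?thesis .
qed

lemma nn_integral_norm_powr_cball:
  fixes s R :: real
  assumes "s > 0" "R \<ge> 0"
  shows "(\<integral>\<^sup>+y. ennreal (norm y powr (s - DIM('a))) * indicator (cball 0 R) y \<partial>(lborel :: 'a::euclidean_space measure))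
    = ennreal (DIM('a) * unit_ball_vol DIM('a) * R powr s / s)"
proof -
  have "(\<integral>\<^sup>+y. ennreal (norm y powr (s - DIM('a))) * indicator (cball 0 R) y \<partial>(lborel :: 'a::euclidean_space measure))
    = (\<integral>\<^sup>+y. ennreal (norm y powr (s - DIM('a))) * indicator {..R} (norm y) \<partial>(lborel :: 'a measure))"
    by (intro nn_integral_cong) (auto simp: indicator_def)
  also have "\<dots> = ennreal (DIM('a) * unit_ball_vol DIM('a) * R powr s / s)"
    using assms by (subst nn_integral_radial_powr) (simp_all add: nn_integral_powr_0 ennreal_mult'[symmetric])
  finally show ?thesis .
qed

text \<open>Near the origin the integrand behaves like the power of order
  \<open>s - DIM('a)\<close>, integrable for positive \<open>s\<close>; far away it decays with
  exponent \<open>s - a - DIM('a)\<close>, integrable for \<open>s < a\<close>. These two conditions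
  reappear as the edges of the strips of exponents below.\<close>

lemma nn_integral_weight_finite:
  fixes s a :: real
  assumes "0 < s" "s < a"
  shows "(\<integral>\<^sup>+y. ennreal (norm y powr (s - DIM('a)) * (1 + norm y) powr (- a)) \<partial>(lborel :: 'a::euclidean_space measure)) < \<infinity>"
proof -
  let ?W = "\<integral>\<^sup>+y. ennreal (norm y powr (s - DIM('a)) * (1 + norm y) powr (- a)) \<partial>(lborel :: 'a measure)"
  let ?B = "\<integral>\<^sup>+r. ennreal (r powr (s - 1)) * indicator {0<..} r * ennreal ((1 + r) powr (- a)) \<partial>lborel"
  have "?W
    = (\<integral>\<^sup>+y. ennreal (norm y powr (s - DIM('a))) * ennreal ((1 + norm y) powr (- a)) \<partial>(lborel :: 'a measure))"
    by (simp add: ennreal_mult')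
  also have "\<dots> = ennreal (DIM('a) * unit_ball_vol DIM('a)) *
      ?B"
    by (rule nn_integral_radial_powr) measurable
  finally have eq: "?W
    = ennreal (DIM('a) * unit_ball_vol DIM('a)) *
      ?B" .
  have "?B
    \<le> (\<integral>\<^sup>+r. ennreal (r powr (s - 1)) * indicator {0<..} r * indicator {..1} r + ennreal (r powr ((s - a) - 1)) * indicator {1..} r \<partial>lborel)"
  proof (rule nn_integral_mono)
    fix r :: real
    consider "r \<le> 0" | "0 < r" "r < 1" | "r \<ge> 1" by linarith
    then show "ennreal (r powr (s - 1)) * indicator {0<..} r * ennreal ((1 + r) powr (- a))
       \<le> ennreal (r powr (s - 1)) * indicator {0<..} r * indicator {..1} r + ennreal (r powr ((s - a) - 1)) * indicator {1..} r"
    proof cases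
      case 2
      have "(1 + r) powr (- a) \<le> 1" using powr_mono[of "- a" 0 "1 + r"] 2 assms by simp
      then show ?thesis using 2 by (simp add: ennreal_mult'[symmetric] mult_left_le)
    next
      case 3
      have "(1 + r) powr (- a) \<le> r powr (- a)" using 3 assms by (intro powr_mono2') auto
      then have "r powr (s - 1) * (1 + r) powr (- a) \<le> r powr (s - 1) * r powr (- a)"
        by (intro mult_left_mono) auto
      also have "\<dots> = r powr ((s - a) - 1)" by (simp add: powr_add[symmetric] algebra_simps)
      finally show ?thesis using 3
        by (simp add: ennreal_mult'[symmetric]) (metis add.commute ennreal_leI le_iff_add order_trans)
    qed auto
  qed
  also have "\<dots> = ennreal (1 powr s / s) + ennreal (- 1 / (s - a))"
    using assms by (subst nn_integral_add) (simp_all only: nn_integral_powr_0 nn_integral_powr_inf, auto)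
  finally have "?B < \<infinity>"
    by (rule le_less_trans) (simp add: less_top)
  then have "ennreal (DIM('a) * unit_ball_vol DIM('a)) *
      ?B < \<infinity>"
    by (simp add: ennreal_mult_less_top)
  with eq show ?thesis by simp
qed

text \<open>Euler's integral, rescaled by \<open>c\<close>. Read from right to left it represents a
  negative power as a superposition of exponentials.\<close>

lemma nn_integral_Gamma:
  assumes "a > 0" "c > 0"
  shows "(\<integral>\<^sup>+t. ennreal (t powr (a - 1) * exp (- (c * t))) * indicator {0<..} t \<partial>lborel) = ennreal (Gamma a * c powr (- a))"
proof -
  have "ennreal (Gamma a) = (\<integral>\<^sup>+t. ennreal (indicator {0..} t * t powr (a - 1) / exp t) \<partial>lborel)"
    by (rule Gamma_conv_nn_integral_real) fact
  also have "\<dots> = ennreal c * (\<integral>\<^sup>+t. ennreal (indicator {0..} (c * t) * (c * t) powr (a - 1) / exp (c * t)) \<partial>lborel)"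
    using assms nn_integral_lborel_affine[of "\<lambda>t. ennreal (indicator {0..} t * t powr (a - 1) / exp t)" c 0] by simp
  also have "\<dots> = ennreal c * (\<integral>\<^sup>+t. ennreal (c powr (a - 1)) * (ennreal (t powr (a - 1) * exp (- (c * t))) * indicator {0<..} t) \<partial>lborel)"
  proof (intro arg_cong2[where f = "(*)"] nn_integral_cong refl)
    fix t :: real
    consider "t > 0" | "t = 0" | "t < 0" by linarith
    then show "ennreal (indicator {0..} (c * t) * (c * t) powr (a - 1) / exp (c * t))
      = ennreal (c powr (a - 1)) * (ennreal (t powr (a - 1) * exp (- (c * t))) * indicator {0<..} t)"
    proof cases
      case 1
      then show ?thesis using assms by (simp add: powr_mult ennreal_mult'[symmetric] exp_minus field_simps)
    next
      case 3
      then have "c * t < 0" using assms by (simp add: mult_pos_neg)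
      then show ?thesis using 3 by (simp add: indicator_def)
    qed simp
  qed
  also have "\<dots> = ennreal (c powr a) * (\<integral>\<^sup>+t. ennreal (t powr (a - 1) * exp (- (c * t))) * indicator {0<..} t \<partial>lborel)"
    using assms by (subst nn_integral_cmult) (auto simp: mult.assoc[symmetric] ennreal_mult'[symmetric] powr_diff)
  finally have "ennreal (c powr - a) * ennreal (Gamma a) = ennreal (c powr - a) * (ennreal (c powr a) * (\<integral>\<^sup>+t. ennreal (t powr (a - 1) * exp (- (c * t))) * indicator {0<..} t \<partial>lborel))"
    by simp
  also have "\<dots> = (\<integral>\<^sup>+t. ennreal (t powr (a - 1) * exp (- (c * t))) * indicator {0<..} t \<partial>lborel)"
    using assms by (simp add: mult.assoc[symmetric] ennreal_mult'[symmetric] powr_add[symmetric])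
  finally show ?thesis using assms by (simp add: ennreal_mult'[symmetric] mult.commute)
qed

text \<open>Multiplied by \<open>Gamma (a + b)\<close>, the power of \<open>1 + v\<close> becomes an
  Euler integral in \<open>u\<close>. Integrating over \<open>v\<close> first separates the double
  integral into \<open>Gamma a\<close> and \<open>Gamma b\<close>.\<close>

lemma nn_integral_Beta_inf:
  assumes a: "a > 0" and b: "b > 0"
  shows "(\<integral>\<^sup>+v. ennreal (v powr (a - 1) * (1 + v) powr (- (a + b))) * indicator {0<..} v \<partial>lborel)
    = ennreal (Gamma a * Gamma b / Gamma (a + b))"
proof -
  let ?B = "\<integral>\<^sup>+v. ennreal (v powr (a - 1) * (1 + v) powr (- (a + b))) * indicator {0<..} v \<partial>lborel"
  let ?K = "\<lambda>v u. ennreal (v powr (a - 1) * (u powr (a + b - 1) * exp (- ((1 + v) * u)))) * indicator {0<..} u * indicator {0<..} v"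
  have "ennreal (Gamma (a + b)) * ?B
    = (\<integral>\<^sup>+v. \<integral>\<^sup>+u. ?K v u \<partial>lborel \<partial>lborel)"
  proof (subst nn_integral_cmult[symmetric], simp, intro nn_integral_cong)
    fix v :: real
    show "ennreal (Gamma (a + b)) * (ennreal (v powr (a - 1) * (1 + v) powr (- (a + b))) * indicator {0<..} v)
      = (\<integral>\<^sup>+u. ?K v u \<partial>lborel)"
    proof (cases "v > 0")
      case True
      have "(\<integral>\<^sup>+u. ?K v u \<partial>lborel)
        = (\<integral>\<^sup>+u. ennreal (v powr (a - 1)) * (ennreal (u powr (a + b - 1) * exp (- ((1 + v) * u))) * indicator {0<..} u) \<partial>lborel)"
        using True by (intro nn_integral_cong) (simp add: ennreal_mult' mult_ac)
      also have "\<dots> = ennreal (v powr (a - 1)) * ennreal (Gamma (a + b) * (1 + v) powr (- (a + b)))"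
        using True a b by (subst nn_integral_cmult, simp, subst nn_integral_Gamma) auto
      finally show ?thesis using True a b by (simp add: ennreal_mult'[symmetric] Gamma_real_pos less_imp_le mult_ac)
    qed simp
  qed
  also have "\<dots> = (\<integral>\<^sup>+u. \<integral>\<^sup>+v. ?K v u \<partial>lborel \<partial>lborel)"
    by (rule lborel_pair.Fubini') measurable
  also have "\<dots> = (\<integral>\<^sup>+u. ennreal (Gamma a) * (ennreal (u powr (b - 1) * exp (- (1 * u))) * indicator {0<..} u) \<partial>lborel)"
  proof (intro nn_integral_cong)
    fix u :: real
    show "(\<integral>\<^sup>+v. ?K v u \<partial>lborel)
      = ennreal (Gamma a) * (ennreal (u powr (b - 1) * exp (- (1 * u))) * indicator {0<..} u)"
    proof (cases "u > 0")
      case True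
      have "(\<integral>\<^sup>+v. ?K v u \<partial>lborel)
        = (\<integral>\<^sup>+v. ennreal (u powr (a + b - 1) * exp (- u)) * (ennreal (v powr (a - 1) * exp (- (u * v))) * indicator {0<..} v) \<partial>lborel)"
      proof (intro nn_integral_cong)
        fix v :: real
        have "exp (- ((1 + v) * u)) = exp (- u) * exp (- (u * v))"
          by (simp add: exp_add[symmetric] algebra_simps)
        then have "v powr (a - 1) * (u powr (a + b - 1) * exp (- ((1 + v) * u)))
           = (u powr (a + b - 1) * exp (- u)) * (v powr (a - 1) * exp (- (u * v)))" by simp
        then show "?K v u
           = ennreal (u powr (a + b - 1) * exp (- u)) * (ennreal (v powr (a - 1) * exp (- (u * v))) * indicator {0<..} v)"
          using True by (simp only: ennreal_mult' mult.assoc) (simp add: ennreal_mult' mult.assoc)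
      qed
      also have "\<dots> = ennreal (u powr (a + b - 1) * exp (- u)) * ennreal (Gamma a * u powr (- a))"
        using True a by (subst nn_integral_cmult, simp, subst nn_integral_Gamma) auto
      also have "\<dots> = ennreal (Gamma a * ((u powr (a + b - 1) * u powr (- a)) * exp (- u)))"
        using a by (simp add: ennreal_mult'[symmetric] Gamma_real_pos less_imp_le mult_ac)
      also have "u powr (a + b - 1) * u powr (- a) = u powr (b - 1)" by (simp add: powr_add[symmetric])
      finally show ?thesis using True a by (simp add: ennreal_mult' Gamma_real_pos less_imp_le mult_ac)
    qed simp
  qed
  also have "\<dots> = ennreal (Gamma a) * ennreal (Gamma b * 1 powr (- b))"
    using b by (subst nn_integral_cmult, simp, subst nn_integral_Gamma) auto
  finally have "ennreal (Gamma (a + b)) * ?B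
    = ennreal (Gamma a * Gamma b)"
    using a by (simp add: ennreal_mult' Gamma_real_pos less_imp_le)
  then have "ennreal (1 / Gamma (a + b)) * (ennreal (Gamma (a + b)) * ?B)
    = ennreal (1 / Gamma (a + b)) * ennreal (Gamma a * Gamma b)" by simp
  moreover have "Gamma (a + b) > 0" using a b by (intro Gamma_real_pos) simp
  ultimately show ?thesis
    by (simp add: mult.assoc[symmetric] ennreal_mult'[symmetric] less_imp_le)
qed

section \<open>Uniqueness of rotation invariant measures\<close>

text \<open>The dimension bound matters because rotations have determinant one: on a line the only
  rotation is the identity, which does not exchange \<open>x + 1\<close> and
  \<open>x - 1\<close>.\<close>

lemma rotate_about_exists:
  fixes x :: "real ^ 'n"
  assumes "CARD('n) \<ge> 2" "norm (w - x) = norm (w' - x)"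
  obtains A where "rotation_matrix A" "rotate_about x A w = w'"
proof -
  obtain f where f: "orthogonal_transformation f" "det (matrix f) = 1" "f (w - x) = w' - x"
    using rotation_exists[OF assms] by blast
  have "linear f" using f(1) by (simp add: orthogonal_transformation)
  then have "rotation_matrix (matrix f)" "matrix f *v (w - x) = w' - x"
    using f by (auto simp: rotation_matrix_def orthogonal_transformation_matrix matrix_works)
  then show thesis using that[of "matrix f"] by (simp add: rotate_about_def)
qed

lemma dist_rotate_about:
  assumes "rotation_matrix A"
  shows "dist (rotate_about x A y) (rotate_about x A z) = dist y z"
proof -
  have "rotate_about x A y - rotate_about x A z = A *v (y - z)"
    using matrix_vector_mult_diff_distrib[of A "y - x" "z - x"] by (simp add: rotate_about_def)
  then show ?thesis
    using rotation_matrix_orthogonal(3)[OF assms] by (simp add: dist_norm orthogonal_transformation)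
qed

lemma norm_rotate_about:
  assumes "rotation_matrix A"
  shows "norm (rotate_about x A y - x) = norm (y - x)"
  using dist_rotate_about[OF assms, of x y x] by (simp add: dist_norm rotate_about_def)

lemma distr_lborel_rotate_about:
  assumes "rotation_matrix A"
  shows "distr lborel borel (rotate_about x A) = lborel"
proof -
  have T: "distr lborel borel (\<lambda>y. t + y) = lborel" for t :: "real ^ 'n"
    using lborel_affine[of 1 t] by (simp add: density_1)
  have [measurable]: "((*v) A) \<in> borel_measurable borel"
    by (intro borel_measurable_continuous_onI linear_continuous_on) (simp add: linear_linear)
  have "rotate_about x A = (\<lambda>y. (x - A *v x) + y) \<circ> (*v) A"
    by (simp add: fun_eq_iff rotate_about_def matrix_vector_mult_diff_distrib)
  then have "distr lborel borel (rotate_about x A) = distr (distr lborel borel ((*v) A)) borel (\<lambda>y. (x - A *v x) + y)"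
    by (simp add: distr_distr)
  also have "\<dots> = lborel"
    by (simp only: distr_lborel_orthogonal[OF rotation_matrix_orthogonal(3)[OF assms]] T)
  finally show ?thesis .
qed

text \<open>Any unit vector would serve. It marks a ray from \<open>x\<close> that meets each sphere
  about \<open>x\<close>, so that rotation invariant quantities can be evaluated as functions of the
  radius.\<close>

definition unit_vector :: "real ^ 'n" where "unit_vector = axis undefined 1"

lemma norm_unit_vector [simp]: "norm (unit_vector :: real ^ 'n) = 1"
  by (simp add: unit_vector_def)

lemma measurable_emeasure_cball_Int:
  fixes N :: "'a::euclidean_space measure"
  assumes "sigma_finite_measure N" and N [measurable_cong]: "sets N = sets borel" and [measurable]: "D \<in> sets borel"
  shows "(\<lambda>y. emeasure N (cball y \<epsilon> \<inter> D)) \<in> borel_measurable borel"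
proof -
  interpret sigma_finite_measure N by fact
  have "(\<lambda>y. \<integral>\<^sup>+w. indicator {p :: 'a \<times> 'a. dist (fst p) (snd p) \<le> \<epsilon>} (y, w) * indicator D w \<partial>N) \<in> borel_measurable borel"
    by (rule borel_measurable_nn_integral) measurable
  also have "(\<lambda>y. \<integral>\<^sup>+w. indicator {p :: 'a \<times> 'a. dist (fst p) (snd p) \<le> \<epsilon>} (y, w) * indicator D w \<partial>N)
     = (\<lambda>y. \<integral>\<^sup>+w. indicator (cball y \<epsilon> \<inter> D) w \<partial>N)"
    by (intro ext nn_integral_cong) (auto simp: indicator_def)
  finally show ?thesis by (simp add: N)
qed

text \<open>The properties shared by the mean of the plane measures and the power density.
  Finiteness on balls supplies the sigma-finiteness that Fubini requires.\<close>

locale rotation_invariant_measure =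
  fixes M :: "(real ^ 'n) measure" and x :: "real ^ 'n"
  assumes card2: "CARD('n) \<ge> 2"
    and sets_M [measurable_cong, simp]: "sets M = sets borel"
    and rot: "rotation_matrix A \<Longrightarrow> distr M borel (rotate_about x A) = M"
    and finite_cball: "emeasure M (cball x r) < \<infinity>"
begin

lemma space_M [simp]: "space M = UNIV"
  using sets_eq_imp_space_eq[OF sets_M] by simp

sublocale sigma_finite_measure M
proof
  show "\<exists>A. countable A \<and> A \<subseteq> sets M \<and> \<Union>A = space M \<and> (\<forall>a\<in>A. emeasure M a \<noteq> \<infinity>)"
  proof (intro exI[of _ "range (\<lambda>n::nat. cball x n)"] conjI)
    show "\<Union> (range (\<lambda>n::nat. cball x n)) = space M"
      using real_arch_simple by (auto simp: set_eq_iff)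
    show "\<forall>a\<in>range (\<lambda>n::nat. cball x (real n)). emeasure M a \<noteq> \<infinity>"
      using finite_cball by (auto simp: less_top)
  qed auto
qed

sublocale MR: pair_sigma_finite M "lborel :: (real ^ 'n) measure" ..

definition mass :: "real \<Rightarrow> real \<Rightarrow> ennreal" where
  "mass \<epsilon> r = emeasure M (cball (x + r *\<^sub>R unit_vector) \<epsilon>)"

lemma emeasure_cball_mass: "emeasure M (cball w \<epsilon>) = mass \<epsilon> (norm (w - x))"
proof -
  let ?w = "x + norm (w - x) *\<^sub>R unit_vector"
  have "norm (w - x) = norm (?w - x)" by simp
  then obtain A where A: "rotation_matrix A" "rotate_about x A w = ?w"
    using rotate_about_exists[OF card2] by metis
  have "rotate_about x A -` cball ?w \<epsilon> = cball w \<epsilon>"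
    using dist_rotate_about[OF A(1), of x w] A(2) by auto
  then have "emeasure (distr M borel (rotate_about x A)) (cball ?w \<epsilon>) = emeasure M (cball w \<epsilon>)"
    by (subst emeasure_distr) auto
  then show ?thesis by (simp add: rot[OF A(1)] mass_def)
qed

lemma measurable_emeasure_cball [measurable]: "(\<lambda>w. emeasure M (cball w \<epsilon>)) \<in> borel_measurable borel"
  using measurable_emeasure_cball_Int[OF sigma_finite_measure_axioms sets_M, of UNIV \<epsilon>] by simp

lemma measurable_mass [measurable]: "mass \<epsilon> \<in> borel_measurable borel"
  unfolding mass_def[abs_def] by measurable

text \<open>Fubini for the symmetric relation \<open>dist y w \<le> \<epsilon>\<close>: the
  smoothing by small balls is moved from the measure to the set \<open>S\<close>.\<close>

lemma nn_integral_mass: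
  assumes [measurable]: "S \<in> sets borel"
  shows "(\<integral>\<^sup>+w. mass \<epsilon> (norm (w - x)) * indicator S w \<partial>lborel)
    = (\<integral>\<^sup>+y. emeasure lborel (cball y \<epsilon> \<inter> S) \<partial>M)"
proof -
  have "(\<integral>\<^sup>+y. emeasure lborel (cball y \<epsilon> \<inter> S) \<partial>M)
    = (\<integral>\<^sup>+y. \<integral>\<^sup>+w. indicator {p :: (real^'n) \<times> (real^'n). dist (fst p) (snd p) \<le> \<epsilon>} (y, w) * indicator S w \<partial>lborel \<partial>M)"
  proof (intro nn_integral_cong)
    fix y
    have "(\<integral>\<^sup>+w. indicator {p. dist (fst p) (snd p) \<le> \<epsilon>} (y, w) * indicator S w \<partial>lborel) = (\<integral>\<^sup>+w. indicator (cball y \<epsilon> \<inter> S) w \<partial>lborel)"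
      by (intro nn_integral_cong) (auto simp: indicator_def)
    then show "emeasure lborel (cball y \<epsilon> \<inter> S) = (\<integral>\<^sup>+w. indicator {p. dist (fst p) (snd p) \<le> \<epsilon>} (y, w) * indicator S w \<partial>lborel)"
      by simp
  qed
  also have "\<dots> = (\<integral>\<^sup>+w. \<integral>\<^sup>+y. indicator {p :: (real^'n) \<times> (real^'n). dist (fst p) (snd p) \<le> \<epsilon>} (y, w) * indicator S w \<partial>M \<partial>lborel)"
    by (rule MR.Fubini'[symmetric]) measurable
  also have "\<dots> = (\<integral>\<^sup>+w. mass \<epsilon> (norm (w - x)) * indicator S w \<partial>lborel)"
  proof (intro nn_integral_cong)
    fix w
    have "(\<integral>\<^sup>+y. indicator {p. dist (fst p) (snd p) \<le> \<epsilon>} (y, w) * indicator S w \<partial>M) = (\<integral>\<^sup>+y. indicator (cball w \<epsilon>) y * indicator S w \<partial>M)"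
      by (intro nn_integral_cong) (auto simp: indicator_def dist_commute)
    then show "(\<integral>\<^sup>+y. indicator {p. dist (fst p) (snd p) \<le> \<epsilon>} (y, w) * indicator S w \<partial>M) = mass \<epsilon> (norm (w - x)) * indicator S w"
      by (subst (asm) (2) nn_integral_multc) (auto simp: emeasure_cball_mass intro!: borel_measurable_indicator)
  qed
  finally show ?thesis ..
qed

end

text \<open>Smooth with small balls: the mass of the ball with centre \<open>w\<close> depends only on \<open>\<bar>w - x\<bar>\<close>, so, by Fubini,
  it is determined almost everywhere by the radial part of the measure.\<close>

lemma rotation_invariant_measure_unique:
  fixes M N :: "(real ^ 'n) measure"
  assumes "rotation_invariant_measure M x" "rotation_invariant_measure N x"
    and cb: "\<And>r. r > 0 \<Longrightarrow> emeasure M (cball x r) = emeasure N (cball x r)"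
  shows "M = N"
proof -
  interpret M: rotation_invariant_measure M x by fact
  interpret N: rotation_invariant_measure N x by fact
  let ?d = "\<lambda>y. norm (y - x)"
  have dd: "distr M borel ?d = distr N borel ?d"
  proof (rule measure_eqI_generator_eq[where E = "range (\<lambda>r::real. {..r})" and \<Omega> = UNIV and A = "\<lambda>n. {..real n}"])
    show "Int_stable (range (\<lambda>r::real. {..r}))"
    proof (rule Int_stableI_image)
      fix a b :: real
      show "\<exists>c\<in>UNIV. {..a} \<inter> {..b} = {..c}" by (rule bexI[of _ "min a b"]) auto
    qed
    show "sets (distr M borel ?d) = sigma_sets UNIV (range (\<lambda>r::real. {..r}))"
      "sets (distr N borel ?d) = sigma_sets UNIV (range (\<lambda>r::real. {..r}))"
      by (simp_all add: borel_eq_atMost)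
    show "(\<Union>n. {..real n}) = UNIV" using real_arch_simple by (auto simp: set_eq_iff)
    have pre: "?d -` {..r} = cball x r" for r by (auto simp: dist_norm norm_minus_commute)
    show "emeasure (distr M borel ?d) {..real n} \<noteq> \<infinity>" for n
      using M.finite_cball[of n] by (subst emeasure_distr) (auto simp: pre less_top)
    have *: "emeasure M (cball x r) = emeasure N (cball x r)" for r
    proof -
      consider "r > 0" | "r = 0" | "r < 0" by linarith
      then show ?thesis
      proof cases
        case 2
        \<comment> \<open>The hypothesis speaks of positive radii; a possible atom at
          \<open>x\<close> is reached as the limit over shrinking balls.\<close>
        let ?C = "\<lambda>n::nat. cball x (1 / real (Suc n))"
        have dec: "decseq ?C" by (intro decseq_SucI subset_cball) (simp add: field_simps)
        have int: "(\<Inter>n. ?C n) = {x}"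
        proof (intro equalityI subsetI)
          fix y assume "y \<in> (\<Inter>n. ?C n)"
          then have "dist x y \<le> 1 / real (Suc n)" for n by auto
          then have "dist x y \<le> 0"
            by (intro LIMSEQ_le_const[OF LIMSEQ_inverse_real_of_nat]) (auto simp: inverse_eq_divide)
          then show "y \<in> {x}" by simp
        qed auto
        have "(\<lambda>n. emeasure M (?C n)) \<longlonglongrightarrow> emeasure M {x}"
          using M.finite_cball unfolding int[symmetric] by (intro Lim_emeasure_decseq dec) (auto simp: less_top)
        moreover have "(\<lambda>n. emeasure N (?C n)) \<longlonglongrightarrow> emeasure N {x}"
          using N.finite_cball unfolding int[symmetric] by (intro Lim_emeasure_decseq dec) (auto simp: less_top)
        moreover have "emeasure M (?C n) = emeasure N (?C n)" for n by (rule cb) simp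
        ultimately show ?thesis using 2 LIMSEQ_unique by auto
      qed (auto simp: cb)
    qed
    show "emeasure (distr M borel ?d) X = emeasure (distr N borel ?d) X" if "X \<in> range (\<lambda>r::real. {..r})" for X
      using that by (auto simp: emeasure_distr pre *)
  qed auto
  have mass: "AE w in lborel. M.mass \<epsilon> (?d w) = N.mass \<epsilon> (?d w)" for \<epsilon>
  proof -
    let ?L = "distr lborel borel ?d :: real measure"
    interpret L: sigma_finite_measure ?L
    proof
      show "\<exists>A. countable A \<and> A \<subseteq> sets ?L \<and> \<Union>A = space ?L \<and> (\<forall>a\<in>A. emeasure ?L a \<noteq> \<infinity>)"
      proof (intro exI[of _ "range (\<lambda>n::nat. {..real n})"] conjI)
        show "\<Union> (range (\<lambda>n::nat. {..real n})) = space ?L"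
          using real_arch_simple by (auto simp: set_eq_iff)
        have "?d -` {..r} = cball x r" for r by (auto simp: dist_norm norm_minus_commute)
        then show "\<forall>a\<in>range (\<lambda>n::nat. {..real n}). emeasure ?L a \<noteq> \<infinity>"
          by (auto simp: emeasure_distr emeasure_cball)
      qed auto
    qed
    \<comment> \<open>Integrated over the set of points whose distance from \<open>x\<close> lies in
      \<open>S\<close>, both mass functions see only the common radial distribution
      \<open>dd\<close>. As \<open>S\<close> is arbitrary, the densities agree at almost every
      radius.\<close>
    have "AE r in ?L. M.mass \<epsilon> r = N.mass \<epsilon> r"
    proof (rule L.density_unique)
      show "density ?L (M.mass \<epsilon>) = density ?L (N.mass \<epsilon>)"
      proof (rule measure_eqI)
        fix S assume "S \<in> sets (density ?L (M.mass \<epsilon>))"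
        then have [measurable]: "S \<in> sets borel" by simp
        let ?S = "?d -` S"
        have [measurable]: "?S \<in> sets borel" using measurable_sets[of ?d borel borel S] by simp
        define q where "q r = emeasure lborel (cball (x + r *\<^sub>R unit_vector) \<epsilon> \<inter> ?S)" for r
        have Q: "emeasure lborel (cball y \<epsilon> \<inter> ?S) = q (?d y)" for y
        proof -
          let ?w = "x + ?d y *\<^sub>R unit_vector"
          have "?d y = ?d ?w" by simp
          then obtain A where A: "rotation_matrix A" "rotate_about x A y = ?w"
            using rotate_about_exists[OF M.card2] by metis
          have "rotate_about x A -` (cball ?w \<epsilon> \<inter> ?S) = cball y \<epsilon> \<inter> ?S"
            using dist_rotate_about[OF A(1), of x y] A(2) norm_rotate_about[OF A(1), of x] by auto
          then have "emeasure (distr lborel borel (rotate_about x A)) (cball ?w \<epsilon> \<inter> ?S) = emeasure lborel (cball y \<epsilon> \<inter> ?S)"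
            by (subst emeasure_distr) auto
          then show ?thesis by (simp add: distr_lborel_rotate_about[OF A(1)] q_def)
        qed
        have [measurable]: "q \<in> borel_measurable borel"
          unfolding q_def[abs_def]
          by (rule measurable_compose[OF _ measurable_emeasure_cball_Int[OF lborel.sigma_finite_measure_axioms]]) measurable
        have "emeasure (density ?L (M.mass \<epsilon>)) S = (\<integral>\<^sup>+w. M.mass \<epsilon> (?d w) * indicator ?S w \<partial>lborel)"
          by (subst emeasure_density, simp, simp, subst nn_integral_distr) (auto simp: indicator_def intro!: nn_integral_cong)
        also have "\<dots> = (\<integral>\<^sup>+y. q (?d y) \<partial>M)" by (subst M.nn_integral_mass) (auto simp: Q)
        also have "\<dots> = (\<integral>\<^sup>+r. q r \<partial>distr M borel ?d)" by (subst nn_integral_distr) auto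
        also have "\<dots> = (\<integral>\<^sup>+r. q r \<partial>distr N borel ?d)" by (simp only: dd)
        also have "\<dots> = (\<integral>\<^sup>+y. q (?d y) \<partial>N)" by (subst nn_integral_distr) auto
        also have "\<dots> = (\<integral>\<^sup>+w. N.mass \<epsilon> (?d w) * indicator ?S w \<partial>lborel)" by (subst N.nn_integral_mass) (auto simp: Q)
        also have "\<dots> = emeasure (density ?L (N.mass \<epsilon>)) S"
          by (subst emeasure_density, simp, simp, subst nn_integral_distr) (auto simp: indicator_def intro!: nn_integral_cong)
        finally show "emeasure (density ?L (M.mass \<epsilon>)) S = emeasure (density ?L (N.mass \<epsilon>)) S" .
      qed simp
    qed auto
    then show ?thesis by (rule AE_distrD[rotated]) simp
  qed
  have compact: "emeasure M C = emeasure N C" if C: "compact C" "C \<noteq> {}" for C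
  proof -
    have clC: "closed C" using C compact_imp_closed by blast
    have "\<exists>R. \<forall>y\<in>C. dist x y \<le> R"
      using compact_imp_bounded[OF C(1)] bounded_any_center[of C x] by simp
    then obtain R where "\<forall>y\<in>C. dist x y \<le> R" ..
    then have R: "C \<subseteq> cball x R" by auto
    define e where "e j = 1 / real (Suc j)" for j
    have e: "e j > 0" "e j \<le> 1" for j by (auto simp: e_def)
    \<comment> \<open>The margin \<open>e j\<close> is chosen to match the radius of the balls:
      balls centred in \<open>C\<close> lie in \<open>D j\<close>, so \<open>F j\<close> is 1 on
      \<open>C\<close>, while off the closed set \<open>C\<close> a small ball eventually misses
      \<open>D j\<close>.\<close>
    define D where "D j = {w. infdist w C \<le> e j}" for j
    have [measurable]: "D j \<in> sets borel" for j
      unfolding D_def by (intro borel_closed closed_Collect_le continuous_intros)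
    define V where "V j = emeasure lborel (cball (0 :: real^'n) (e j))" for j
    have V: "V j \<noteq> 0" "V j \<noteq> \<infinity>" "emeasure lborel (cball (y :: real^'n) (e j)) = V j" for j y
      using e[of j] by (simp_all add: V_def emeasure_cball less_imp_neq[symmetric])
    define F where "F j y = emeasure lborel (cball y (e j) \<inter> D j) / V j" for j y
    have m [measurable]: "(\<lambda>y. emeasure lborel (cball y (e j) \<inter> D j)) \<in> borel_measurable borel" for j
      by (rule measurable_emeasure_cball_Int[OF lborel.sigma_finite_measure_axioms]) auto
    then have [measurable]: "F j \<in> borel_measurable borel" for j unfolding F_def[abs_def] by measurable
    have tri: "infdist y C \<le> infdist w C + dist y w" for y w
      by (rule infdist_triangle)
    have lim: "(\<lambda>j. \<integral>\<^sup>+y. F j y \<partial>K) \<longlonglongrightarrow> emeasure K C" if "rotation_invariant_measure K x" for K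
    proof -
      interpret K: rotation_invariant_measure K x by fact
      have "(\<lambda>j. \<integral>\<^sup>+y. F j y \<partial>K) \<longlonglongrightarrow> (\<integral>\<^sup>+y. indicator C y \<partial>K)"
      \<comment> \<open>\<open>F j\<close> is at most 1, and if it is nonzero at \<open>y\<close>,
        then \<open>y\<close> has distance at most \<open>2 * e j \<le> 2\<close> from
        \<open>C\<close>, hence at most \<open>R + 2\<close> from \<open>x\<close>.\<close>
      proof (rule nn_integral_dominated_convergence[where w = "indicator (cball x (R + 2))"])
        show "(\<integral>\<^sup>+y. indicator (cball x (R + 2)) y \<partial>K) < \<infinity>"
          using K.finite_cball by simp
        show "AE y in K. F j y \<le> indicator (cball x (R + 2)) y" for j
        proof (intro AE_I2)
          fix y
          show "F j y \<le> indicator (cball x (R + 2)) y"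
          proof (cases "cball y (e j) \<inter> D j = {}")
            case False
            then obtain w where w: "dist y w \<le> e j" "infdist w C \<le> e j" by (auto simp: D_def)
            then have "infdist y C \<le> 2" using tri[of y w] e[of j] by linarith
            moreover obtain c where c: "c \<in> C" "infdist y C = dist y c"
              using infdist_attains_inf[OF clC C(2)] by metis
            moreover have "dist x c \<le> R" using R c(1) by auto
            ultimately have "dist x y \<le> R + 2" using dist_triangle2[of x y c] by linarith
            moreover have "F j y \<le> V j / V j" unfolding F_def V(3)[of y j, symmetric]
              by (intro divide_right_mono_ennreal emeasure_mono) auto
            ultimately show ?thesis using V(1,2)[of j] by (simp add: ennreal_divide_self less_top)
          qed (simp add: F_def)
        qed
        show "AE y in K. (\<lambda>j. F j y) \<longlonglongrightarrow> indicator C y"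
        proof (intro AE_I2)
          fix y
          show "(\<lambda>j. F j y) \<longlonglongrightarrow> indicator C y"
          proof (cases "y \<in> C")
            case True
            have "cball y (e j) \<inter> D j = cball y (e j)" for j
            proof -
              have "infdist w C \<le> dist y w" for w
                using tri[of w y] True by (simp add: dist_commute)
              then have "dist y w \<le> e j \<Longrightarrow> infdist w C \<le> e j" for w by (rule order_trans)
              then show ?thesis by (auto simp: D_def)
            qed
            then have "F j y = 1" for j using V(1,2)[of j] V(3)[of y j] by (simp add: F_def ennreal_divide_self less_top)
            then show ?thesis using True by simp
          next
            case False
            then have d: "infdist y C > 0" using clC C(2) by (simp add: infdist_pos_not_in_closed)
            have "e \<longlonglongrightarrow> 0" unfolding e_def using LIMSEQ_inverse_real_of_nat by (simp add: inverse_eq_divide)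
            then have "eventually (\<lambda>j. e j < infdist y C / 2) sequentially"
              using d by (intro order_tendstoD) auto
            then have "eventually (\<lambda>j. F j y = 0) sequentially"
            proof eventually_elim
              case (elim j)
              have "cball y (e j) \<inter> D j = {}"
              proof (rule ccontr)
                assume "cball y (e j) \<inter> D j \<noteq> {}"
                then obtain w where "dist y w \<le> e j" "infdist w C \<le> e j" by (auto simp: D_def)
                then show False using tri[of y w] elim by linarith
              qed
              then show ?case by (simp add: F_def)
            qed
            then show ?thesis using False by (simp add: tendsto_eventually)
          qed
        qed
        show "indicator C \<in> borel_measurable K" "indicator (cball x (R + 2)) \<in> borel_measurable K"
          using clC by (auto intro!: borel_measurable_indicator)
      qed auto
      then show ?thesis using clC by simp
    qed
    have int: "(\<integral>\<^sup>+y. F j y \<partial>K) = (\<integral>\<^sup>+w. rotation_invariant_measure.mass K x (e j) (?d w) * indicator (D j) w \<partial>lborel) / V j"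
      if "rotation_invariant_measure K x" for K j
    proof -
      interpret K: rotation_invariant_measure K x by fact
      have "(\<integral>\<^sup>+y. F j y \<partial>K) = (\<integral>\<^sup>+y. emeasure lborel (cball y (e j) \<inter> D j) \<partial>K) / V j"
        unfolding F_def by (rule nn_integral_divide) (simp add: m)
      then show ?thesis by (simp add: K.nn_integral_mass)
    qed
    have "(\<integral>\<^sup>+y. F j y \<partial>M) = (\<integral>\<^sup>+y. F j y \<partial>N)" for j
    proof -
      have "(\<integral>\<^sup>+w. M.mass (e j) (?d w) * indicator (D j) w \<partial>lborel) = (\<integral>\<^sup>+w. N.mass (e j) (?d w) * indicator (D j) w \<partial>lborel)"
        by (rule nn_integral_cong_AE) (use mass[of "e j"] in eventually_elim, simp)
      then show ?thesis by (simp only: int[OF assms(1)] int[OF assms(2)])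
    qed
    then have "(\<lambda>j. \<integral>\<^sup>+y. F j y \<partial>M) \<longlonglongrightarrow> emeasure N C" using lim[OF assms(2)] by simp
    with lim[OF assms(1)] show ?thesis by (rule LIMSEQ_unique)
  qed
  show ?thesis
  proof (rule measure_eqI_generator_eq[where E = "Collect closed" and \<Omega> = UNIV and A = "\<lambda>n. cball x (real n)"])
    show "Int_stable (Collect closed :: (real^'n) set set)" by (auto simp: Int_stable_def)
    show "sets M = sigma_sets UNIV (Collect closed)" "sets N = sigma_sets UNIV (Collect closed)"
      by (simp_all add: borel_eq_closed)
    show "(\<Union>n. cball x (real n)) = UNIV" using real_arch_simple by (auto simp: set_eq_iff)
    show "emeasure M (cball x (real n)) \<noteq> \<infinity>" for n using M.finite_cball[of n] by auto
    fix X :: "(real^'n) set" assume "X \<in> Collect closed"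
    then have X: "closed X" by simp
    have "emeasure K X = (SUP n. emeasure K (X \<inter> cball x (real n)))" if "sets K = sets borel" for K
    proof -
      have "(\<Union>n. X \<inter> cball x (real n)) = X" using real_arch_simple by (auto simp: set_eq_iff)
      moreover have "incseq (\<lambda>n. X \<inter> cball x (real n))" by (intro incseq_SucI) auto
      moreover have "range (\<lambda>n. X \<inter> cball x (real n)) \<subseteq> sets K" using X by (auto simp: that)
      ultimately show ?thesis using SUP_emeasure_incseq[of "\<lambda>n. X \<inter> cball x (real n)" K] by metis
    qed
    moreover have "emeasure M (X \<inter> cball x (real n)) = emeasure N (X \<inter> cball x (real n))" for n
      using compact[OF closed_Int_compact[OF X compact_cball]] by (cases "X \<inter> cball x (real n) = {}") (simp, blast)
    ultimately show "emeasure M X = emeasure N X" by simp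
  qed auto
qed

section \<open>The dual transform of the transform as a Riesz potential\<close>

text \<open>The projection is affine and fixes \<open>x\<close>, so it is determined by its values
  at finitely many points. This reduces joint measurability in plane and point to measurability in
  the plane at these fixed points.\<close>

lemma closest_point_kplane_linear:
  assumes "\<xi> \<in> kplanes_through k x"
  shows "closest_point \<xi> y = x + (\<Sum>i\<in>UNIV. (y - x) $ i *\<^sub>R (closest_point \<xi> (x + axis i 1) - x))"
proof -
  obtain b where b: "orthonormal_frame k b" "\<xi> = range (frame_map k x b)"
    using kplanes_through_frame[OF assms] .
  define g where "g v = (\<Sum>i<k. (v \<bullet> b i) *\<^sub>R b i)" for v
  have cp: "closest_point \<xi> y = x + g (y - x)" for y
    unfolding b(2) closest_point_frame[OF b(1)] frame_map_def g_def ..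
  have "linear g"
    unfolding g_def by (rule linearI) (auto simp: inner_add_left scaleR_add_left sum.distrib scaleR_sum_right)
  then have "g v = (\<Sum>i\<in>UNIV. v $ i *\<^sub>R g (axis i 1))" for v
    by (subst basis_expansion[symmetric, of v]) (simp add: linear_sum linear_scale scalar_mult_eq_scaleR)
  from this[of "y - x"] show ?thesis by (simp add: cp)
qed

definition kplane_weight :: "(real ^ 'n) set \<times> (real ^ 'n) \<Rightarrow> real" where
  "kplane_weight = (\<lambda>(\<xi>, y). exp (- (pi * (norm (y - closest_point \<xi> y))\<^sup>2)))"

locale invariant_kplanes =
  fixes k :: nat and x :: "real ^ 'n" and \<mu> :: "(real ^ 'n) set measure"
  assumes card2: "CARD('n) \<ge> 2" and inv: "rotation_invariant_prob k x \<mu>"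
begin

lemma space_\<mu>: "space \<mu> = kplanes_through k x"
  and sets_\<mu>: "sets \<mu> = sigma_sets (kplanes_through k x) {U. openin (grassmann_topology k x) U}"
  and distr_\<mu>: "rotation_matrix A \<Longrightarrow> distr \<mu> \<mu> ((`) (rotate_about x A)) = \<mu>"
  using inv by (auto simp: rotation_invariant_prob_def)

sublocale prob_space \<mu>
  using inv unfolding rotation_invariant_prob_def by (intro prob_spaceI) blast

sublocale PL: pair_sigma_finite \<mu> "lborel :: (real ^ 'n) measure" ..

lemma measurable_cp [measurable]:
  "(\<lambda>(\<xi>, y). closest_point \<xi> y) \<in> borel_measurable (\<mu> \<Otimes>\<^sub>M lborel)"
proof -
  let ?M = "\<mu> \<Otimes>\<^sub>M (lborel :: (real ^ 'n) measure)"
  have "(\<lambda>p. closest_point (fst p) z) \<in> borel_measurable ?M" for z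
    by (rule measurable_compose[OF measurable_fst measurable_closest_point_kplane[OF space_\<mu> sets_\<mu>]])
  moreover have "(\<lambda>p. (snd p - x) $ i) \<in> borel_measurable ?M" for i
  proof (rule measurable_compose[OF measurable_snd])
    show "(\<lambda>y. (y - x) $ i) \<in> borel_measurable lborel"
      unfolding measurable_lborel2 by (intro borel_measurable_continuous_onI continuous_intros)
  qed
  ultimately have "(\<lambda>p. x + (\<Sum>i\<in>UNIV. (snd p - x) $ i *\<^sub>R (closest_point (fst p) (x + axis i 1) - x))) \<in> borel_measurable ?M"
    by (intro borel_measurable_add borel_measurable_const borel_measurable_sum borel_measurable_scaleR borel_measurable_diff)
  also have "?this \<longleftrightarrow> ?thesis"
  proof (rule measurable_cong)
    fix p assume "p \<in> space ?M"
    then have "fst p \<in> kplanes_through k x" by (auto simp: space_pair_measure space_\<mu>)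
    from closest_point_kplane_linear[OF this, of "snd p"]
    show "x + (\<Sum>i\<in>UNIV. (snd p - x) $ i *\<^sub>R (closest_point (fst p) (x + axis i 1) - x)) = (case p of (\<xi>, y) \<Rightarrow> closest_point \<xi> y)"
      by (simp add: case_prod_beta)
  qed
  finally show ?thesis .
qed

lemma measurable_weight [measurable]:
  "kplane_weight \<in> borel_measurable (\<mu> \<Otimes>\<^sub>M lborel)"
proof -
  have "(\<lambda>p. case p of (\<xi>, y) \<Rightarrow> closest_point \<xi> y) \<in> borel_measurable (\<mu> \<Otimes>\<^sub>M lborel)" by (rule measurable_cp)
  then have "(\<lambda>p. exp (- (pi * (norm (snd p - (case p of (\<xi>, y) \<Rightarrow> closest_point \<xi> y)))\<^sup>2))) \<in> borel_measurable (\<mu> \<Otimes>\<^sub>M lborel)"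
    by measurable
  then show ?thesis by (simp add: kplane_weight_def case_prod_beta)
qed

text \<open>The mean over \<open>\<mu>\<close> of the Lebesgue measures of the planes, written as a
  single image of a density on the product. In this form measurability in the plane and Fubini are
  available.\<close>

definition \<nu> :: "(real ^ 'n) measure" where
  "\<nu> = distr (density (\<mu> \<Otimes>\<^sub>M lborel) (\<lambda>p. ennreal (kplane_weight p))) borel (\<lambda>(\<xi>, y). closest_point \<xi> y)"

lemma kplane_lborel_weight:
  assumes "\<xi> \<in> space \<mu>"
  shows "kplane_lborel k \<xi> = distr (density lborel (\<lambda>y. ennreal (kplane_weight (\<xi>, y)))) borel (closest_point \<xi>)"
  using kplane_lborel_gauss[of \<xi> k x] assms by (simp add: space_\<mu> kplane_weight_def)

lemma measurable_slice:
  assumes "\<xi> \<in> space \<mu>"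
  shows "closest_point \<xi> \<in> borel_measurable borel" "(\<lambda>y. kplane_weight (\<xi>, y)) \<in> borel_measurable borel"
  using measurable_closest_point[of \<xi> k x] assms measurable_Pair2[OF measurable_weight assms] by (auto simp: space_\<mu>)

lemma emeasure_\<nu>:
  assumes [measurable]: "B \<in> sets borel"
  shows "(\<lambda>\<xi>. emeasure (kplane_lborel k \<xi>) B) \<in> borel_measurable \<mu>"
    and "emeasure \<nu> B = (\<integral>\<^sup>+\<xi>. emeasure (kplane_lborel k \<xi>) B \<partial>\<mu>)"
proof -
  let ?h = "\<lambda>p. ennreal (kplane_weight p) * indicator B (case p of (\<xi>, y) \<Rightarrow> closest_point \<xi> y)"
  have h: "?h \<in> borel_measurable (\<mu> \<Otimes>\<^sub>M lborel)" by measurable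
  have s: "emeasure (kplane_lborel k \<xi>) B = (\<integral>\<^sup>+y. ?h (\<xi>, y) \<partial>lborel)" if "\<xi> \<in> space \<mu>" for \<xi>
  proof -
    note measurable_slice[OF that, measurable]
    show ?thesis unfolding kplane_lborel_weight[OF that]
      by (subst nn_integral_indicator[symmetric], simp, subst nn_integral_distr, simp, simp, subst nn_integral_density) auto
  qed
  have "(\<lambda>\<xi>. \<integral>\<^sup>+y. ?h (\<xi>, y) \<partial>lborel) \<in> borel_measurable \<mu>"
    using lborel.borel_measurable_nn_integral_fst[OF h] .
  then show "(\<lambda>\<xi>. emeasure (kplane_lborel k \<xi>) B) \<in> borel_measurable \<mu>"
    using s by (simp cong: measurable_cong)
  have "emeasure \<nu> B = (\<integral>\<^sup>+p. ?h p \<partial>(\<mu> \<Otimes>\<^sub>M lborel))"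
    unfolding \<nu>_def
    by (subst nn_integral_indicator[symmetric], simp, subst nn_integral_distr, simp, simp, subst nn_integral_density) auto
  also have "\<dots> = (\<integral>\<^sup>+\<xi>. \<integral>\<^sup>+y. ?h (\<xi>, y) \<partial>lborel \<partial>\<mu>)"
    using lborel.nn_integral_fst[OF h] by simp
  also have "\<dots> = (\<integral>\<^sup>+\<xi>. emeasure (kplane_lborel k \<xi>) B \<partial>\<mu>)"
    using s by (intro nn_integral_cong) simp
  finally show "emeasure \<nu> B = (\<integral>\<^sup>+\<xi>. emeasure (kplane_lborel k \<xi>) B \<partial>\<mu>)" .
qed

text \<open>Integrability for \<open>\<nu>\<close> unfolds to integrability on the product. Fubini
  then gives an iterated integral whose inner part is the integral over a plane in its Gaussian
  form.\<close>

lemma dual_kplane_transform_\<nu>: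
  assumes \<mu>: "\<mu> = kplane_prob k x" and f: "integrable \<nu> f"
  shows "dual_kplane_transform k (kplane_transform k f) x = (LINT y|\<nu>. f y)"
proof -
  have [measurable]: "f \<in> borel_measurable borel"
    using f by (auto simp: \<nu>_def)
  let ?h = "\<lambda>p. kplane_weight p *\<^sub>R f (case p of (\<xi>, y) \<Rightarrow> closest_point \<xi> y)"
  have nn: "kplane_weight p \<ge> 0" for p :: "(real ^ 'n) set \<times> (real ^ 'n)" by (simp add: kplane_weight_def case_prod_beta)
  have "integrable (density (\<mu> \<Otimes>\<^sub>M lborel) (\<lambda>p. ennreal (kplane_weight p))) (\<lambda>p. f (case p of (\<xi>, y) \<Rightarrow> closest_point \<xi> y))"
    using f unfolding \<nu>_def by (subst (asm) integrable_distr_eq) auto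
  then have h: "integrable (\<mu> \<Otimes>\<^sub>M lborel) ?h"
    by (subst (asm) integrable_density) (auto simp: nn)
  have "(LINT y|\<nu>. f y) = (LINT p|(\<mu> \<Otimes>\<^sub>M lborel). ?h p)"
    unfolding \<nu>_def by (subst integral_distr, simp, simp, subst integral_density) (auto simp: nn)
  also have "\<dots> = (LINT \<xi>|\<mu>. LINT y|lborel. ?h (\<xi>, y))"
    using PL.integral_fst'[OF h] by simp
  also have "\<dots> = (LINT \<xi>|\<mu>. kplane_transform k f \<xi>)"
  proof (intro Bochner_Integration.integral_cong refl)
    fix \<xi> assume \<xi>: "\<xi> \<in> space \<mu>"
    note measurable_slice[OF \<xi>, measurable]
    show "(LINT y|lborel. ?h (\<xi>, y)) = kplane_transform k f \<xi>"
      unfolding kplane_transform_def kplane_lborel_weight[OF \<xi>]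
      by (subst integral_distr, simp, simp, subst integral_density) (auto simp: nn)
  qed
  finally show ?thesis by (simp add: dual_kplane_transform_def \<mu>)
qed

lemma kplane_lborel_rotate:
  assumes A: "rotation_matrix A" and \<xi>: "\<xi> \<in> kplanes_through k x"
  shows "kplane_lborel k (rotate_about x A ` \<xi>) = distr (kplane_lborel k \<xi>) borel (rotate_about x A)"
proof -
  obtain b where b: "orthonormal_frame k b" "\<xi> = range (frame_map k x b)"
    using kplanes_through_frame[OF \<xi>] .
  let ?b = "\<lambda>i. A *v b i"
  have "orthonormal_frame k ?b"
    using b(1) rotation_matrix_orthogonal(3)[OF A] by (simp add: orthonormal_frame_def orthogonal_transformation_def)
  moreover have fm: "frame_map k x ?b = rotate_about x A \<circ> frame_map k x b"
    by (simp add: fun_eq_iff frame_map_def rotate_about_def linear_sum[OF matrix_vector_mul_linear] matrix_vector_mult_scaleR)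
  then have "rotate_about x A ` \<xi> = range (frame_map k x ?b)" by (simp add: b(2) image_comp)
  ultimately have "kplane_lborel k (rotate_about x A ` \<xi>) = distr (\<Pi>\<^sub>M i\<in>{..<k}. lborel) borel (rotate_about x A \<circ> frame_map k x b)"
    using kplane_lborel_eq fm by metis
  also have "\<dots> = distr (kplane_lborel k \<xi>) borel (rotate_about x A)"
    by (simp add: kplane_lborel_eq[OF b] distr_distr)
  finally show ?thesis .
qed

lemma emeasure_\<nu>_cball:
  assumes "r > 0"
  shows "emeasure \<nu> (cball x r) = ennreal (unit_ball_vol k * r ^ k)"
proof -
  have "emeasure \<nu> (cball x r) = (\<integral>\<^sup>+\<xi>. ennreal (unit_ball_vol k * r ^ k) \<partial>\<mu>)"
    using emeasure_kplane_cball[OF _ assms] by (subst emeasure_\<nu>, simp, intro nn_integral_cong) (simp add: space_\<mu>)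
  then show ?thesis by (simp add: emeasure_space_1)
qed

lemma rotation_invariant_\<nu>: "rotation_invariant_measure \<nu> x"
proof
  show "CARD('n) \<ge> 2" by (rule card2)
  show sets: "sets \<nu> = sets borel" by (simp add: \<nu>_def)
  show "emeasure \<nu> (cball x r) < \<infinity>" for r
  proof -
    have "emeasure \<nu> (cball x r) \<le> emeasure \<nu> (cball x (max 1 r))"
      using sets by (intro emeasure_mono) auto
    also have "\<dots> < \<infinity>" by (subst emeasure_\<nu>_cball) auto
    finally show ?thesis .
  qed
  fix A :: "real ^ 'n ^ 'n" assume A: "rotation_matrix A"
  let ?R = "rotate_about x A"
  note F = measurable_rotate_image[OF space_\<mu> sets_\<mu> A]
  show "distr \<nu> borel ?R = \<nu>"
  proof (rule measure_eqI)
    fix B assume "B \<in> sets (distr \<nu> borel ?R)"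
    then have B [measurable]: "B \<in> sets borel" by simp
    have RB: "?R -` B \<in> sets borel" using measurable_sets[OF rotate_about_measurable B] by simp
    have sk: "sets (kplane_lborel k \<xi>) = sets borel" if "\<xi> \<in> space \<mu>" for \<xi>
      using kplane_lborel_weight[OF that] by simp
    have "emeasure (distr \<nu> borel ?R) B = emeasure \<nu> (?R -` B)"
      using sets sets_eq_imp_space_eq[OF sets] by (subst emeasure_distr) (auto simp: measurable_cong_sets[OF sets refl])
    also have "\<dots> = (\<integral>\<^sup>+\<xi>. emeasure (kplane_lborel k \<xi>) (?R -` B) \<partial>\<mu>)"
      by (rule emeasure_\<nu>(2)[OF RB])
    \<comment> \<open>Pulling the set back by the rotation amounts to rotating the plane, which
      brings in the invariance of \<open>\<mu>\<close>.\<close>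
    also have "\<dots> = (\<integral>\<^sup>+\<xi>. emeasure (kplane_lborel k (?R ` \<xi>)) B \<partial>\<mu>)"
    proof (rule nn_integral_cong)
      fix \<xi> assume \<xi>: "\<xi> \<in> space \<mu>"
      then have "\<xi> \<in> kplanes_through k x" by (simp add: space_\<mu>)
      then show "emeasure (kplane_lborel k \<xi>) (?R -` B) = emeasure (kplane_lborel k (?R ` \<xi>)) B"
        unfolding kplane_lborel_rotate[OF A \<open>\<xi> \<in> kplanes_through k x\<close>]
        using sk[OF \<xi>] sets_eq_imp_space_eq[OF sk[OF \<xi>]] B
        by (subst emeasure_distr) (auto simp: measurable_cong_sets[OF sk[OF \<xi>] refl])
    qed
    also have "\<dots> = (\<integral>\<^sup>+\<xi>. emeasure (kplane_lborel k \<xi>) B \<partial>distr \<mu> \<mu> ((`) ?R))"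
      using emeasure_\<nu>(1)[OF B] F by (subst nn_integral_distr) auto
    also have "\<dots> = emeasure \<nu> B" by (simp only: distr_\<mu>[OF A] emeasure_\<nu>(2)[OF B])
    finally show "emeasure (distr \<nu> borel ?R) B = emeasure \<nu> B" .
  qed (simp add: sets)
qed

end

text \<open>The factor for which \<open>c \<bar>y - x\<bar> powr (k - n)\<close> gives the balls about \<open>x\<close> the mass \<open>\<omega>\<^sub>k r\<^sup>k\<close>.\<close>

definition kplane_const :: "real \<Rightarrow> real \<Rightarrow> real" where
  "kplane_const n k = k * unit_ball_vol k / (n * unit_ball_vol n)"

text \<open>The comparison measure for the uniqueness theorem. It is invariant because its density
  depends on the distance from \<open>x\<close> alone and \<open>lborel\<close> is
  invariant.\<close>

lemma powr_density_rotation_invariant: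
  fixes x :: "real ^ 'n" and s c :: real
  assumes card2: "CARD('n) \<ge> 2" and s: "s > 0" and c: "c \<ge> 0"
  defines "P \<equiv> density lborel (\<lambda>y. ennreal (c * norm (y - x) powr (s - CARD('n))))"
  shows "rotation_invariant_measure P x"
    and "r \<ge> 0 \<Longrightarrow> emeasure P (cball x r) = ennreal (c * (CARD('n) * unit_ball_vol CARD('n) * r powr s / s))"
proof -
  have sets: "sets P = sets borel" by (simp add: P_def)
  have cb: "emeasure P (cball x r) = ennreal (c * (CARD('n) * unit_ball_vol CARD('n) * r powr s / s))" if r: "r \<ge> 0" for r
  proof -
    have [measurable]: "(indicator (cball x r) :: _ \<Rightarrow> ennreal) \<in> borel_measurable borel"
      by (intro borel_measurable_indicator) simp
    have "emeasure P (cball x r) = (\<integral>\<^sup>+y. ennreal (c * norm (y - x) powr (s - CARD('n))) * indicator (cball x r) y \<partial>lborel)"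
      unfolding P_def by (rule emeasure_density) auto
    also have "\<dots> = (\<integral>\<^sup>+y. ennreal (c * norm (x + y - x) powr (s - CARD('n))) * indicator (cball x r) (x + y) \<partial>lborel)"
      by (rule nn_integral_lborel_translate[symmetric]) measurable
    also have "\<dots> = (\<integral>\<^sup>+y. ennreal c * (ennreal (norm y powr (s - real DIM(real ^ 'n))) * indicator (cball 0 r) y) \<partial>(lborel :: (real ^ 'n) measure))"
    proof (rule nn_integral_cong)
      fix y :: "real ^ 'n"
      have "indicator (cball x r) (x + y) = (indicator (cball 0 r) y :: ennreal)"
        by (simp add: indicator_def dist_norm)
      then show "ennreal (c * norm (x + y - x) powr (s - CARD('n))) * indicator (cball x r) (x + y)
         = ennreal c * (ennreal (norm y powr (s - real DIM(real ^ 'n))) * indicator (cball 0 r) y)"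
        using c by (simp add: ennreal_mult' mult.assoc)
    qed
    also have "\<dots> = ennreal c * ennreal (real DIM(real ^ 'n) * unit_ball_vol DIM(real ^ 'n) * r powr s / s)"
      unfolding nn_integral_norm_powr_cball[OF s r, where ?'a = "real ^ 'n", symmetric]
      by (rule nn_integral_cmult) (intro borel_measurable_times_ennreal borel_measurable_indicator, measurable)
    also have "\<dots> = ennreal (c * (real DIM(real ^ 'n) * unit_ball_vol DIM(real ^ 'n) * r powr s / s))"
      using c by (rule ennreal_mult'[symmetric])
    finally show ?thesis by simp
  qed
  then show "r \<ge> 0 \<Longrightarrow> emeasure P (cball x r) = ennreal (c * (CARD('n) * unit_ball_vol CARD('n) * r powr s / s))" .
  show "rotation_invariant_measure P x"
  proof
    show "CARD('n) \<ge> 2" by (rule card2)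
    show "sets P = sets borel" by (rule sets)
    show "emeasure P (cball x r) < \<infinity>" for r
      using cb[of r] by (cases "r \<ge> 0") auto
    fix A :: "real ^ 'n ^ 'n" assume A: "rotation_matrix A"
    let ?R = "rotate_about x A" and ?h = "\<lambda>y. ennreal (c * norm (y - x) powr (s - CARD('n)))"
    show "distr P borel ?R = P"
    proof (rule measure_eqI)
      fix B assume "B \<in> sets (distr P borel ?R)"
      then have B [measurable]: "B \<in> sets borel" by simp
      have "emeasure (distr P borel ?R) B = (\<integral>\<^sup>+y. indicator B (?R y) \<partial>P)"
        by (subst nn_integral_indicator[symmetric], simp, subst nn_integral_distr) (auto simp: P_def)
      also have "\<dots> = (\<integral>\<^sup>+y. ?h (?R y) * indicator B (?R y) \<partial>lborel)"
        unfolding P_def by (subst nn_integral_density) (auto simp: norm_rotate_about[OF A])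
      also have "\<dots> = (\<integral>\<^sup>+y. ?h y * indicator B y \<partial>distr lborel borel ?R)"
        by (rule nn_integral_distr[symmetric]) measurable
      also have "\<dots> = emeasure P B"
        unfolding distr_lborel_rotate_about[OF A] P_def by (rule emeasure_density[symmetric]) auto
      finally show "emeasure (distr P borel ?R) B = emeasure P B" .
    qed (simp add: sets)
  qed
qed

lemma dual_kplane_transform_riesz:
  fixes f :: "real ^ 'n \<Rightarrow> complex" and x :: "real ^ 'n" and k :: nat
  assumes card2: "CARD('n) \<ge> 2" and k: "1 \<le> k" "k \<le> CARD('n)"
    and f: "integrable lborel (\<lambda>y. norm (y - x) powr (real k - CARD('n)) *\<^sub>R f y)"
    and f_meas [measurable]: "f \<in> borel_measurable borel"
  shows "dual_kplane_transform k (kplane_transform k f) x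
    = kplane_const CARD('n) k *\<^sub>R (LINT y|lborel. norm (y - x) powr (real k - CARD('n)) *\<^sub>R f y)"
proof -
  let ?c = "kplane_const CARD('n) k" and ?w = "\<lambda>y. norm (y - x) powr (real k - CARD('n))"
  have "rotation_invariant_prob k x (kplane_prob k x)"
    unfolding kplane_prob_def using rotation_invariant_prob_exists[OF k(2)] by (rule someI_ex)
  then interpret invariant_kplanes k x "kplane_prob k x" by unfold_locales (rule card2)
  have c: "?c \<ge> 0" by (simp add: kplane_const_def)
  define P where "P = density lborel (\<lambda>y. ennreal (?c * ?w y))"
  have "real k > 0" using k by simp
  note P = powr_density_rotation_invariant[OF card2 this c, where x = x, folded P_def]
  have "\<nu> = P"
  proof (rule rotation_invariant_measure_unique[OF rotation_invariant_\<nu> P(1)])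
    fix r :: real assume r: "r > 0"
    show "emeasure \<nu> (cball x r) = emeasure P (cball x r)"
      using r k unit_ball_vol_pos[of "real CARD('n)", THEN less_imp_neq]
      by (simp add: emeasure_\<nu>_cball P(2) kplane_const_def powr_realpow)
  qed
  have i: "integrable lborel (\<lambda>y. (?c * ?w y) *\<^sub>R f y)"
    using integrable_scaleR_right[OF f, of ?c] by simp
  have "integrable \<nu> f"
    unfolding \<open>\<nu> = P\<close> P_def using c i by (subst integrable_density) auto
  then have "dual_kplane_transform k (kplane_transform k f) x = (LINT y|\<nu>. f y)"
    by (intro dual_kplane_transform_\<nu>) auto
  also have "\<dots> = (LINT y|lborel. (?c * ?w y) *\<^sub>R f y)"
    unfolding \<open>\<nu> = P\<close> P_def using c by (subst integral_density) auto
  also have "\<dots> = ?c *\<^sub>R (LINT y|lborel. ?w y *\<^sub>R f y)"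
    by (subst integral_scaleR_right[symmetric]) simp
  finally show ?thesis .
qed

section \<open>Composition of Riesz kernels\<close>

text \<open>The normalising factor at real arguments, where the kernel identities can be proved with
  nonnegative integrals.\<close>

definition riesz_H_real :: "real \<Rightarrow> real \<Rightarrow> real" where
  "riesz_H_real n \<alpha> = 2 powr \<alpha> * pi powr (n / 2) * Gamma (\<alpha> / 2) / Gamma ((n - \<alpha>) / 2)"

lemma riesz_H_of_real: "riesz_H n (complex_of_real \<alpha>) = complex_of_real (riesz_H_real (real n) \<alpha>)"
proof -
  have "(2::complex) powr complex_of_real \<alpha> = complex_of_real (2 powr \<alpha>)"
    using powr_of_real[of 2 \<alpha>] by simp
  moreover have "complex_of_real pi powr (of_nat n / 2) = complex_of_real (pi powr (real n / 2))"
    using powr_of_real[of pi "real n / 2"] by simp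
  moreover have "Gamma (complex_of_real \<alpha> / 2) = complex_of_real (Gamma (\<alpha> / 2))"
    using Gamma_complex_of_real[of "\<alpha> / 2"] by simp
  moreover have "Gamma ((of_nat n - complex_of_real \<alpha>) / 2) = complex_of_real (Gamma ((real n - \<alpha>) / 2))"
    using Gamma_complex_of_real[of "(real n - \<alpha>) / 2"] by simp
  ultimately show ?thesis by (simp add: riesz_H_def riesz_H_real_def)
qed

lemma riesz_H_real_pos: "0 < \<alpha> \<Longrightarrow> \<alpha> < n \<Longrightarrow> riesz_H_real n \<alpha> > 0"
  unfolding riesz_H_real_def by (intro mult_pos_pos divide_pos_pos Gamma_real_pos) auto

lemma gauss_complete_square:
  fixes x y z :: "'a::real_inner"
  assumes "\<sigma> + \<tau> \<noteq> 0"
  shows "\<sigma> * (norm (x - y))\<^sup>2 + \<tau> * (norm (y - z))\<^sup>2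
    = (\<sigma> * \<tau> / (\<sigma> + \<tau>)) * (norm (x - z))\<^sup>2
      + (\<sigma> + \<tau>) * (norm (y - (1 / (\<sigma> + \<tau>)) *\<^sub>R (\<sigma> *\<^sub>R x + \<tau> *\<^sub>R z)))\<^sup>2"
proof -
  define p q where "p = y - x" and "q = y - z"
  have "y - (1 / (\<sigma> + \<tau>)) *\<^sub>R (\<sigma> *\<^sub>R x + \<tau> *\<^sub>R z) = (1 / (\<sigma> + \<tau>)) *\<^sub>R ((\<sigma> + \<tau>) *\<^sub>R y - (\<sigma> *\<^sub>R x + \<tau> *\<^sub>R z))"
    using assms by (simp add: scaleR_diff_right)
  also have "(\<sigma> + \<tau>) *\<^sub>R y - (\<sigma> *\<^sub>R x + \<tau> *\<^sub>R z) = \<sigma> *\<^sub>R p + \<tau> *\<^sub>R q"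
    by (simp add: p_def q_def algebra_simps)
  finally have m: "y - (1 / (\<sigma> + \<tau>)) *\<^sub>R (\<sigma> *\<^sub>R x + \<tau> *\<^sub>R z) = (1 / (\<sigma> + \<tau>)) *\<^sub>R (\<sigma> *\<^sub>R p + \<tau> *\<^sub>R q)" .
  have poly: "(\<sigma> + \<tau>) * (\<sigma> * (p \<bullet> p) + \<tau> * (q \<bullet> q))
    = \<sigma> * \<tau> * ((q - p) \<bullet> (q - p)) + (\<sigma> *\<^sub>R p + \<tau> *\<^sub>R q) \<bullet> (\<sigma> *\<^sub>R p + \<tau> *\<^sub>R q)"
    by (simp add: inner_diff_left inner_diff_right inner_add_left inner_add_right inner_commute algebra_simps)
  have "x - z = q - p" "norm (x - y) = norm p" by (simp_all add: p_def q_def norm_minus_commute)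
  then have "\<sigma> * (norm (x - y))\<^sup>2 + \<tau> * (norm (y - z))\<^sup>2 = \<sigma> * (p \<bullet> p) + \<tau> * (q \<bullet> q)"
    by (simp add: power2_norm_eq_inner q_def)
  also have "\<dots> = (\<sigma> * \<tau> * ((q - p) \<bullet> (q - p)) + (\<sigma> *\<^sub>R p + \<tau> *\<^sub>R q) \<bullet> (\<sigma> *\<^sub>R p + \<tau> *\<^sub>R q)) / (\<sigma> + \<tau>)"
    using assms poly by (simp add: field_simps)
  also have "\<dots> = (\<sigma> * \<tau> / (\<sigma> + \<tau>)) * (norm (q - p))\<^sup>2 + (\<sigma> + \<tau>) * (norm ((1 / (\<sigma> + \<tau>)) *\<^sub>R (\<sigma> *\<^sub>R p + \<tau> *\<^sub>R q)))\<^sup>2"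
    unfolding power2_norm_eq_inner using assms by (simp add: add_divide_distrib)
  finally show ?thesis unfolding m \<open>x - z = q - p\<close> .
qed

lemma nn_integral_two_gauss:
  fixes x z :: "real ^ 'n"
  assumes "\<sigma> > 0" "\<tau> > 0"
  shows "(\<integral>\<^sup>+y. ennreal (exp (- (\<sigma> * (norm (x - y))\<^sup>2 + \<tau> * (norm (y - z))\<^sup>2))) \<partial>lborel)
    = ennreal ((pi / (\<sigma> + \<tau>)) powr (CARD('n) / 2) * exp (- ((\<sigma> * \<tau> / (\<sigma> + \<tau>)) * (norm (x - z))\<^sup>2)))"
proof -
  let ?m = "(1 / (\<sigma> + \<tau>)) *\<^sub>R (\<sigma> *\<^sub>R x + \<tau> *\<^sub>R z)"
  have "\<sigma> + \<tau> \<noteq> 0" using assms by simp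
  note sq = gauss_complete_square[OF this]
  have "(\<integral>\<^sup>+y. ennreal (exp (- (\<sigma> * (norm (x - y))\<^sup>2 + \<tau> * (norm (y - z))\<^sup>2))) \<partial>lborel)
    = (\<integral>\<^sup>+y. ennreal (exp (- ((\<sigma> * \<tau> / (\<sigma> + \<tau>)) * (norm (x - z))\<^sup>2))) * ennreal (exp (- ((\<sigma> + \<tau>) * (norm (y - ?m))\<^sup>2))) \<partial>lborel)"
    unfolding sq by (simp only: ennreal_mult'[symmetric] exp_ge_zero exp_add[symmetric] minus_add_distrib)
  also have "\<dots> = ennreal (exp (- ((\<sigma> * \<tau> / (\<sigma> + \<tau>)) * (norm (x - z))\<^sup>2))) * ennreal ((pi / (\<sigma> + \<tau>)) powr (CARD('n) / 2))"
    using assms by (subst nn_integral_cmult, simp, subst nn_integral_gauss) simp_all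
  finally show ?thesis by (simp add: ennreal_mult' mult.commute)
qed

text \<open>Write both kernels as Gamma integrals in \<sigma> and \<tau>. The integral over
  \<open>y\<close> leaves a Gaussian in \<open>x - z\<close> with parameter
  \<open>\<sigma> * \<tau> / (\<sigma> + \<tau>)\<close>, and the substitution \<tau> = \<sigma> v
  separates the variables: \<sigma> contributes a Gamma integral, \<open>v\<close> a Beta integral.
  The condition on the total order makes the Gamma integral converge.\<close>

lemma riesz_kernel_composition:
  fixes x z :: "real ^ 'n" and \<alpha> \<beta> :: real
  assumes \<alpha>: "0 < \<alpha>" and \<beta>: "0 < \<beta>" and \<alpha>\<beta>: "\<alpha> + \<beta> < CARD('n)" and xz: "x \<noteq> z"
  shows "(\<integral>\<^sup>+y. ennreal (norm (x - y) powr (\<alpha> - CARD('n)) * norm (y - z) powr (\<beta> - CARD('n))) \<partial>lborel)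
    = ennreal (riesz_H_real CARD('n) \<alpha> * riesz_H_real CARD('n) \<beta> / riesz_H_real CARD('n) (\<alpha> + \<beta>)
        * norm (x - z) powr (\<alpha> + \<beta> - CARD('n)))"
proof -
  define n where "n = real CARD('n)"
  \<comment> \<open>Exponents for squared norms: away from zero, the kernels of orders \<alpha>,
    \<beta> and \<alpha> + \<beta> are the squared norm to the powers \<open>- A\<close>,
    \<open>- B\<close> and \<open>- D\<close>.\<close>
  define A B D where "A = (n - \<alpha>) / 2" and "B = (n - \<beta>) / 2" and "D = (n - (\<alpha> + \<beta>)) / 2"
  have pos: "A > 0" "B > 0" "D > 0" using \<alpha> \<beta> \<alpha>\<beta> by (simp_all add: A_def B_def D_def n_def)
  define r where "r = norm (x - z)"
  have r: "r > 0" using xz by (simp add: r_def)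
  let ?k = "\<lambda>\<sigma> v. v powr (B - 1) * (pi / (1 + v)) powr (n / 2) * (\<sigma> powr (D - 1) * exp (- ((v / (1 + v) * r\<^sup>2) * \<sigma>)))"
  let ?R = "Gamma D * pi powr (n / 2) * r powr (\<alpha> + \<beta> - n)"
  let ?L = "\<integral>\<^sup>+y. ennreal (norm (x - y) powr (\<alpha> - n) * norm (y - z) powr (\<beta> - n)) \<partial>lborel"
  let ?I = "\<lambda>t::real. indicator {0<..} t :: ennreal"
  let ?g = "\<lambda>\<sigma> \<tau>. ennreal (\<sigma> powr (A - 1) * \<tau> powr (B - 1)) * ?I \<sigma> * ?I \<tau>"
  let ?e = "\<lambda>\<sigma> \<tau> y. ennreal (exp (- (\<sigma> * (norm (x - y))\<^sup>2 + \<tau> * (norm (y - z))\<^sup>2)))"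
  have gam: "(\<integral>\<^sup>+t. ennreal (t powr (a - 1) * exp (- (t * s\<^sup>2))) * ?I t \<partial>lborel) = ennreal (Gamma a * s powr (- 2 * a))"
    if "a > 0" "s > 0" for a s :: real
  proof -
    have "(\<integral>\<^sup>+t. ennreal (t powr (a - 1) * exp (- (s\<^sup>2 * t))) * ?I t \<partial>lborel) = ennreal (Gamma a * (s\<^sup>2) powr (- a))"
      using that by (intro nn_integral_Gamma) auto
    also have "(s\<^sup>2) powr (- a) = s powr (- 2 * a)"
      using that by (simp add: powr_powr flip: powr_numeral)
    finally show ?thesis by (simp only: mult.commute)
  qed
  have "ennreal (Gamma A * Gamma B) * ?L
    = (\<integral>\<^sup>+y. ennreal (Gamma A * Gamma B) * ennreal (norm (x - y) powr (\<alpha> - n) * norm (y - z) powr (\<beta> - n)) \<partial>lborel)"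
    by (rule nn_integral_cmult[symmetric]) measurable
  also have "\<dots> = (\<integral>\<^sup>+y. \<integral>\<^sup>+\<sigma>. \<integral>\<^sup>+\<tau>. ?g \<sigma> \<tau> * ?e \<sigma> \<tau> y \<partial>lborel \<partial>lborel \<partial>lborel)"
  \<comment> \<open>At \<open>y = x\<close> or \<open>y = z\<close> a Gamma integral diverges while
    \<open>powr\<close> with base 0 is 0; these two points form a null set.\<close>
  proof (rule nn_integral_cong_AE)
    have "AE y in lborel. y \<noteq> x" "AE y in lborel. y \<noteq> z"
      by (rule AE_lborel_singleton)+
    then show "AE y in lborel. ennreal (Gamma A * Gamma B) * ennreal (norm (x - y) powr (\<alpha> - n) * norm (y - z) powr (\<beta> - n))
      = (\<integral>\<^sup>+\<sigma>. \<integral>\<^sup>+\<tau>. ?g \<sigma> \<tau> * ?e \<sigma> \<tau> y \<partial>lborel \<partial>lborel)"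
    proof eventually_elim
      case (elim y)
      let ?u = "\<lambda>\<sigma>. ennreal (\<sigma> powr (A - 1) * exp (- (\<sigma> * (norm (x - y))\<^sup>2))) * ?I \<sigma>"
      let ?v = "\<lambda>\<tau>. ennreal (\<tau> powr (B - 1) * exp (- (\<tau> * (norm (y - z))\<^sup>2))) * ?I \<tau>"
      have "?g \<sigma> \<tau> * ?e \<sigma> \<tau> y = ?u \<sigma> * ?v \<tau>" for \<sigma> \<tau>
        by (simp only: minus_add_distrib exp_add) (simp add: ennreal_mult' mult_ac)
      then have "(\<integral>\<^sup>+\<sigma>. \<integral>\<^sup>+\<tau>. ?g \<sigma> \<tau> * ?e \<sigma> \<tau> y \<partial>lborel \<partial>lborel) = (\<integral>\<^sup>+\<sigma>. ?u \<sigma> \<partial>lborel) * (\<integral>\<^sup>+\<tau>. ?v \<tau> \<partial>lborel)"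
        by (simp add: nn_integral_cmult nn_integral_multc)
      also have "\<dots> = ennreal (Gamma A * norm (x - y) powr (- 2 * A)) * ennreal (Gamma B * norm (y - z) powr (- 2 * B))"
        using elim pos by (subst (1 2) gam) auto
      also have "- 2 * A = \<alpha> - n" by (simp add: A_def)
      also have "- 2 * B = \<beta> - n" by (simp add: B_def)
      finally show ?case using pos by (simp add: ennreal_mult'[symmetric] Gamma_real_pos less_imp_le mult_ac)
    qed
  qed
  also have "\<dots> = (\<integral>\<^sup>+\<sigma>. \<integral>\<^sup>+y. \<integral>\<^sup>+\<tau>. ?g \<sigma> \<tau> * ?e \<sigma> \<tau> y \<partial>lborel \<partial>lborel \<partial>lborel)"
    by (rule lborel_pair.Fubini'[symmetric]) measurable
  also have "\<dots> = (\<integral>\<^sup>+\<sigma>. \<integral>\<^sup>+\<tau>. \<integral>\<^sup>+y. ?g \<sigma> \<tau> * ?e \<sigma> \<tau> y \<partial>lborel \<partial>lborel \<partial>lborel)"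
    by (intro nn_integral_cong lborel_pair.Fubini'[symmetric]) measurable
  also have "\<dots> = (\<integral>\<^sup>+\<sigma>. \<integral>\<^sup>+\<tau>. ?g \<sigma> \<tau> * ennreal ((pi / (\<sigma> + \<tau>)) powr (n / 2) * exp (- ((\<sigma> * \<tau> / (\<sigma> + \<tau>)) * r\<^sup>2))) \<partial>lborel \<partial>lborel)"
  proof (intro nn_integral_cong)
    fix \<sigma> \<tau> :: real
    show "(\<integral>\<^sup>+y. ?g \<sigma> \<tau> * ?e \<sigma> \<tau> y \<partial>lborel) = ?g \<sigma> \<tau> * ennreal ((pi / (\<sigma> + \<tau>)) powr (n / 2) * exp (- ((\<sigma> * \<tau> / (\<sigma> + \<tau>)) * r\<^sup>2)))"
    proof (cases "\<sigma> > 0 \<and> \<tau> > 0")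
      case True
      then show ?thesis unfolding n_def r_def
        by (subst nn_integral_cmult, simp, subst nn_integral_two_gauss) auto
    qed (auto simp: indicator_def)
  qed
  also have "\<dots> = (\<integral>\<^sup>+\<sigma>. \<integral>\<^sup>+v. ennreal (?k \<sigma> v) * ?I \<sigma> * ?I v \<partial>lborel \<partial>lborel)"
  proof (rule nn_integral_cong)
    fix \<sigma> :: real
    let ?F = "\<lambda>\<tau>. ?g \<sigma> \<tau> * ennreal ((pi / (\<sigma> + \<tau>)) powr (n / 2) * exp (- ((\<sigma> * \<tau> / (\<sigma> + \<tau>)) * r\<^sup>2)))"
    show "(\<integral>\<^sup>+\<tau>. ?F \<tau> \<partial>lborel) = (\<integral>\<^sup>+v. ennreal (?k \<sigma> v) * ?I \<sigma> * ?I v \<partial>lborel)"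
    proof (cases "\<sigma> > 0")
      case True
      have "(\<integral>\<^sup>+\<tau>. ?F \<tau> \<partial>lborel) = ennreal \<sigma> * (\<integral>\<^sup>+v. ?F (\<sigma> * v) \<partial>lborel)"
        using True nn_integral_lborel_affine[of ?F \<sigma> 0] by simp
      also have "\<dots> = (\<integral>\<^sup>+v. ennreal \<sigma> * ?F (\<sigma> * v) \<partial>lborel)"
        by (rule nn_integral_cmult[symmetric]) measurable
      also have "\<dots> = (\<integral>\<^sup>+v. ennreal (?k \<sigma> v) * ?I \<sigma> * ?I v \<partial>lborel)"
      proof (intro nn_integral_cong)
        fix v :: real
        show "ennreal \<sigma> * ?F (\<sigma> * v) = ennreal (?k \<sigma> v) * ?I \<sigma> * ?I v"
        proof (cases "v > 0")
          case v: True
          have sv: "\<sigma> + \<sigma> * v = \<sigma> * (1 + v)" by (simp add: distrib_left)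
          have e1: "\<sigma> * (\<sigma> * v) / (\<sigma> + \<sigma> * v) * r\<^sup>2 = v / (1 + v) * r\<^sup>2 * \<sigma>"
            unfolding sv using True v by (simp add: mult.commute)
          have "(pi / (\<sigma> + \<sigma> * v)) powr (n / 2) = ((pi / (1 + v)) * (1 / \<sigma>)) powr (n / 2)"
            unfolding sv by (simp add: mult.commute)
          also have "\<dots> = (pi / (1 + v)) powr (n / 2) * (1 / \<sigma>) powr (n / 2)"
            using True v by (intro powr_mult)
          also have "(1 / \<sigma>) powr (n / 2) = \<sigma> powr (- (n / 2))"
            using True by (simp add: powr_divide powr_minus_divide)
          finally have e2: "(pi / (\<sigma> + \<sigma> * v)) powr (n / 2) = (pi / (1 + v)) powr (n / 2) * \<sigma> powr (- (n / 2))" .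
          have e3: "(\<sigma> * v) powr (B - 1) = \<sigma> powr (B - 1) * v powr (B - 1)"
            using True v by (simp add: powr_mult)
          \<comment> \<open>The Jacobian \<sigma> of the substitution and the three powers of
            \<sigma> combine to the weight of a Gamma integral of order \<open>D\<close>.\<close>
          have e4: "\<sigma> * \<sigma> powr (A - 1) * \<sigma> powr (B - 1) * \<sigma> powr (- (n / 2)) = \<sigma> powr (D - 1)"
          proof -
            have "\<sigma> * \<sigma> powr (A - 1) * \<sigma> powr (B - 1) * \<sigma> powr (- (n / 2)) = \<sigma> powr (1 + (A - 1) + (B - 1) + (- (n / 2)))"
              using True by (simp only: powr_add powr_one)
            also have "1 + (A - 1) + (B - 1) + (- (n / 2)) = D - 1" by (simp add: A_def B_def D_def field_simps)
            finally show ?thesis .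
          qed
          show ?thesis
            using True v unfolding e1 e2 e3 e4[symmetric]
            by (simp add: ennreal_mult'[symmetric] mult_ac)
        qed (use True in \<open>simp add: zero_less_mult_iff\<close>)
      qed
      finally show ?thesis .
    qed simp
  qed
  also have "\<dots> = (\<integral>\<^sup>+v. \<integral>\<^sup>+\<sigma>. ennreal (?k \<sigma> v) * ?I \<sigma> * ?I v \<partial>lborel \<partial>lborel)"
    by (rule lborel_pair.Fubini') measurable
  also have "\<dots> = (\<integral>\<^sup>+v. ennreal (?R) *
      (ennreal (v powr (\<alpha> / 2 - 1) * (1 + v) powr (- (\<alpha> / 2 + \<beta> / 2))) * ?I v) \<partial>lborel)"
  proof (rule nn_integral_cong)
    fix v :: real
    show "(\<integral>\<^sup>+\<sigma>. ennreal (?k \<sigma> v) * ?I \<sigma> * ?I v \<partial>lborel)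
      = ennreal (?R) * (ennreal (v powr (\<alpha> / 2 - 1) * (1 + v) powr (- (\<alpha> / 2 + \<beta> / 2))) * ?I v)"
    proof (cases "v > 0")
      case True
      let ?c = "v / (1 + v) * r\<^sup>2"
      have c: "?c > 0" using True r by simp
      have "(\<integral>\<^sup>+\<sigma>. ennreal (v powr (B - 1) * (pi / (1 + v)) powr (n / 2)
          * (\<sigma> powr (D - 1) * exp (- (?c * \<sigma>)))) * ?I \<sigma> * ?I v \<partial>lborel)
        = (\<integral>\<^sup>+\<sigma>. ennreal (v powr (B - 1) * (pi / (1 + v)) powr (n / 2))
          * (ennreal (\<sigma> powr (D - 1) * exp (- (?c * \<sigma>))) * ?I \<sigma>) \<partial>lborel)"
        using True by (intro nn_integral_cong) (simp add: ennreal_mult' mult_ac)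
      also have "\<dots> = ennreal (v powr (B - 1) * (pi / (1 + v)) powr (n / 2)) * ennreal (Gamma D * ?c powr (- D))"
        using pos c by (subst nn_integral_cmult, simp, subst nn_integral_Gamma) auto
      also have "\<dots> = ennreal (v powr (B - 1) * (pi / (1 + v)) powr (n / 2) * (Gamma D * ?c powr (- D)))"
        using pos by (simp add: ennreal_mult'[symmetric])
      also have "v powr (B - 1) * (pi / (1 + v)) powr (n / 2) * (Gamma D * ?c powr (- D))
        = (?R) * (v powr (\<alpha> / 2 - 1) * (1 + v) powr (- (\<alpha> / 2 + \<beta> / 2)))"
      proof -
        have "?c powr (- D) = (v / (1 + v)) powr (- D) * (r\<^sup>2) powr (- D)"
          using True by (intro powr_mult)
        also have "(v / (1 + v)) powr (- D) = v powr (- D) * (1 + v) powr D"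
          using True by (simp add: powr_divide powr_minus_divide)
        also have "(r\<^sup>2) powr (- D) = r powr (2 * (- D))" using r by (simp add: powr_powr flip: powr_numeral)
        also have "2 * (- D) = \<alpha> + \<beta> - n" by (simp add: D_def field_simps)
        finally have c1: "?c powr (- D) = v powr (- D) * (1 + v) powr D * r powr (\<alpha> + \<beta> - n)" .
        have c2: "(pi / (1 + v)) powr (n / 2) = pi powr (n / 2) * (1 + v) powr (- (n / 2))"
          using True by (simp add: powr_divide powr_minus_divide)
        have "B - 1 + (- D) = \<alpha> / 2 - 1" by (simp add: B_def D_def field_simps)
        then have c3: "v powr (\<alpha> / 2 - 1) = v powr (B - 1) * v powr (- D)" by (simp only: powr_add[symmetric])
        have "- (n / 2) + D = - (\<alpha> / 2 + \<beta> / 2)" by (simp add: D_def field_simps)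
        then have c4: "(1 + v) powr (- (\<alpha> / 2 + \<beta> / 2)) = (1 + v) powr (- (n / 2)) * (1 + v) powr D"
          by (simp only: powr_add[symmetric])
        show ?thesis unfolding c1 c2 c3 c4 by (simp only: mult_ac)
      qed
      finally show ?thesis using True pos by (simp add: ennreal_mult' Gamma_real_pos less_imp_le)
    qed simp
  qed
  also have "\<dots> = ennreal (?R) * ennreal (Gamma (\<alpha> / 2) * Gamma (\<beta> / 2) / Gamma (\<alpha> / 2 + \<beta> / 2))"
    using \<alpha> \<beta> by (subst nn_integral_cmult, simp, subst nn_integral_Beta_inf) auto
  also have "\<dots> = ennreal ((?R) * (Gamma (\<alpha> / 2) * Gamma (\<beta> / 2) / Gamma ((\<alpha> + \<beta>) / 2)))"
    using pos by (simp add: ennreal_mult'[symmetric] Gamma_real_pos less_imp_le add_divide_distrib)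
  finally have eq: "ennreal (Gamma A * Gamma B) * ?L
    = ennreal ((?R) * (Gamma (\<alpha> / 2) * Gamma (\<beta> / 2) / Gamma ((\<alpha> + \<beta>) / 2)))" .
  have G: "Gamma A > 0" "Gamma B > 0" "Gamma D > 0" "Gamma ((\<alpha> + \<beta>) / 2) > 0"
    using pos \<alpha> \<beta> by (simp_all add: Gamma_real_pos)
  have "?L
    = ennreal (1 / (Gamma A * Gamma B)) * (ennreal (Gamma A * Gamma B) * ?L)"
    using G by (simp add: mult.assoc[symmetric] ennreal_mult'[symmetric])
  also have "\<dots> = ennreal (1 / (Gamma A * Gamma B) * ((?R) * (Gamma (\<alpha> / 2) * Gamma (\<beta> / 2) / Gamma ((\<alpha> + \<beta>) / 2))))"
    unfolding eq using G by (intro ennreal_mult'[symmetric]) simp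
  also have "1 / (Gamma A * Gamma B) * ((?R) * (Gamma (\<alpha> / 2) * Gamma (\<beta> / 2) / Gamma ((\<alpha> + \<beta>) / 2)))
    = riesz_H_real n \<alpha> * riesz_H_real n \<beta> / riesz_H_real n (\<alpha> + \<beta>) * r powr (\<alpha> + \<beta> - n)"
    using G by (simp add: riesz_H_real_def A_def[symmetric] B_def[symmetric] D_def[symmetric] powr_add field_simps)
  finally show ?thesis by (simp only: n_def r_def)
qed

section \<open>Decay estimates\<close>

text \<open>Continuity bounds \<open>f\<close> on a compact ball and the Landau condition outside
  it. The weight \<open>1 + norm y\<close> has no zero at the origin, so one constant serves
  everywhere.\<close>

lemma C_decay_bound:
  fixes f :: "real ^ 'n \<Rightarrow> complex"
  assumes f: "f \<in> C_decay a" and a: "a \<ge> 0"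
  obtains C where "C > 0" "\<And>y. norm (f y) \<le> C * (1 + norm y) powr (- a)"
proof -
  have cont: "continuous_on UNIV f" and bigo: "f \<in> O[at_infinity](\<lambda>x. complex_of_real (norm x powr (- a)))"
    using f by (auto simp: C_decay_def)
  obtain c where c: "c > 0" "eventually (\<lambda>y. norm (f y) \<le> c * norm (complex_of_real (norm y powr (- a)))) at_infinity"
    using landau_o.bigE[OF bigo] by blast
  then obtain B where B: "\<And>y. norm y \<ge> B \<Longrightarrow> norm (f y) \<le> c * norm y powr (- a)"
    by (auto simp: eventually_at_infinity)
  define R where "R = max B 1"
  have "compact (f ` cball 0 R)" using cont by (intro compact_continuous_image continuous_on_subset[OF cont]) auto
  then have "bounded (f ` cball 0 R)" by (rule compact_imp_bounded)
  then obtain K where "K > 0" "\<forall>w\<in>f ` cball 0 R. norm w \<le> K" unfolding bounded_pos by blast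
  then have K: "K > 0" "\<And>y. norm y \<le> R \<Longrightarrow> norm (f y) \<le> K" by auto
  \<comment> \<open>The first summand serves the far points, where
    \<open>(1 + norm y) / 2 \<le> norm y\<close>; the second serves the ball of radius
    \<open>R\<close>.\<close>
  define C where "C = c * 2 powr a + K * (1 + R) powr a"
  have "C > 0" using c(1) K(1) by (simp add: C_def add_pos_nonneg)
  moreover have "norm (f y) \<le> C * (1 + norm y) powr (- a)" for y
  proof (cases "norm y \<le> R")
    case True
    have "norm (f y) \<le> K * 1" using K(2)[OF True] by simp
    also have "1 = (1 + norm y) powr a * (1 + norm y) powr (- a)"
      using norm_ge_zero[of y] by (simp add: powr_add[symmetric] add_nonneg_eq_0_iff)
    also have "K * \<dots> \<le> K * ((1 + R) powr a * (1 + norm y) powr (- a))"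
      using True a K(1) by (intro mult_left_mono mult_right_mono powr_mono2) auto
    also have "\<dots> \<le> C * (1 + norm y) powr (- a)" using c(1) by (simp add: C_def distrib_right)
    finally show ?thesis .
  next
    case False
    then have y: "norm y \<ge> B" "norm y \<ge> 1" by (auto simp: R_def)
    have "norm (f y) \<le> c * norm y powr (- a)" by (rule B[OF y(1)])
    also have "norm y powr (- a) \<le> ((1 + norm y) / 2) powr (- a)"
      using y(2) a by (intro powr_mono2') auto
    also have "((1 + norm y) / 2) powr (- a) = 2 powr a * (1 + norm y) powr (- a)"
      using norm_ge_zero[of y] by (simp add: powr_divide powr_minus_divide)
    finally have "norm (f y) \<le> c * (2 powr a * (1 + norm y) powr (- a))" using c(1) by (simp add: mult_left_mono)
    also have "\<dots> \<le> C * (1 + norm y) powr (- a)" using K(1) by (simp add: C_def distrib_right)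
    finally show ?thesis .
  qed
  ultimately show thesis by (rule that)
qed

lemma C_decayI:
  fixes f :: "real ^ 'n \<Rightarrow> complex"
  assumes "continuous_on UNIV f" and b: "\<And>y. norm y powr a * norm (f y) \<le> C"
  shows "f \<in> C_decay a"
proof -
  have "eventually (\<lambda>y. norm (f y) \<le> C * norm (complex_of_real (norm y powr (- a)))) at_infinity"
    unfolding eventually_at_infinity
  proof (intro exI[of _ 1] allI impI)
    fix y :: "real ^ 'n" assume y: "norm y \<ge> 1"
    have "norm (f y) = norm y powr (- a) * (norm y powr a * norm (f y))"
    proof -
      have "y \<noteq> 0" using y by auto
      then show ?thesis by (simp add: mult.assoc[symmetric] powr_add[symmetric])
    qed
    also have "\<dots> \<le> norm y powr (- a) * C" by (intro mult_left_mono b) simp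
    finally show "norm (f y) \<le> C * norm (complex_of_real (norm y powr (- a)))" by (simp add: mult.commute)
  qed
  then have "f \<in> O[at_infinity](\<lambda>x. complex_of_real (norm x powr (- a)))" by (rule bigoI)
  then show ?thesis using assms(1) by (simp add: C_decay_def)
qed

lemma C_decay_measurable: "f \<in> C_decay a \<Longrightarrow> f \<in> borel_measurable borel"
  by (auto simp: C_decay_def intro: borel_measurable_continuous_onI)

lemma C_decay_mono:
  fixes f :: "real ^ 'n \<Rightarrow> complex"
  assumes f: "f \<in> C_decay a" and "a' \<le> a" "a' \<ge> 0"
  shows "f \<in> C_decay a'"
proof -
  have "0 \<le> a" using assms by simp
  then obtain C where C: "C > 0" "\<And>y. norm (f y) \<le> C * (1 + norm y) powr (- a)"
    using C_decay_bound[OF f] by blast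
  have "norm y powr a' * norm (f y) \<le> C" for y
  proof -
    have "norm y powr a' * norm (f y) \<le> (1 + norm y) powr a' * (C * (1 + norm y) powr (- a))"
      using assms(3) C by (intro mult_mono powr_mono2) auto
    also have "\<dots> = C * (1 + norm y) powr (a' - a)"
      by (simp add: powr_add[symmetric] powr_diff powr_minus divide_inverse)
    also have "(1 + norm y) powr (a' - a) \<le> (1 + norm y) powr 0"
      using assms(2) by (intro powr_mono) auto
    finally show ?thesis using C(1) norm_ge_zero[of y] by (simp add: mult_left_mono add_nonneg_eq_0_iff)
  qed
  then show ?thesis using f by (intro C_decayI) (auto simp: C_decay_def)
qed

text \<open>Peetre's inequality. Translating the weight costs a factor that depends on the
  translation alone, so bounded sets of centres share a dominating function.\<close>

lemma peetre_weight:
  fixes y z :: "'a::real_normed_vector"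
  assumes "a \<ge> 0"
  shows "(1 + norm (y + z)) powr (- a) \<le> (1 + norm y) powr a * (1 + norm z) powr (- a)"
proof -
  have "norm z \<le> norm (y + z) + norm y" using norm_triangle_ineq4[of "y + z" y] by simp
  moreover have "0 \<le> norm y * norm (y + z)" by simp
  ultimately have "1 + norm z \<le> 1 + norm y + norm (y + z) + norm y * norm (y + z)" by linarith
  also have "\<dots> = (1 + norm (y + z)) * (1 + norm y)" by (simp add: algebra_simps)
  finally have "1 + norm z \<le> (1 + norm (y + z)) * (1 + norm y)" .
  then have "((1 + norm (y + z)) * (1 + norm y)) powr (- a) \<le> (1 + norm z) powr (- a)"
    using assms by (intro powr_mono2') (auto simp: add_pos_nonneg)
  then have "(1 + norm y) powr a * ((1 + norm (y + z)) powr (- a) * (1 + norm y) powr (- a)) \<le> (1 + norm y) powr a * (1 + norm z) powr (- a)"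
    by (intro mult_left_mono) (simp_all add: powr_mult)
  moreover have "(1 + norm y) powr a * (1 + norm y) powr (- a) = 1"
    using norm_ge_zero[of y] by (simp add: powr_add[symmetric] add_nonneg_eq_0_iff)
  moreover have "(1 + norm y) powr a * ((1 + norm (y + z)) powr (- a) * (1 + norm y) powr (- a))
    = (1 + norm (y + z)) powr (- a) * ((1 + norm y) powr a * (1 + norm y) powr (- a))"
    by (simp only: mult_ac)
  ultimately show ?thesis by simp
qed

section \<open>Integrability, continuity and decay of Riesz integrals\<close>

lemma integrable_weight:
  fixes s a :: real
  assumes "0 < s" "s < a"
  shows "integrable lborel (\<lambda>u::real ^ 'n. norm u powr (s - CARD('n)) * (1 + norm u) powr (- a))"
  using nn_integral_weight_finite[OF assms, where ?'a = "real ^ 'n"]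
  by (intro integrableI_nonneg) simp_all

lemma integrable_powr_shift:
  fixes f :: "real ^ 'n \<Rightarrow> complex" and x :: "real ^ 'n"
  assumes [measurable]: "f \<in> borel_measurable borel"
    and f: "\<And>y. norm (f y) \<le> C * (1 + norm y) powr (- a)" and s: "0 < s" "s < a"
  shows "integrable lborel (\<lambda>u. norm u powr (s - CARD('n)) *\<^sub>R f (x + u))"
proof (rule Bochner_Integration.integrable_bound)
  show "integrable lborel (\<lambda>u::real^'n. (C * (1 + norm x) powr a) * (norm u powr (s - CARD('n)) * (1 + norm u) powr (- a)))"
    by (intro integrable_mult_right integrable_weight s)
  have C: "C \<ge> 0" using f[of 0] by (simp add: order_trans[OF norm_ge_zero])
  show "AE u in lborel. norm (norm u powr (s - CARD('n)) *\<^sub>R f (x + u)) \<le> norm ((C * (1 + norm x) powr a) * (norm u powr (s - CARD('n)) * (1 + norm u) powr (- a)))"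
  proof (rule AE_I2)
    fix u :: "real ^ 'n"
    have "norm (f (x + u)) \<le> C * ((1 + norm x) powr a * (1 + norm u) powr (- a))"
      using f[of "x + u"] peetre_weight[of a x u] s C by (meson less_imp_le less_trans mult_left_mono order_trans)
    then have "norm u powr (s - CARD('n)) * norm (f (x + u)) \<le> norm u powr (s - CARD('n)) * (C * ((1 + norm x) powr a * (1 + norm u) powr (- a)))"
      by (intro mult_left_mono) auto
    then show "norm (norm u powr (s - CARD('n)) *\<^sub>R f (x + u)) \<le> norm ((C * (1 + norm x) powr a) * (norm u powr (s - CARD('n)) * (1 + norm u) powr (- a)))"
      using C by (simp add: mult_ac)
  qed
qed measurable

lemma
  fixes f :: "real ^ 'n \<Rightarrow> 'b::{banach, second_countable_topology}"
  assumes [measurable]: "f \<in> borel_measurable borel"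
  shows integrable_lborel_translate: "integrable lborel (\<lambda>u. f (x + u)) \<longleftrightarrow> integrable lborel f"
    and integral_lborel_translate: "(LINT u|lborel. f (x + u)) = (LINT u|lborel. f u)"
proof -
  have "distr lborel borel ((+) x) = (lborel :: (real^'n) measure)"
    using lborel_affine[of 1 x] by (simp add: density_1)
  then show "integrable lborel (\<lambda>u. f (x + u)) \<longleftrightarrow> integrable lborel f"
    "(LINT u|lborel. f (x + u)) = (LINT u|lborel. f u)"
    using integrable_distr_eq[of "(+) x" "lborel" "borel" f] integral_distr[of "(+) x" "lborel" "borel" f] by auto
qed

lemma integrable_powr_decay:
  fixes f :: "real ^ 'n \<Rightarrow> complex" and x :: "real ^ 'n"
  assumes [measurable]: "f \<in> borel_measurable borel"
    and f: "\<And>y. norm (f y) \<le> C * (1 + norm y) powr (- a)" and s: "0 < s" "s < a"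
  shows "integrable lborel (\<lambda>z. norm (z - x) powr (s - CARD('n)) *\<^sub>R f z)"
  using integrable_powr_shift[OF assms, of x]
    integrable_lborel_translate[of "\<lambda>z. norm (z - x) powr (s - CARD('n)) *\<^sub>R f z" x] by simp

text \<open>A translation fixes the singularity at the origin and lets only \<open>f\<close> move.
  Along a convergent, hence bounded, sequence of centres, Peetre's inequality provides a common
  majorant.\<close>

lemma continuous_riesz:
  fixes f :: "real ^ 'n \<Rightarrow> complex"
  assumes cont: "continuous_on UNIV f"
    and f: "\<And>y. norm (f y) \<le> C * (1 + norm y) powr (- a)" and s: "0 < s" "s < a"
  shows "continuous_on UNIV (\<lambda>x. LINT z|lborel. norm (z - x) powr (s - CARD('n)) *\<^sub>R f z)"
proof -
  have [measurable]: "f \<in> borel_measurable borel" using cont by (rule borel_measurable_continuous_onI)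
  have eq: "(LINT z|lborel. norm (z - x) powr (s - CARD('n)) *\<^sub>R f z) = (LINT u|lborel. norm u powr (s - CARD('n)) *\<^sub>R f (x + u))" for x
    using integral_lborel_translate[of "\<lambda>z. norm (z - x) powr (s - CARD('n)) *\<^sub>R f z" x] by simp
  have C: "C \<ge> 0" using f[of 0] by (simp add: order_trans[OF norm_ge_zero])
  show ?thesis unfolding eq continuous_on_sequentially
  proof (intro allI ballI impI, elim conjE)
    fix y :: "nat \<Rightarrow> real ^ 'n" and x assume lim: "y \<longlonglongrightarrow> x"
    then obtain M where M: "\<And>j. norm (y j) \<le> M" using convergent_imp_Bseq[of y] by (auto simp: convergent_def Bseq_def)
    show "((\<lambda>x. LINT u|lborel. norm u powr (s - CARD('n)) *\<^sub>R f (x + u)) \<circ> y) \<longlonglongrightarrow> (LINT u|lborel. norm u powr (s - CARD('n)) *\<^sub>R f (x + u))"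
      unfolding o_def
    proof (rule integral_dominated_convergence)
      show "integrable lborel (\<lambda>u::real^'n. (C * (1 + M) powr a) * (norm u powr (s - CARD('n)) * (1 + norm u) powr (- a)))"
        by (intro integrable_mult_right integrable_weight s)
      show "AE u in lborel. (\<lambda>j. norm u powr (s - CARD('n)) *\<^sub>R f (y j + u)) \<longlonglongrightarrow> norm u powr (s - CARD('n)) *\<^sub>R f (x + u)"
      proof (rule AE_I2)
        fix u
        have "isCont f (x + u)" using cont by (simp add: continuous_on_eq_continuous_at)
        then have "(\<lambda>j. f (y j + u)) \<longlonglongrightarrow> f (x + u)" by (rule isCont_tendsto_compose) (intro tendsto_intros lim)
        then show "(\<lambda>j. norm u powr (s - CARD('n)) *\<^sub>R f (y j + u)) \<longlonglongrightarrow> norm u powr (s - CARD('n)) *\<^sub>R f (x + u)"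
          by (intro tendsto_intros)
      qed
      show "AE u in lborel. norm (norm u powr (s - CARD('n)) *\<^sub>R f (y j + u)) \<le> (C * (1 + M) powr a) * (norm u powr (s - CARD('n)) * (1 + norm u) powr (- a))" for j
      proof (rule AE_I2)
        fix u :: "real ^ 'n"
        have "norm (f (y j + u)) \<le> C * ((1 + norm (y j)) powr a * (1 + norm u) powr (- a))"
          using f[of "y j + u"] peetre_weight[of a "y j" u] s C by (meson less_imp_le less_trans mult_left_mono order_trans)
        also have "\<dots> \<le> C * ((1 + M) powr a * (1 + norm u) powr (- a))"
          using M[of j] C s by (intro mult_left_mono mult_right_mono powr_mono2) auto
        finally have "norm u powr (s - CARD('n)) * norm (f (y j + u)) \<le> norm u powr (s - CARD('n)) * (C * ((1 + M) powr a * (1 + norm u) powr (- a)))"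
          by (intro mult_left_mono) auto
        then show "norm (norm u powr (s - CARD('n)) *\<^sub>R f (y j + u)) \<le> (C * (1 + M) powr a) * (norm u powr (s - CARD('n)) * (1 + norm u) powr (- a))"
          by (simp add: mult_ac)
      qed
    qed measurable
  qed
qed

text \<open>Both factors decrease in their arguments, so both may be evaluated at the smaller of
  \<open>u\<close> and \<open>v\<close>. Each summand of the bound then involves a single
  variable.\<close>

lemma powr_weight_split:
  fixes u v p q :: real
  assumes "0 \<le> u" "0 < v" "0 \<le> p" "0 \<le> q"
  shows "u powr (- p) * (1 + v) powr (- q) \<le> u powr (- p) * (1 + u) powr (- q) + v powr (- p) * (1 + v) powr (- q)"
proof (cases "u \<le> v")
  case True
  then have "(1 + v) powr (- q) \<le> (1 + u) powr (- q)" using assms by (intro powr_mono2') auto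
  then have "u powr (- p) * (1 + v) powr (- q) \<le> u powr (- p) * (1 + u) powr (- q)" by (intro mult_left_mono) auto
  then show ?thesis by (simp add: add_increasing2)
next
  case False
  then have "u powr (- p) \<le> v powr (- p)" using assms by (intro powr_mono2') auto
  then have "u powr (- p) * (1 + v) powr (- q) \<le> v powr (- p) * (1 + v) powr (- q)" by (intro mult_right_mono) auto
  then show ?thesis by (simp add: add_increasing)
qed

text \<open>After the splitting, the two summands have the same integral up to translation, so the
  bound is independent of \<open>y\<close>.\<close>

lemma riesz_weight_bounded:
  fixes p q :: real
  assumes "0 \<le> p" "p < CARD('n)" "CARD('n) - p < q"
  obtains W where "\<And>y::real ^ 'n. (\<integral>\<^sup>+u. ennreal (norm u powr (- p) * (1 + norm (y + u)) powr (- q)) \<partial>lborel) \<le> ennreal W" "W \<ge> 0"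
proof -
  define J where "J = (\<integral>\<^sup>+u. ennreal (norm u powr (- p) * (1 + norm u) powr (- q)) \<partial>(lborel :: (real ^ 'n) measure))"
  have "J < \<infinity>"
    using nn_integral_weight_finite[of "CARD('n) - p" q, where ?'a = "real ^ 'n"] assms by (simp add: J_def)
  then obtain W where W: "J = ennreal W" "W \<ge> 0" by (cases J) auto
  have "(\<integral>\<^sup>+u. ennreal (norm u powr (- p) * (1 + norm (y + u)) powr (- q)) \<partial>lborel) \<le> ennreal (2 * W)" for y :: "real ^ 'n"
  proof -
    let ?w = "\<lambda>u::real ^ 'n. ennreal (norm u powr (- p) * (1 + norm u) powr (- q))"
    have "AE u in lborel. u \<noteq> - y" by (rule AE_lborel_singleton)
    then have "(\<integral>\<^sup>+u. ennreal (norm u powr (- p) * (1 + norm (y + u)) powr (- q)) \<partial>lborel) \<le> (\<integral>\<^sup>+u. ?w u + ?w (y + u) \<partial>lborel)"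
    proof (intro nn_integral_mono_AE, eventually_elim)
      case (elim u)
      then have "y + u \<noteq> 0" by (metis add_eq_0_iff)
      then have "norm u powr (- p) * (1 + norm (y + u)) powr (- q)
          \<le> norm u powr (- p) * (1 + norm u) powr (- q) + norm (y + u) powr (- p) * (1 + norm (y + u)) powr (- q)"
        using powr_weight_split[of "norm u" "norm (y + u)" p q] assms by simp
      then have "ennreal (norm u powr (- p) * (1 + norm (y + u)) powr (- q))
          \<le> ennreal (norm u powr (- p) * (1 + norm u) powr (- q) + norm (y + u) powr (- p) * (1 + norm (y + u)) powr (- q))"
        by (rule ennreal_leI)
      also have "\<dots> = ?w u + ?w (y + u)" by (rule ennreal_plus) auto
      finally show ?case .
    qed
    also have "\<dots> = (\<integral>\<^sup>+u. ?w u \<partial>lborel) + (\<integral>\<^sup>+u. ?w (y + u) \<partial>lborel)"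
      by (rule nn_integral_add) measurable
    also have "(\<integral>\<^sup>+u. ?w (y + u) \<partial>lborel) = (\<integral>\<^sup>+u. ?w u \<partial>lborel)"
      by (rule nn_integral_lborel_translate) measurable
    finally show ?thesis using W by (simp add: J_def[symmetric] ennreal_plus[symmetric] del: ennreal_plus)
  qed
  then show thesis using W(2) by (intro that[of "2 * W"]) auto
qed

text \<open>The power of \<open>norm y\<close> is at most a multiple of
  \<open>norm u powr b + (1 + norm (y + u)) powr b\<close>. The first term is absorbed by the
  kernel, whose order rises to \<open>s + b\<close>; the second by \<open>f\<close>, whose decay
  drops to \<open>a - b\<close>. Either way \<open>s + b < a\<close> leaves an integral bounded in
  \<open>y\<close>.\<close>

lemma riesz_decay:
  fixes f :: "real ^ 'n \<Rightarrow> complex" and s a b :: real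
  assumes [measurable]: "f \<in> borel_measurable borel"
    and f: "\<And>y. norm (f y) \<le> C * (1 + norm y) powr (- a)"
    and b: "0 < b" "b \<le> CARD('n) - s" and s: "0 < s" "s + b < a"
  obtains K where "\<And>y. norm y powr b * norm (LINT z|lborel. norm (z - y) powr (s - CARD('n)) *\<^sub>R f z) \<le> K"
proof -
  let ?n = "real CARD('n)"
  have C: "C \<ge> 0" using f[of 0] by (simp add: order_trans[OF norm_ge_zero])
  obtain W1 where W1: "\<And>y::real ^ 'n. (\<integral>\<^sup>+u. ennreal (norm u powr (- (?n - s - b)) * (1 + norm (y + u)) powr (- a)) \<partial>lborel) \<le> ennreal W1" "W1 \<ge> 0"
    using riesz_weight_bounded[of "?n - s - b" a, where ?'n = 'n] b s by auto
  obtain W2 where W2: "\<And>y::real ^ 'n. (\<integral>\<^sup>+u. ennreal (norm u powr (- (?n - s)) * (1 + norm (y + u)) powr (- (a - b))) \<partial>lborel) \<le> ennreal W2" "W2 \<ge> 0"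
    using riesz_weight_bounded[of "?n - s" "a - b", where ?'n = 'n] b s by auto
  have "norm y powr b * norm (LINT z|lborel. norm (z - y) powr (s - ?n) *\<^sub>R f z) \<le> C * 2 powr b * (W1 + W2)" for y
  proof -
    have eq: "(LINT z|lborel. norm (z - y) powr (s - ?n) *\<^sub>R f z) = (LINT u|lborel. norm u powr (s - ?n) *\<^sub>R f (y + u))"
      using integral_lborel_translate[of "\<lambda>z. norm (z - y) powr (s - ?n) *\<^sub>R f z" y] by simp
    let ?h = "\<lambda>u. norm u powr (s - ?n) *\<^sub>R f (y + u)"
    have int: "integrable lborel ?h" using s b by (intro integrable_powr_shift[OF _ f]) auto
    have "ennreal (norm y powr b * norm (LINT u|lborel. ?h u)) \<le> ennreal (norm y powr b) * (\<integral>\<^sup>+u. ennreal (norm (?h u)) \<partial>lborel)"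
      unfolding ennreal_mult'[OF powr_ge_zero] by (intro mult_left_mono integral_norm_bound_ennreal[OF int]) simp
    also have "\<dots> = (\<integral>\<^sup>+u. ennreal (norm y powr b) * ennreal (norm (?h u)) \<partial>lborel)"
      by (rule nn_integral_cmult[symmetric]) measurable
    also have "\<dots> \<le> (\<integral>\<^sup>+u. ennreal (C * 2 powr b) * (ennreal (norm u powr (- (?n - s - b)) * (1 + norm (y + u)) powr (- a))
        + ennreal (norm u powr (- (?n - s)) * (1 + norm (y + u)) powr (- (a - b)))) \<partial>lborel)"
    proof (rule nn_integral_mono)
      fix u :: "real ^ 'n"
      let ?u = "norm u" and ?v = "norm (y + u)"
      have "norm y \<le> ?u + ?v" using norm_triangle_ineq4[of "y + u" u] by simp
      then have "norm y \<le> 2 * max ?u ?v" by simp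
      then have "norm y powr b \<le> (2 * max ?u ?v) powr b" using b by (intro powr_mono2) auto
      also have "\<dots> = 2 powr b * max ?u ?v powr b" by (simp add: powr_mult)
      also have "max ?u ?v powr b \<le> ?u powr b + (1 + ?v) powr b"
        using b powr_mono2[of b ?v "1 + ?v"] by (auto simp: max_def intro: add_increasing add_increasing2)
      finally have yb: "norm y powr b \<le> 2 powr b * (?u powr b + (1 + ?v) powr b)" by simp
      have "norm y powr b * norm (?h u) = norm y powr b * (?u powr (s - ?n) * norm (f (y + u)))" by simp
      also have "\<dots> \<le> (2 powr b * (?u powr b + (1 + ?v) powr b)) * (?u powr (s - ?n) * (C * (1 + ?v) powr (- a)))"
        using yb f[of "y + u"] C by (intro mult_mono) auto
      also have "\<dots> = (C * 2 powr b) * ((?u powr b * ?u powr (s - ?n)) * (1 + ?v) powr (- a) + ?u powr (s - ?n) * ((1 + ?v) powr b * (1 + ?v) powr (- a)))"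
        by (simp add: algebra_simps)
      also have "?u powr b * ?u powr (s - ?n) = ?u powr (- (?n - s - b))" by (simp add: powr_add[symmetric] algebra_simps)
      also have "(1 + ?v) powr b * (1 + ?v) powr (- a) = (1 + ?v) powr (- (a - b))" by (simp add: powr_add[symmetric])
      finally have "ennreal (norm y powr b * norm (?h u)) \<le> ennreal ((C * 2 powr b) * (?u powr (- (?n - s - b)) * (1 + ?v) powr (- a) + ?u powr (s - ?n) * (1 + ?v) powr (- (a - b))))"
        by (rule ennreal_leI)
      then show "ennreal (norm y powr b) * ennreal (norm (?h u)) \<le> ennreal (C * 2 powr b) * (ennreal (?u powr (- (?n - s - b)) * (1 + ?v) powr (- a))
        + ennreal (?u powr (- (?n - s)) * (1 + ?v) powr (- (a - b))))"
        using C by (subst ennreal_plus[symmetric], simp, simp, subst (1 2) ennreal_mult'[symmetric]) simp_all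
    qed
    also have "\<dots> = ennreal (C * 2 powr b) * ((\<integral>\<^sup>+u. ennreal (norm u powr (- (?n - s - b)) * (1 + norm (y + u)) powr (- a)) \<partial>lborel)
        + (\<integral>\<^sup>+u. ennreal (norm u powr (- (?n - s)) * (1 + norm (y + u)) powr (- (a - b))) \<partial>lborel))"
      by (subst nn_integral_cmult, measurable, subst nn_integral_add) auto
    also have "\<dots> \<le> ennreal (C * 2 powr b) * (ennreal W1 + ennreal W2)"
      by (intro mult_left_mono add_mono W1 W2) simp
    also have "\<dots> = ennreal (C * 2 powr b * (W1 + W2))" using C W1(2) W2(2) by (simp add: ennreal_mult')
    finally show ?thesis unfolding eq using C W1(2) W2(2) by (subst (asm) ennreal_le_iff) auto
  qed
  then show thesis by (rule that)
qed

section \<open>Analytic dependence on the exponent\<close>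

lemma norm_exp_minus_1_le: "norm (exp w - 1) \<le> norm w * exp (norm w)" for w :: complex
proof -
  have "norm (exp w - exp 0) \<le> exp (norm w) * norm (w - 0)"
  proof (rule field_differentiable_bound[where S = "cball 0 (norm w)" and f' = exp])
    show "(exp has_field_derivative exp z) (at z within cball 0 (norm w))" for z :: complex
      by (auto intro!: derivative_eq_intros)
    show "norm (exp z) \<le> exp (norm w)" if "z \<in> cball 0 (norm w)" for z :: complex
      using that complex_Re_le_cmod[of z] by (simp add: norm_exp_eq_Re)
  qed auto
  then show ?thesis by (simp add: mult.commute)
qed

text \<open>Differentiation under the integral. The logarithm in the difference quotient is absorbed
  by slightly raising or lowering the exponent, so integrability at two neighbouring real exponents
  provides the majorant.\<close>

lemma holomorphic_integral_powr:
  fixes f :: "'a \<Rightarrow> complex" and r :: "'a \<Rightarrow> real"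
  assumes [measurable]: "f \<in> borel_measurable M" "r \<in> borel_measurable M"
    and r: "\<And>z. r z \<ge> 0"
    and int: "\<And>\<sigma>. a < \<sigma> \<Longrightarrow> \<sigma> < b \<Longrightarrow> integrable M (\<lambda>z. r z powr \<sigma> *\<^sub>R f z)"
  shows "(\<lambda>s. LINT z|M. f z * complex_of_real (r z) powr s) holomorphic_on {s. a < Re s \<and> Re s < b}"
proof -
  have norm_powr: "norm (complex_of_real (r z) powr s) = r z powr Re s" for z s
    using r[of z] by (cases "r z = 0") (simp_all add: norm_powr_real_powr)
  have meas: "(\<lambda>z. complex_of_real (r z) powr s) \<in> borel_measurable M" for s by measurable
  have I: "integrable M (\<lambda>z. f z * complex_of_real (r z) powr s)" if "a < Re s" "Re s < b" for s
    by (rule Bochner_Integration.integrable_bound[OF int[OF that]]) (auto simp: norm_mult norm_powr mult.commute)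
  let ?G = "\<lambda>s. LINT z|M. f z * complex_of_real (r z) powr s"
  have "(?G has_field_derivative (LINT z|M. f z * (complex_of_real (r z) powr s * of_real (ln (r z))))) (at s)"
    if s: "a < Re s" "Re s < b" for s
  proof -
    \<comment> \<open>A third of the distance to the edges leaves room for exponents shifted by
      \<open>2 * \<eta>\<close>: one \<eta> bounds the increment \<open>h\<close>, the other
      dominates the logarithm.\<close>
    define \<eta> where "\<eta> = min (Re s - a) (b - Re s) / 3"
    have \<eta>: "\<eta> > 0" "a < Re s - 2 * \<eta>" "Re s + 2 * \<eta> < b" using s by (auto simp: \<eta>_def min_def field_simps)
    let ?q = "\<lambda>h z. f z * ((complex_of_real (r z) powr (s + h) - complex_of_real (r z) powr s) / h)"
    let ?d = "\<lambda>z. f z * (complex_of_real (r z) powr s * of_real (ln (r z)))"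
    let ?w = "\<lambda>z. (1 / \<eta>) * (norm (r z powr (Re s + 2 * \<eta>) *\<^sub>R f z) + norm (r z powr (Re s - 2 * \<eta>) *\<^sub>R f z))"
    have w: "integrable M ?w"
      using \<eta> s by (intro integrable_mult_right Bochner_Integration.integrable_add integrable_norm int) auto
    \<comment> \<open>This includes \<open>r z = 0\<close>, where every power is 0 and both sides
      vanish.\<close>
    have fac: "(complex_of_real (r z) powr (s + h) - complex_of_real (r z) powr s) / h
        = complex_of_real (r z) powr s * ((exp (h * of_real (ln (r z))) - 1) / h)" for z h
      using r[of z] by (cases "r z = 0") (simp_all add: powr_def Ln_of_real distrib_right exp_add right_diff_distrib diff_divide_distrib)
    have bound: "norm (?q h z) \<le> ?w z" if h: "norm h < \<eta>" "h \<noteq> 0" for h z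
    proof (cases "r z = 0")
      case False
      then have rp: "r z > 0" using r[of z] by simp
      let ?L = "\<bar>ln (r z)\<bar>"
      have "norm (exp (h * of_real (ln (r z))) - 1) \<le> (norm h * ?L) * exp (norm h * ?L)"
        using norm_exp_minus_1_le[of "h * of_real (ln (r z))"] by (simp add: norm_mult)
      then have "norm ((exp (h * of_real (ln (r z))) - 1) / h) \<le> ?L * exp (norm h * ?L)"
        using h(2) by (simp add: norm_divide divide_le_eq mult_ac)
      also have "\<dots> \<le> ?L * exp (\<eta> * ?L)" using h(1) by (intro mult_left_mono) (auto intro: mult_right_mono)
      also have "\<dots> \<le> (exp (\<eta> * ?L) / \<eta>) * exp (\<eta> * ?L)"
      proof (rule mult_right_mono)
        have "\<eta> * ?L \<le> exp (\<eta> * ?L)" using exp_ge_add_one_self[of "\<eta> * ?L"] by linarith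
        then show "?L \<le> exp (\<eta> * ?L) / \<eta>" using \<eta>(1) by (simp add: pos_le_divide_eq mult.commute)
      qed simp
      also have "\<dots> = (1 / \<eta>) * exp (2 * \<eta> * ?L)" by (simp add: exp_add[symmetric])
      also have "exp (2 * \<eta> * ?L) \<le> r z powr (2 * \<eta>) + r z powr (- (2 * \<eta>))"
        using rp by (cases "ln (r z) \<ge> 0") (auto simp: powr_def)
      finally have e: "norm ((exp (h * of_real (ln (r z))) - 1) / h) \<le> (1 / \<eta>) * (r z powr (2 * \<eta>) + r z powr (- (2 * \<eta>)))"
        using \<eta>(1) by (simp add: mult_left_mono divide_right_mono)
      have "norm (?q h z) = norm (f z) * (r z powr Re s * norm ((exp (h * of_real (ln (r z))) - 1) / h))"
        unfolding fac by (simp only: norm_mult norm_powr)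
      also have "\<dots> \<le> norm (f z) * (r z powr Re s * ((1 / \<eta>) * (r z powr (2 * \<eta>) + r z powr (- (2 * \<eta>)))))"
        by (intro mult_left_mono e) auto
      also have "\<dots> = (1 / \<eta>) * ((r z powr Re s * r z powr (2 * \<eta>)) * norm (f z) + (r z powr Re s * r z powr (- (2 * \<eta>))) * norm (f z))"
        by (simp add: algebra_simps)
      also have "\<dots> = ?w z" by (simp add: powr_add[symmetric])
      finally show ?thesis .
    qed (use \<eta> in simp)
    have lim: "((\<lambda>h. ?q h z) \<longlongrightarrow> ?d z) (at 0)" for z
    proof -
      have "((\<lambda>h. exp (h * of_real (ln (r z)))) has_field_derivative of_real (ln (r z))) (at (0::complex))"
        by (auto intro!: derivative_eq_intros)
      then have "((\<lambda>h. (exp (h * of_real (ln (r z))) - 1) / h) \<longlongrightarrow> of_real (ln (r z))) (at (0::complex))"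
        by (simp add: has_field_derivative_iff)
      then show ?thesis unfolding fac by (intro tendsto_intros)
    qed
    have "((\<lambda>h. (?G (s + h) - ?G s) / h) \<longlongrightarrow> (LINT z|M. ?d z)) (at 0)"
      unfolding tendsto_at_iff_sequentially o_def
    proof (intro allI impI)
      fix h :: "nat \<Rightarrow> complex" assume h: "\<forall>i. h i \<in> UNIV - {0}" "h \<longlonglongrightarrow> 0"
      have ev: "eventually (\<lambda>j. norm (h j) < \<eta>) sequentially"
        using order_tendstoD(2)[OF tendsto_norm[OF h(2)], of \<eta>] \<eta> by simp
      then obtain N where N: "\<And>j. j \<ge> N \<Longrightarrow> norm (h j) < \<eta>" by (auto simp: eventually_sequentially)
      have "(\<lambda>j. LINT z|M. ?q (h (j + N)) z) \<longlonglongrightarrow> (LINT z|M. ?d z)"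
      proof (rule integral_dominated_convergence[OF _ _ w])
        show "AE z in M. (\<lambda>j. ?q (h (j + N)) z) \<longlonglongrightarrow> ?d z"
        proof (rule AE_I2)
          fix z
          have "(\<lambda>j. ?q (h j) z) \<longlonglongrightarrow> ?d z"
            using lim[of z] h unfolding tendsto_at_iff_sequentially o_def by blast
          then show "(\<lambda>j. ?q (h (j + N)) z) \<longlonglongrightarrow> ?d z" by (rule LIMSEQ_ignore_initial_segment)
        qed
        show "AE z in M. norm (?q (h (j + N)) z) \<le> ?w z" for j
          using bound[of "h (j + N)"] N[of "j + N"] h(1) by (intro AE_I2) auto
      qed measurable
      moreover have "(LINT z|M. ?q (h (j + N)) z) = (?G (s + h (j + N)) - ?G s) / h (j + N)" for j
      proof -
        have hs: "\<bar>Re (h (j + N))\<bar> < \<eta>" using N[of "j + N"] abs_Re_le_cmod[of "h (j + N)"] by simp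
        then have "a < Re (s + h (j + N))" "Re (s + h (j + N)) < b" using \<eta> by auto
        note Is = I[OF this] I[OF s]
        have "(LINT z|M. ?q (h (j + N)) z) = (LINT z|M. (f z * complex_of_real (r z) powr (s + h (j + N)) - f z * complex_of_real (r z) powr s) / h (j + N))"
          by (simp add: right_diff_distrib diff_divide_distrib)
        also have "\<dots> = (LINT z|M. f z * complex_of_real (r z) powr (s + h (j + N)) - f z * complex_of_real (r z) powr s) / h (j + N)"
          by (rule integral_divide_zero)
        also have "\<dots> = (?G (s + h (j + N)) - ?G s) / h (j + N)"
          by (simp only: Bochner_Integration.integral_diff[OF Is])
        finally show ?thesis .
      qed
      ultimately have "(\<lambda>j. (?G (s + h (j + N)) - ?G s) / h (j + N)) \<longlonglongrightarrow> (LINT z|M. ?d z)" by (simp only:)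
      then show "(\<lambda>j. (?G (s + h j) - ?G s) / h j) \<longlonglongrightarrow> (LINT z|M. ?d z)"
        by (rule LIMSEQ_offset)
    qed
    then show ?thesis unfolding DERIV_def .
  qed
  then show ?thesis
    unfolding holomorphic_on_def field_differentiable_def by (blast intro: has_field_derivative_at_within)
qed

section \<open>Behaviour of the Riesz potentials near order zero\<close>

lemma integrable_cball_powr:
  fixes x :: "real ^ 'n" and s :: real
  assumes s: "s > 0"
  shows "integrable lborel (\<lambda>z. norm (z - x) powr (s - CARD('n)) * indicator (cball x 1) z)" (is ?I)
    and "(LINT z|lborel. norm (z - x) powr (s - CARD('n)) * indicator (cball x 1) z) = CARD('n) * unit_ball_vol CARD('n) / s"
proof -
  let ?h = "\<lambda>z. norm (z - x) powr (s - CARD('n)) * indicator (cball x 1) z"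
  let ?g = "\<lambda>u::real ^ 'n. norm u powr (s - CARD('n)) * indicator (cball 0 1) u"
  have "(\<integral>\<^sup>+u. ennreal (?g u) \<partial>lborel) = (\<integral>\<^sup>+u. ennreal (norm u powr (s - real DIM(real ^ 'n))) * indicator (cball 0 1) u \<partial>(lborel :: (real ^ 'n) measure))"
    by (intro nn_integral_cong) (auto simp: indicator_def)
  also have "\<dots> = ennreal (real DIM(real ^ 'n) * unit_ball_vol (real DIM(real ^ 'n)) * 1 powr s / s)"
    by (rule nn_integral_norm_powr_cball) (use s in auto)
  finally have nn: "(\<integral>\<^sup>+u. ennreal (?g u) \<partial>lborel) = ennreal (CARD('n) * unit_ball_vol CARD('n) / s)" by simp
  have m [measurable]: "(indicator (cball y 1) :: real ^ 'n \<Rightarrow> real) \<in> borel_measurable borel" for y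
    by (intro borel_measurable_indicator) simp
  have hb: "has_bochner_integral lborel ?g (CARD('n) * unit_ball_vol CARD('n) / s)"
    by (rule has_bochner_integral_nn_integral[OF _ _ _ nn]) (use s in auto)
  have sh: "?h (x + u) = ?g u" for u by (simp add: indicator_def dist_norm)
  have "?h \<in> borel_measurable borel" by measurable
  then show ?I "(LINT z|lborel. ?h z) = CARD('n) * unit_ball_vol CARD('n) / s"
    using hb integrable_lborel_translate[of ?h x] integral_lborel_translate[of ?h x]
    unfolding sh by (auto simp: has_bochner_integral_iff)
qed

text \<open>For an integer \<open>d\<close> this number is the area of the unit sphere in dimension
  \<open>d\<close>.\<close>

lemma unit_ball_vol_Gamma:
  fixes d :: real
  assumes "d > 0"
  shows "d * unit_ball_vol d = 2 * pi powr (d / 2) / Gamma (d / 2)"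
proof -
  have "d / 2 \<notin> \<int>\<^sub>\<le>\<^sub>0" using assms by (auto elim!: nonpos_Ints_cases)
  then have "Gamma (d / 2 + 1) = d / 2 * Gamma (d / 2)" by (rule Gamma_plus1)
  then show ?thesis using assms unfolding unit_ball_vol_def by (simp only:) simp
qed

text \<open>The pole of \<open>Gamma (\<epsilon> / 2)\<close> at 0 makes
  \<open>riesz_H_real n \<epsilon>\<close> asymptotic to the sphere area divided by \<epsilon>,
  which is exactly the integral of the kernel over the unit ball. So the normalised mass there tends
  to 1, and the prefactor, tending to 0, suppresses everything away from the centre.\<close>

lemma riesz_H_limit:
  fixes n :: real
  assumes n: "n > 0"
  shows "((\<lambda>\<epsilon>. 1 / riesz_H_real n \<epsilon> * (n * unit_ball_vol n / \<epsilon>)) \<longlongrightarrow> 1) (at_right 0)"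
    and "((\<lambda>\<epsilon>. 1 / riesz_H_real n \<epsilon>) \<longlongrightarrow> 0) (at_right 0)"
proof -
  have Gn: "Gamma (n / 2) > 0" using n by (intro Gamma_real_pos) simp
  have ev: "eventually (\<lambda>\<epsilon>::real. \<epsilon> > 0) (at_right 0)" by (rule eventually_at_right_less)
  have G: "\<epsilon> * Gamma (\<epsilon> / 2) = 2 * Gamma (\<epsilon> / 2 + 1)" if "\<epsilon> > 0" for \<epsilon> :: real
  proof -
    have "\<epsilon> / 2 \<notin> \<int>\<^sub>\<le>\<^sub>0" using that by (auto elim!: nonpos_Ints_cases)
    then have "Gamma (\<epsilon> / 2 + 1) = \<epsilon> / 2 * Gamma (\<epsilon> / 2)" by (rule Gamma_plus1)
    then show ?thesis by simp
  qed
  have "((\<lambda>\<epsilon>. (n * unit_ball_vol n) * Gamma ((n - \<epsilon>) / 2) / (2 powr \<epsilon> * pi powr (n / 2) * (2 * Gamma (\<epsilon> / 2 + 1))))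
     \<longlongrightarrow> (n * unit_ball_vol n) * Gamma ((n - 0) / 2) / (2 powr 0 * pi powr (n / 2) * (2 * Gamma (0 / 2 + 1)))) (at_right 0)"
    using n by (intro tendsto_intros) (auto elim!: nonpos_Ints_cases)
  also have "(n * unit_ball_vol n) * Gamma ((n - 0) / 2) / (2 powr 0 * pi powr (n / 2) * (2 * Gamma (0 / 2 + 1))) = 1"
    using Gn[THEN less_imp_neq] unit_ball_vol_Gamma[OF n] by simp
  finally show A: "((\<lambda>\<epsilon>. 1 / riesz_H_real n \<epsilon> * (n * unit_ball_vol n / \<epsilon>)) \<longlongrightarrow> 1) (at_right 0)"
  proof (rule tendsto_cong[THEN iffD1, rotated])
    show "eventually (\<lambda>\<epsilon>. (n * unit_ball_vol n) * Gamma ((n - \<epsilon>) / 2) / (2 powr \<epsilon> * pi powr (n / 2) * (2 * Gamma (\<epsilon> / 2 + 1)))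
       = 1 / riesz_H_real n \<epsilon> * (n * unit_ball_vol n / \<epsilon>)) (at_right 0)"
      using ev
    proof eventually_elim
      case (elim \<epsilon>)
      show ?case unfolding G[OF elim, symmetric] riesz_H_real_def by (simp add: mult_ac)
    qed
  qed
  have nz: "n * unit_ball_vol n \<noteq> 0" using n unit_ball_vol_pos[of n, THEN less_imp_neq] by auto
  have "((\<lambda>\<epsilon>. (1 / riesz_H_real n \<epsilon> * (n * unit_ball_vol n / \<epsilon>)) * (\<epsilon> / (n * unit_ball_vol n))) \<longlongrightarrow> 1 * (0 / (n * unit_ball_vol n))) (at_right 0)"
    using nz by (intro tendsto_intros A)
  then have "((\<lambda>\<epsilon>. (1 / riesz_H_real n \<epsilon> * (n * unit_ball_vol n / \<epsilon>)) * (\<epsilon> / (n * unit_ball_vol n))) \<longlongrightarrow> 0) (at_right 0)"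
    by simp
  then show "((\<lambda>\<epsilon>. 1 / riesz_H_real n \<epsilon>) \<longlongrightarrow> 0) (at_right 0)"
  proof (rule tendsto_cong[THEN iffD1, rotated])
    show "eventually (\<lambda>\<epsilon>. (1 / riesz_H_real n \<epsilon> * (n * unit_ball_vol n / \<epsilon>)) * (\<epsilon> / (n * unit_ball_vol n)) = 1 / riesz_H_real n \<epsilon>) (at_right 0)"
      using ev
    proof eventually_elim
      case (elim \<epsilon>)
      have "(n * unit_ball_vol n / \<epsilon>) * (\<epsilon> / (n * unit_ball_vol n)) = 1" using elim nz by simp
      then show ?case by (simp only: mult.assoc mult_1_right)
    qed
  qed
qed

text \<open>Subtract \<open>f x\<close> on the unit ball. Within distance \<rho> of \<open>x\<close>
  the remainder \<open>\<phi>\<close> is small and the normalised kernel mass is bounded; beyond it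
  the kernel of order \<epsilon> is at most \<open>\<rho> powr (- e0)\<close> times the one of the
  fixed order \<open>e0\<close>, and the prefactor tends to 0.\<close>

lemma riesz_approximate_identity:
  fixes f :: "real ^ 'n \<Rightarrow> complex" and x :: "real ^ 'n"
  assumes cont: "continuous_on UNIV f"
    and f: "\<And>y. norm (f y) \<le> C * (1 + norm y) powr (- a)" and a: "a > 0"
  shows "((\<lambda>\<epsilon>. (1 / riesz_H_real CARD('n) \<epsilon>) *\<^sub>R (LINT z|lborel. norm (z - x) powr (\<epsilon> - CARD('n)) *\<^sub>R f z)) \<longlongrightarrow> f x) (at_right 0)"
proof -
  let ?n = "real CARD('n)"
  have n: "?n \<ge> 1" using zero_less_card_finite[where 'a='n] by linarith
  have [measurable]: "f \<in> borel_measurable borel" using cont by (rule borel_measurable_continuous_onI)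
  have [measurable]: "(indicator (cball x 1) :: real ^ 'n \<Rightarrow> real) \<in> borel_measurable borel"
    by (intro borel_measurable_indicator) simp
  let ?w = "\<lambda>\<epsilon> z. norm (z - x) powr (\<epsilon> - ?n)"
  define \<phi> where "\<phi> z = f z - indicator (cball x 1) z *\<^sub>R f x" for z
  have [measurable]: "\<phi> \<in> borel_measurable borel" unfolding \<phi>_def[abs_def] by measurable
  define c where "c \<epsilon> = 1 / riesz_H_real ?n \<epsilon>" for \<epsilon>
  define A where "A \<epsilon> = c \<epsilon> * (?n * unit_ball_vol ?n / \<epsilon>)" for \<epsilon>
  have A: "(A \<longlongrightarrow> 1) (at_right 0)" and c0: "(c \<longlongrightarrow> 0) (at_right 0)"
    using riesz_H_limit[of ?n] n by (auto simp: A_def[abs_def] c_def[abs_def])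
  \<comment> \<open>\<open>e0 < a\<close> gives integrability at infinity, and \<open>e0 < 1\<close>
    keeps the orders below the dimension, where \<open>riesz_H_real\<close> is positive.\<close>
  define e0 where "e0 = min (a / 2) (1 / 2)"
  have e0: "0 < e0" "e0 < a" "e0 < 1" using a by (auto simp: e0_def)
  have int_f: "integrable lborel (\<lambda>z. ?w \<epsilon> z *\<^sub>R f z)" if "0 < \<epsilon>" "\<epsilon> \<le> e0" for \<epsilon>
    using that e0 by (intro integrable_powr_decay[OF _ f]) auto
  have split: "?w \<epsilon> z *\<^sub>R \<phi> z = ?w \<epsilon> z *\<^sub>R f z - (?w \<epsilon> z * indicator (cball x 1) z) *\<^sub>R f x" for \<epsilon> z
    by (simp add: \<phi>_def scaleR_diff_right)
  have int_\<phi>: "integrable lborel (\<lambda>z. ?w \<epsilon> z *\<^sub>R \<phi> z)" if "0 < \<epsilon>" "\<epsilon> \<le> e0" for \<epsilon>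
    unfolding split using that
    by (intro Bochner_Integration.integrable_diff int_f integrable_scaleR_left integrable_cball_powr) auto
  define K0 where "K0 = (LINT z|lborel. norm (?w e0 z *\<^sub>R \<phi> z))"
  have est: "norm ((1 / riesz_H_real ?n \<epsilon>) *\<^sub>R (LINT z|lborel. ?w \<epsilon> z *\<^sub>R f z) - A \<epsilon> *\<^sub>R f x)
      \<le> \<eta> * A \<epsilon> + c \<epsilon> * (\<rho> powr (- e0) * K0)"
    if \<epsilon>: "0 < \<epsilon>" "\<epsilon> \<le> e0" and \<rho>: "0 < \<rho>" "\<rho> \<le> 1" and \<eta>: "0 \<le> \<eta>" "\<And>z. norm (z - x) < \<rho> \<Longrightarrow> norm (f z - f x) \<le> \<eta>" for \<epsilon> \<rho> \<eta>
  proof -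
    have "\<epsilon> < ?n" using \<epsilon> e0 n by linarith
    then have c: "c \<epsilon> > 0" using \<epsilon>(1) by (simp add: c_def riesz_H_real_pos)
    have "(LINT z|lborel. ?w \<epsilon> z *\<^sub>R \<phi> z) = (LINT z|lborel. ?w \<epsilon> z *\<^sub>R f z) - (LINT z|lborel. (?w \<epsilon> z * indicator (cball x 1) z) *\<^sub>R f x)"
      unfolding split using \<epsilon>
      by (intro Bochner_Integration.integral_diff int_f integrable_scaleR_left integrable_cball_powr)
    also have "(LINT z|lborel. (?w \<epsilon> z * indicator (cball x 1) z) *\<^sub>R f x) = (?n * unit_ball_vol ?n / \<epsilon>) *\<^sub>R f x"
      using integrable_cball_powr[OF \<epsilon>(1), of x] by (subst integral_scaleR_left) auto
    finally have eq: "(1 / riesz_H_real ?n \<epsilon>) *\<^sub>R (LINT z|lborel. ?w \<epsilon> z *\<^sub>R f z) - A \<epsilon> *\<^sub>R f x = c \<epsilon> *\<^sub>R (LINT z|lborel. ?w \<epsilon> z *\<^sub>R \<phi> z)"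
      by (simp add: A_def c_def scaleR_diff_right)
    have "norm (LINT z|lborel. ?w \<epsilon> z *\<^sub>R \<phi> z) \<le> (LINT z|lborel. norm (?w \<epsilon> z *\<^sub>R \<phi> z))"
      by (rule integral_norm_bound)
    also have "\<dots> \<le> (LINT z|lborel. \<eta> * (?w \<epsilon> z * indicator (cball x 1) z) + \<rho> powr (- e0) * norm (?w e0 z *\<^sub>R \<phi> z))"
    proof (rule integral_mono)
      show "integrable lborel (\<lambda>z. norm (?w \<epsilon> z *\<^sub>R \<phi> z))" by (intro integrable_norm int_\<phi> \<epsilon>)
      show "integrable lborel (\<lambda>z. \<eta> * (?w \<epsilon> z * indicator (cball x 1) z) + \<rho> powr (- e0) * norm (?w e0 z *\<^sub>R \<phi> z))"
        using \<epsilon> e0 by (intro Bochner_Integration.integrable_add integrable_mult_right integrable_norm int_\<phi> integrable_cball_powr) auto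
      fix z
      show "norm (?w \<epsilon> z *\<^sub>R \<phi> z) \<le> \<eta> * (?w \<epsilon> z * indicator (cball x 1) z) + \<rho> powr (- e0) * norm (?w e0 z *\<^sub>R \<phi> z)"
      proof (cases "norm (z - x) < \<rho>")
        case True
        then have "z \<in> cball x 1" using \<rho> by (simp add: dist_norm norm_minus_commute)
        then have "norm (\<phi> z) \<le> \<eta>" using \<eta>(2)[OF True] by (simp add: \<phi>_def)
        then have "?w \<epsilon> z * norm (\<phi> z) \<le> ?w \<epsilon> z * \<eta>" by (intro mult_left_mono) auto
        then show ?thesis using \<open>z \<in> cball x 1\<close> by (simp add: mult.commute add_increasing2)
      next
        case False
        then have z: "norm (z - x) \<ge> \<rho>" by simp
        have "?w \<epsilon> z = ?w e0 z * norm (z - x) powr (\<epsilon> - e0)" by (simp add: powr_add[symmetric])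
        also have "norm (z - x) powr (\<epsilon> - e0) \<le> \<rho> powr (\<epsilon> - e0)" using z \<rho> \<epsilon> by (intro powr_mono2') auto
        also have "\<rho> powr (\<epsilon> - e0) \<le> \<rho> powr (- e0)" using \<rho> \<epsilon> by (intro powr_mono') auto
        finally have "?w \<epsilon> z \<le> ?w e0 z * \<rho> powr (- e0)" by (simp add: mult_left_mono)
        then have "?w \<epsilon> z * norm (\<phi> z) \<le> ?w e0 z * \<rho> powr (- e0) * norm (\<phi> z)" by (intro mult_right_mono) auto
        then show ?thesis using \<eta>(1) by (simp add: mult_ac add_increasing)
      qed
    qed
    also have "\<dots> = \<eta> * (?n * unit_ball_vol ?n / \<epsilon>) + \<rho> powr (- e0) * K0"
    proof -
      have "integrable lborel (\<lambda>z. \<eta> * (?w \<epsilon> z * indicator (cball x 1) z))" "integrable lborel (\<lambda>z. \<rho> powr (- e0) * norm (?w e0 z *\<^sub>R \<phi> z))"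
        using \<epsilon> e0 by (intro integrable_mult_right integrable_norm int_\<phi> integrable_cball_powr; simp)+
      note Bochner_Integration.integral_add[OF this]
      then show ?thesis by (simp only: integral_mult_right_zero K0_def integrable_cball_powr(2)[OF \<epsilon>(1)])
    qed
    finally have "c \<epsilon> * norm (LINT z|lborel. ?w \<epsilon> z *\<^sub>R \<phi> z) \<le> c \<epsilon> * (\<eta> * (?n * unit_ball_vol ?n / \<epsilon>) + \<rho> powr (- e0) * K0)"
      using c by (intro mult_left_mono) auto
    then show ?thesis unfolding eq using c by (simp add: A_def algebra_simps)
  qed
  show ?thesis
  proof (rule tendstoI)
    fix e :: real assume e: "e > 0"
    \<comment> \<open>Since \<open>A \<epsilon> < 2\<close> eventually, the term
      \<open>\<eta> * A \<epsilon>\<close> stays within a third of \<open>e\<close>.\<close>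
    define \<eta> where "\<eta> = e / 6"
    have \<eta>: "\<eta> > 0" using e by (simp add: \<eta>_def)
    have "isCont f x" using cont by (simp add: continuous_on_eq_continuous_at)
    then obtain d where d: "d > 0" "\<And>z. norm (z - x) < d \<Longrightarrow> norm (f z - f x) < \<eta>"
      using \<eta> unfolding continuous_at_eps_delta dist_norm by metis
    define \<rho> where "\<rho> = min d 1"
    have \<rho>: "0 < \<rho>" "\<rho> \<le> 1" "\<And>z. norm (z - x) < \<rho> \<Longrightarrow> norm (f z - f x) \<le> \<eta>"
      using d by (auto simp: \<rho>_def less_imp_le)
    have "((\<lambda>\<epsilon>. c \<epsilon> * (\<rho> powr (- e0) * K0)) \<longlongrightarrow> 0 * (\<rho> powr (- e0) * K0)) (at_right 0)"
      by (intro tendsto_intros c0)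
    then have ev1: "eventually (\<lambda>\<epsilon>. c \<epsilon> * (\<rho> powr (- e0) * K0) < e / 3) (at_right 0)"
      using e by (intro order_tendstoD(2)) auto
    have ev2: "eventually (\<lambda>\<epsilon>. A \<epsilon> < 2) (at_right 0)" using A by (intro order_tendstoD(2)) auto
    have "((\<lambda>\<epsilon>. norm (A \<epsilon> *\<^sub>R f x - f x)) \<longlongrightarrow> norm (1 *\<^sub>R f x - f x)) (at_right 0)"
      by (intro tendsto_intros A)
    then have ev3: "eventually (\<lambda>\<epsilon>. norm (A \<epsilon> *\<^sub>R f x - f x) < e / 3) (at_right 0)"
      using e by (intro order_tendstoD(2)) auto
    have ev4: "eventually (\<lambda>\<epsilon>. 0 < \<epsilon> \<and> \<epsilon> < e0) (at_right 0)"
      using e0(1) by (intro eventually_conj eventually_at_right_less) (auto simp: eventually_at_right_field)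
    show "eventually (\<lambda>\<epsilon>. dist ((1 / riesz_H_real ?n \<epsilon>) *\<^sub>R (LINT z|lborel. ?w \<epsilon> z *\<^sub>R f z)) (f x) < e) (at_right 0)"
      using ev1 ev2 ev3 ev4
    proof eventually_elim
      case (elim \<epsilon>)
      let ?J = "(1 / riesz_H_real ?n \<epsilon>) *\<^sub>R (LINT z|lborel. ?w \<epsilon> z *\<^sub>R f z)"
      have "norm (?J - A \<epsilon> *\<^sub>R f x) \<le> \<eta> * A \<epsilon> + c \<epsilon> * (\<rho> powr (- e0) * K0)"
        using elim \<eta> \<rho> by (intro est) auto
      moreover have "\<eta> * A \<epsilon> \<le> \<eta> * 2" using elim(2) \<eta> by (intro mult_left_mono) auto
      moreover have "norm (?J - f x) \<le> norm (?J - A \<epsilon> *\<^sub>R f x) + norm (A \<epsilon> *\<^sub>R f x - f x)"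
        using norm_triangle_ineq[of "?J - A \<epsilon> *\<^sub>R f x" "A \<epsilon> *\<^sub>R f x - f x"] by simp
      ultimately show ?case using elim by (simp add: dist_norm \<eta>_def)
    qed
  qed
qed

text \<open>Fubini applied to the kernel composition, which also computes the integral of the
  absolute values and so justifies the exchange.\<close>

lemma riesz_compose:
  fixes f :: "real ^ 'n \<Rightarrow> complex" and x :: "real ^ 'n" and \<alpha> \<beta> :: real
  assumes [measurable]: "f \<in> borel_measurable borel"
    and f: "\<And>y. norm (f y) \<le> C * (1 + norm y) powr (- a)"
    and ab: "0 < \<alpha>" "0 < \<beta>" "\<alpha> + \<beta> < a" "\<alpha> + \<beta> < CARD('n)"
  defines "H \<equiv> riesz_H_real CARD('n)"
  shows "(LINT y|lborel. norm (x - y) powr (\<alpha> - CARD('n)) *\<^sub>R (LINT z|lborel. norm (z - y) powr (\<beta> - CARD('n)) *\<^sub>R f z))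
    = (H \<alpha> * H \<beta> / H (\<alpha> + \<beta>)) *\<^sub>R (LINT z|lborel. norm (z - x) powr (\<alpha> + \<beta> - CARD('n)) *\<^sub>R f z)"
proof -
  let ?n = "real CARD('n)"
  define c where "c = H \<alpha> * H \<beta> / H (\<alpha> + \<beta>)"
  let ?p = "\<lambda>y z. norm (x - y) powr (\<alpha> - ?n) * norm (z - y) powr (\<beta> - ?n)"
  have c: "c \<ge> 0" using ab unfolding c_def H_def by (intro divide_nonneg_nonneg mult_nonneg_nonneg less_imp_le riesz_H_real_pos) auto
  have comp: "(\<integral>\<^sup>+y. ennreal (?p y z) \<partial>lborel) = ennreal (c * norm (z - x) powr (\<alpha> + \<beta> - ?n))" if "z \<noteq> x" for z
    using riesz_kernel_composition[of \<alpha> \<beta> x z] ab that by (simp add: c_def H_def norm_minus_commute)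
  have zx: "AE z in lborel. z \<noteq> x" by (rule AE_lborel_singleton)
  have int: "integrable (lborel \<Otimes>\<^sub>M lborel) (\<lambda>(y, z). ?p y z *\<^sub>R f z)"
  proof (rule integrableI_bounded)
    show "(\<lambda>(y, z). ?p y z *\<^sub>R f z) \<in> borel_measurable (lborel \<Otimes>\<^sub>M lborel)" by measurable
    have "(\<integral>\<^sup>+q. ennreal (norm (case q of (y, z) \<Rightarrow> ?p y z *\<^sub>R f z)) \<partial>(lborel \<Otimes>\<^sub>M lborel))
      = (\<integral>\<^sup>+z. \<integral>\<^sup>+y. ennreal (norm (?p y z *\<^sub>R f z)) \<partial>lborel \<partial>lborel)"
      by (subst lborel_pair.nn_integral_snd[symmetric]) auto
    also have "\<dots> = (\<integral>\<^sup>+z. ennreal (norm (c *\<^sub>R (norm (z - x) powr (\<alpha> + \<beta> - ?n) *\<^sub>R f z))) \<partial>lborel)"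
    proof (rule nn_integral_cong_AE, use zx in eventually_elim)
      case (elim z)
      have "(\<integral>\<^sup>+y. ennreal (norm (?p y z *\<^sub>R f z)) \<partial>lborel) = (\<integral>\<^sup>+y. ennreal (?p y z) * ennreal (norm (f z)) \<partial>lborel)"
        by (simp add: ennreal_mult' abs_mult)
      also have "\<dots> = ennreal (c * norm (z - x) powr (\<alpha> + \<beta> - ?n)) * ennreal (norm (f z))"
        using comp[OF elim] by (subst nn_integral_multc) auto
      also have "\<dots> = ennreal (norm (c *\<^sub>R (norm (z - x) powr (\<alpha> + \<beta> - ?n) *\<^sub>R f z)))"
        using c by (subst ennreal_mult'[symmetric]) (auto simp: mult.assoc)
      finally show ?case .
    qed
    also have "\<dots> < \<infinity>"
    proof -
      have "integrable lborel (\<lambda>z. c *\<^sub>R (norm (z - x) powr (\<alpha> + \<beta> - ?n) *\<^sub>R f z))"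
        using ab by (intro integrable_scaleR_right integrable_powr_decay[OF _ f]) auto
      then show ?thesis by (simp only: integrable_iff_bounded)
    qed
    finally show "(\<integral>\<^sup>+q. ennreal (norm (case q of (y, z) \<Rightarrow> ?p y z *\<^sub>R f z)) \<partial>(lborel \<Otimes>\<^sub>M lborel)) < \<infinity>" .
  qed
  have "(LINT y|lborel. norm (x - y) powr (\<alpha> - ?n) *\<^sub>R (LINT z|lborel. norm (z - y) powr (\<beta> - ?n) *\<^sub>R f z))
    = (LINT y|lborel. LINT z|lborel. ?p y z *\<^sub>R f z)"
    by (simp flip: scaleR_scaleR)
  also have "\<dots> = (LINT z|lborel. LINT y|lborel. ?p y z *\<^sub>R f z)"
    by (rule lborel_pair.Fubini_integral[OF int, symmetric])
  also have "\<dots> = (LINT z|lborel. c *\<^sub>R (norm (z - x) powr (\<alpha> + \<beta> - ?n) *\<^sub>R f z))"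
  proof (rule integral_cong_AE, measurable, use zx in eventually_elim)
    case (elim z)
    have "has_bochner_integral lborel (\<lambda>y. ?p y z) (c * norm (z - x) powr (\<alpha> + \<beta> - ?n))"
      by (rule has_bochner_integral_nn_integral[OF _ _ _ comp[OF elim]]) (use c in auto)
    then have "has_bochner_integral lborel (\<lambda>y. ?p y z *\<^sub>R f z) ((c * norm (z - x) powr (\<alpha> + \<beta> - ?n)) *\<^sub>R f z)"
      by (rule has_bochner_integral_scaleR_left)
    then show ?case by (simp add: has_bochner_integral_iff)
  qed
  also have "\<dots> = c *\<^sub>R (LINT z|lborel. norm (z - x) powr (\<alpha> + \<beta> - ?n) *\<^sub>R f z)"
    by (rule integral_scaleR_right)
  finally show ?thesis by (simp only: c_def)
qed

section \<open>Analytic continuation and inversion\<close>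

text \<open>In the product the sphere areas cancel against the Gamma factors up to
  \<open>2 powr k * pi powr (k / 2)\<close> and a quotient of two Gamma values; the power is that of
  \<open>4 * pi\<close> with exponent \<open>k / 2\<close>.\<close>

lemma kplane_const_riesz_H:
  fixes n k :: real
  assumes "0 < k" "k < n"
  shows "(4 * pi) powr (- (k / 2)) * (Gamma ((n - k) / 2) / Gamma (n / 2)) * (kplane_const n k * riesz_H_real n k) = 1"
proof -
  have G: "Gamma ((n - k) / 2) \<noteq> 0" "Gamma (n / 2) \<noteq> 0" "Gamma (k / 2) \<noteq> 0"
    using assms by (auto intro!: less_imp_neq[symmetric] Gamma_real_pos)
  have "kplane_const n k = (2 * pi powr (k / 2) / Gamma (k / 2)) / (2 * pi powr (n / 2) / Gamma (n / 2))"
    using unit_ball_vol_Gamma[of k] unit_ball_vol_Gamma[of n] assms by (simp add: kplane_const_def)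
  then have "kplane_const n k * riesz_H_real n k = 2 powr k * pi powr (k / 2) * (Gamma (n / 2) / Gamma ((n - k) / 2))"
    using G by (simp add: riesz_H_real_def)
  moreover have "(4 * pi) powr (- (k / 2)) * (2 powr k * pi powr (k / 2)) = 1"
  proof -
    have "(4::real) powr (- (k / 2)) = (2 powr 2) powr (- (k / 2))" by simp
    also have "\<dots> = 2 powr (- k)" by (simp only: powr_powr) simp
    finally have "(4 * pi) powr (- (k / 2)) = 2 powr (- k) * pi powr (- (k / 2))"
      by (simp add: powr_mult)
    moreover have "2 powr (- k) * 2 powr k = (1::real)" "pi powr (- (k / 2)) * pi powr (k / 2) = 1"
      by (simp_all add: powr_add[symmetric])
    ultimately show ?thesis by (simp add: mult_ac)
  qed
  ultimately show ?thesis using G by (simp add: mult_ac)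
qed

text \<open>In this strip both Gamma arguments have positive real part, away from the poles, and
  Gamma has no zeros there.\<close>

lemma riesz_H_holomorphic:
  "(\<lambda>\<beta>. 1 / riesz_H n \<beta>) holomorphic_on {\<beta>. 0 < Re \<beta> \<and> Re \<beta> < real n}"
proof -
  have np: "z \<notin> \<int>\<^sub>\<le>\<^sub>0" if "Re z > 0" for z :: complex
    using that by (auto elim!: nonpos_Ints_cases)
  have nz: "riesz_H n \<beta> \<noteq> 0" if "0 < Re \<beta>" "Re \<beta> < real n" for \<beta>
    using that np[of "\<beta> / 2"] np[of "(of_nat n - \<beta>) / 2"] by (simp add: riesz_H_def Gamma_eq_zero_iff)
  have "riesz_H n holomorphic_on {\<beta>. 0 < Re \<beta> \<and> Re \<beta> < real n}"
    unfolding riesz_H_def[abs_def]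
    by (intro holomorphic_intros) (auto simp: Gamma_eq_zero_iff intro!: np dest: np)
  then show ?thesis by (intro holomorphic_intros) (auto simp: nz)
qed

section \<open>The identity theorem on strips\<close>

lemma open_strip: "open {s. a < Re s \<and> Re s < b}"
  and connected_strip: "connected {s. a < Re s \<and> Re s < b}"
proof -
  have eq: "{s. a < Re s \<and> Re s < b} = {s. a < Re s} \<inter> {s. Re s < b}" by auto
  show "open {s. a < Re s \<and> Re s < b}"
    unfolding eq by (intro open_Int open_halfspace_Re_gt open_halfspace_Re_lt)
  show "connected {s. a < Re s \<and> Re s < b}"
    unfolding eq by (intro convex_connected convex_Int convex_halfspace_Re_gt convex_halfspace_Re_lt)
qed

text \<open>The composition of kernels is established for real exponents; this carries the resulting
  identity to the whole strip.\<close>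

lemma holomorphic_eq_real_segment:
  assumes F: "F holomorphic_on {s. 0 < Re s \<and> Re s < b}" and G: "G holomorphic_on {s. 0 < Re s \<and> Re s < b}"
    and b: "b > 0" and eq: "\<And>t. 0 < t \<Longrightarrow> t < b \<Longrightarrow> F (complex_of_real t) = G (complex_of_real t)"
    and s: "0 < Re s" "Re s < b"
  shows "F s = G s"
proof -
  let ?U = "complex_of_real ` {0<..<b}"
  have lp: "complex_of_real (b / 2) islimpt ?U"
    unfolding islimpt_approachable
  proof (intro allI impI)
    fix e :: real assume e: "e > 0"
    define t where "t = b / 2 + min (e / 2) (b / 4)"
    have t: "t \<in> {0<..<b}" "t \<noteq> b / 2" "\<bar>t - b / 2\<bar> < e" using e b by (auto simp: t_def min_def)
    show "\<exists>x'\<in>?U. x' \<noteq> complex_of_real (b / 2) \<and> dist x' (complex_of_real (b / 2)) < e"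
    proof (intro bexI conjI)
      show "complex_of_real t \<in> ?U" using t(1) by (rule imageI)
      show "complex_of_real t \<noteq> complex_of_real (b / 2)" using t(2) by (simp only: of_real_eq_iff not_False_eq_True)
      show "dist (complex_of_real t) (complex_of_real (b / 2)) < e"
        using t(3) by (simp only: dist_of_real dist_real_def)
    qed
  qed
  have "(\<lambda>s. F s - G s) holomorphic_on {s. 0 < Re s \<and> Re s < b}" by (intro holomorphic_intros F G)
  then have "F s - G s = 0"
    by (rule analytic_continuation[OF _ open_strip connected_strip _ _ lp]) (use b s eq in auto)
  then show ?thesis by simp
qed

lemma riesz_continuation_unique:
  fixes g :: "real ^ 'n \<Rightarrow> complex"
  assumes F: "riesz_continuation g x c b F" and G: "riesz_continuation g x c' b' G"
    and s: "c < Re s" "c' < Re s" "Re s \<le> 0"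
  shows "F s = G s"
proof -
  \<comment> \<open>The bound 1 keeps the common strip to the left of the first pole, which lies at
    the dimension.\<close>
  define c0 b0 where "c0 = max c c'" and "b0 = min (min b b') 1"
  have b0: "b0 > 0" "b0 \<le> b" "b0 \<le> b'" using F G by (auto simp: b0_def riesz_continuation_def)
  have c0: "c0 < 0" "c \<le> c0" "c' \<le> c0" using F G by (auto simp: c0_def riesz_continuation_def)
  have n: "CARD('n) \<ge> 1" using zero_less_card_finite[where 'a='n] by simp
  have pole: "z \<notin> riesz_poles CARD('n)" if "Re z < b0" for z
  proof
    assume "z \<in> riesz_poles CARD('n)"
    then obtain j where "z = of_nat (CARD('n) + 2 * j)" by (auto simp: riesz_poles_def)
    then have "Re z = real (CARD('n) + 2 * j)" by (simp only: complex_Re_of_nat)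
    moreover have "real (CARD('n) + 2 * j) \<ge> real 1" using n by (intro of_nat_mono) linarith
    ultimately show False using that by (simp add: b0_def)
  qed
  let ?S = "{z. c0 < Re z \<and> Re z < b0}" and ?T = "{z. 0 < Re z \<and> Re z < b0}"
  show ?thesis
  proof (rule analytic_continuation_open[of ?T ?S F G])
    show "open ?T" "open ?S" "connected ?S" by (rule open_strip connected_strip)+
    have "complex_of_real (b0 / 2) \<in> ?T" using b0 by simp
    then show "?T \<noteq> {}" by blast
    show "?T \<subseteq> ?S" using c0 by auto
    show "F holomorphic_on ?S"
      by (rule holomorphic_on_subset[of _ "{z. c < Re z \<and> Re z < b} - riesz_poles CARD('n)"])
        (use F b0 c0 pole in \<open>auto simp: riesz_continuation_def\<close>)
    show "G holomorphic_on ?S"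
      by (rule holomorphic_on_subset[of _ "{z. c' < Re z \<and> Re z < b'} - riesz_poles CARD('n)"])
        (use G b0 c0 pole in \<open>auto simp: riesz_continuation_def\<close>)
    show "F z = G z" if "z \<in> ?T" for z
      using F G that b0 pole[of z] by (auto simp: riesz_continuation_def)
    show "s \<in> ?S" using s b0 by (auto simp: c0_def)
  qed
qed

lemma riesz_potential_eq:
  assumes F: "riesz_continuation g x c b F" and s: "c < Re s" "Re s \<le> 0"
  shows "riesz_potential s g x = F s"
proof -
  have "(THE v. \<exists>c b F. riesz_continuation g x c b F \<and> c < Re s \<and> v = F s) = F s"
  proof (rule the_equality)
    show "\<exists>c b Fa. riesz_continuation g x c b Fa \<and> c < Re s \<and> F s = Fa s" using F s by blast
    fix v assume "\<exists>c b F. riesz_continuation g x c b F \<and> c < Re s \<and> v = F s"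
    then obtain c' b' G where "riesz_continuation g x c' b' G" "c' < Re s" "v = G s" by blast
    then show "v = F s" using riesz_continuation_unique[OF F] s by metis
  qed
  then show ?thesis using s(2) by (simp add: riesz_potential_def)
qed

lemma of_real_norm_powr:
  "complex_of_real (norm y) powr complex_of_real s = complex_of_real (norm y powr s)"
  by (simp add: powr_of_real)

lemma riesz_integral_holomorphic:
  fixes g :: "real ^ 'n \<Rightarrow> complex"
  assumes [measurable]: "g \<in> borel_measurable borel"
    and g: "\<And>y. norm (g y) \<le> C * (1 + norm y) powr (- b)" and b: "b \<le> CARD('n)"
  shows "riesz_integral g x holomorphic_on {s. 0 < Re s \<and> Re s < b}"
proof -
  let ?n = "real CARD('n)"
  have "(\<lambda>s. LINT y|lborel. g y * complex_of_real (norm (x - y)) powr s) holomorphic_on {s. - ?n < Re s \<and> Re s < b - ?n}"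
  proof (rule holomorphic_integral_powr)
    fix \<sigma> assume \<sigma>: "- ?n < \<sigma>" "\<sigma> < b - ?n"
    show "integrable lborel (\<lambda>y. norm (x - y) powr \<sigma> *\<^sub>R g y)"
      using integrable_powr_decay[OF _ g, of "\<sigma> + ?n" x] \<sigma> by (simp add: norm_minus_commute)
  qed auto
  then have "(\<lambda>s. LINT y|lborel. g y * complex_of_real (norm (x - y)) powr (s - of_nat CARD('n))) holomorphic_on {s. 0 < Re s \<and> Re s < b}"
    by (rule holomorphic_on_compose_gen[unfolded o_def, rotated]) (auto intro!: holomorphic_intros)
  moreover have "(\<lambda>s. 1 / riesz_H CARD('n) s) holomorphic_on {s. 0 < Re s \<and> Re s < b}"
    by (rule holomorphic_on_subset[OF riesz_H_holomorphic]) (use b in auto)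
  ultimately show ?thesis unfolding riesz_integral_def[abs_def] by (intro holomorphic_on_mult)
qed

theorem theorem5p3:
  fixes f :: "real ^ 'n \<Rightarrow> complex" and k :: nat and \<delta> :: real and x :: "real ^ 'n"
  assumes "CARD('n) \<ge> 2"
    and "k \<in> {1..CARD('n) - 1}"
    and "\<delta> > 0"
    and "f \<in> C_decay (real k + \<delta>)"
  shows "\<exists>L. ((\<lambda>s::real. riesz_potential (complex_of_real s)
                 (dual_kplane_transform k (kplane_transform k f)) x) \<longlongrightarrow> L)
               (at_right (- real k)) \<and>
             f x = complex_of_real ((4 * pi) powr (- (real k / 2)) *
                     (Gamma ((real CARD('n) - real k) / 2) / Gamma (real CARD('n) / 2))) * L"
proof -
  let ?n = "real CARD('n)" and ?k = "real k"
  have k: "1 \<le> k" "k \<le> CARD('n)" "0 < ?k" "?k + 1 \<le> ?n" using assms(1,2) by auto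
  \<comment> \<open>With \<open>b\<close> at most a half, \<open>a = k + 2 * b\<close> is at most
    \<open>k + 1\<close> and hence at most the dimension. Of the surplus \<open>2 * b\<close>, one
    half becomes the decay of \<open>g\<close>, the other keeps the integrals of order up to
    \<open>k + b\<close> convergent.\<close>
  define b where "b = min \<delta> 1 / 2"
  define a where "a = ?k + 2 * b"
  have b: "0 < b" "b \<le> 1 / 2" "2 * b \<le> \<delta>" using assms(3) by (auto simp: b_def)
  have a: "a > 0" "a \<le> ?n" using b k by (auto simp: a_def)
  have fa: "f \<in> C_decay a" by (rule C_decay_mono[OF assms(4)]) (use a b in \<open>auto simp: a_def\<close>)
  then have cont: "continuous_on UNIV f" by (simp add: C_decay_def)
  have [measurable]: "f \<in> borel_measurable borel" using fa by (rule C_decay_measurable)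
  obtain C where C: "\<And>y. norm (f y) \<le> C * (1 + norm y) powr (- a)"
    using C_decay_bound[OF fa] a by (metis less_imp_le)
  define J where "J s y = (LINT z|lborel. norm (z - y) powr (s - ?n) *\<^sub>R f z)" for s y
  define q where "q = kplane_const ?n ?k"
  define H where "H = riesz_H_real ?n"
  define g where "g = dual_kplane_transform k (kplane_transform k f)"
  have g: "g y = q *\<^sub>R J ?k y" for y
    unfolding g_def q_def J_def
    by (rule dual_kplane_transform_riesz[OF assms(1) k(1,2)]) (use k b in \<open>auto simp: a_def intro!: integrable_powr_decay[OF _ C]\<close>)
  have contJ: "continuous_on UNIV (J ?k)"
    unfolding J_def[abs_def] using k b by (intro continuous_riesz[OF cont C]) (auto simp: a_def)
  obtain K where K: "\<And>y. norm y powr b * norm (J ?k y) \<le> K"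
    unfolding J_def using riesz_decay[OF _ C, of b ?k] k b by (auto simp: a_def)
  have gC: "g \<in> C_decay b"
  proof (rule C_decayI)
    show "continuous_on UNIV g" unfolding g[abs_def] by (intro continuous_intros contJ)
    show "norm y powr b * norm (g y) \<le> \<bar>q\<bar> * K" for y
      using mult_left_mono[OF K[of y], of "\<bar>q\<bar>"] by (simp add: g mult_ac)
  qed
  have g_meas [measurable]: "g \<in> borel_measurable borel" using gC by (rule C_decay_measurable)
  obtain D where D: "\<And>y. norm (g y) \<le> D * (1 + norm y) powr (- b)"
    using C_decay_bound[OF gC] b by (metis less_imp_le)
  \<comment> \<open>The factor \<open>q\<close> stems from the dual transform; \<open>H ?k\<close>
    is what the composition of normalised kernels leaves over.\<close>
  define F where "F s = of_real (q * H ?k) * (1 / riesz_H CARD('n) (s + of_nat k) *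
     (LINT z|lborel. f z * complex_of_real (norm (z - x)) powr (s + of_nat k - of_nat CARD('n))))" for s
  have F_real: "F (of_real t) = of_real (q * H ?k) * ((1 / H (t + ?k)) *\<^sub>R J (t + ?k) x)" for t
  proof -
    have "complex_of_real (norm (z - x)) powr (of_real t + of_nat k - of_nat CARD('n)) = of_real (norm (z - x) powr (t + ?k - ?n))" for z
      using of_real_norm_powr[of "z - x" "t + ?k - ?n"] by simp
    then show ?thesis
      using riesz_H_of_real[of "CARD('n)" "t + ?k"]
      by (simp add: F_def J_def H_def scaleR_conv_of_real mult.commute)
  qed
  have F_hol: "F holomorphic_on {s. - ?k < Re s \<and> Re s < b}"
  proof -
    have "(\<lambda>s. LINT z|lborel. f z * complex_of_real (norm (z - x)) powr s) holomorphic_on {s. - ?n < Re s \<and> Re s < a - ?n}"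
    proof (rule holomorphic_integral_powr)
      fix \<sigma> assume \<sigma>: "- ?n < \<sigma>" "\<sigma> < a - ?n"
      show "integrable lborel (\<lambda>z. norm (z - x) powr \<sigma> *\<^sub>R f z)"
        using integrable_powr_decay[OF _ C, of "\<sigma> + ?n" x] \<sigma> by simp
    qed auto
    then have "(\<lambda>s. LINT z|lborel. f z * complex_of_real (norm (z - x)) powr (s + of_nat k - of_nat CARD('n))) holomorphic_on {s. - ?k < Re s \<and> Re s < b}"
      by (rule holomorphic_on_compose_gen[unfolded o_def, rotated]) (use b in \<open>auto intro!: holomorphic_intros simp: a_def\<close>)
    moreover have "(\<lambda>s. 1 / riesz_H CARD('n) (s + of_nat k)) holomorphic_on {s. - ?k < Re s \<and> Re s < b}"
      by (rule holomorphic_on_compose_gen[OF _ riesz_H_holomorphic, unfolded o_def]) (use b k in \<open>auto intro!: holomorphic_intros\<close>)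
    ultimately show ?thesis unfolding F_def[abs_def] by (intro holomorphic_on_mult holomorphic_on_const)
  qed
  have F_riesz: "F s = riesz_integral g x s" if s: "0 < Re s" "Re s < b" for s
  proof (rule holomorphic_eq_real_segment[OF _ _ b(1) _ s])
    show "F holomorphic_on {s. 0 < Re s \<and> Re s < b}" using F_hol by (rule holomorphic_on_subset) auto
    show "riesz_integral g x holomorphic_on {s. 0 < Re s \<and> Re s < b}"
      by (rule riesz_integral_holomorphic[OF g_meas D]) (use b k in auto)
    fix t assume t: "0 < t" "t < b"
    have Ht: "H t \<noteq> 0" using riesz_H_real_pos[of t ?n] t b k by (simp add: H_def)
    have "g y * complex_of_real (norm (x - y)) powr (of_real t - of_nat CARD('n)) = q *\<^sub>R (norm (x - y) powr (t - ?n) *\<^sub>R J ?k y)" for y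
      using of_real_norm_powr[of "x - y" "t - ?n"] by (simp add: g scaleR_conv_of_real mult_ac)
    then have "riesz_integral g x (of_real t) = (1 / H t) *\<^sub>R (LINT y|lborel. q *\<^sub>R (norm (x - y) powr (t - ?n) *\<^sub>R J ?k y))"
      using riesz_H_of_real[of "CARD('n)" t] by (simp add: riesz_integral_def H_def scaleR_conv_of_real)
    also have "\<dots> = (1 / H t) *\<^sub>R (q *\<^sub>R (LINT y|lborel. norm (x - y) powr (t - ?n) *\<^sub>R J ?k y))"
      by (simp only: integral_scaleR_right)
    also have "(LINT y|lborel. norm (x - y) powr (t - ?n) *\<^sub>R J ?k y) = (H t * H ?k / H (t + ?k)) *\<^sub>R J (t + ?k) x"
      unfolding J_def H_def using t b k by (intro riesz_compose[OF _ C]) (auto simp: a_def)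
    also have "(1 / H t) *\<^sub>R (q *\<^sub>R ((H t * H ?k / H (t + ?k)) *\<^sub>R J (t + ?k) x)) = F (of_real t)"
      unfolding F_real using Ht by (simp add: scaleR_conv_of_real)
    finally show "F (of_real t) = riesz_integral g x (of_real t)" ..
  qed
  \<comment> \<open>The strip ends where the order \<open>s + k\<close> of the kernel reaches zero;
    the limit of the theorem is taken at this edge.\<close>
  have cont_F: "riesz_continuation g x (- ?k) b F"
    unfolding riesz_continuation_def
    using k b gC F_riesz holomorphic_on_subset[OF F_hol, of "{s. - ?k < Re s \<and> Re s < b} - riesz_poles CARD('n)"] by auto
  define L where "L = of_real (q * H ?k) * f x"
  have "((\<lambda>\<epsilon>. of_real (q * H ?k) * ((1 / H \<epsilon>) *\<^sub>R J \<epsilon> x)) \<longlongrightarrow> L) (at_right 0)"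
    unfolding L_def H_def J_def by (intro tendsto_mult tendsto_const riesz_approximate_identity[OF cont C a(1)])
  then have "((\<lambda>s. of_real (q * H ?k) * ((1 / H (s + ?k)) *\<^sub>R J (s + ?k) x)) \<longlongrightarrow> L) (at_right (- ?k))"
    by (subst filterlim_at_right_to_0) simp
  then have "((\<lambda>s. riesz_potential (of_real s) g x) \<longlongrightarrow> L) (at_right (- ?k))"
  proof (rule tendsto_cong[THEN iffD1, rotated])
    \<comment> \<open>Negative \<open>s\<close> fall under the clause of
      \<open>riesz_potential\<close> that is given by continuation.\<close>
    have "eventually (\<lambda>s. - ?k < s \<and> s < 0) (at_right (- ?k))"
      unfolding eventually_at_right_field using k by (intro exI[of _ 0]) auto
    then show "eventually (\<lambda>s. of_real (q * H ?k) * ((1 / H (s + ?k)) *\<^sub>R J (s + ?k) x) = riesz_potential (of_real s) g x) (at_right (- ?k))"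
    proof eventually_elim
      case (elim s)
      then show ?case using riesz_potential_eq[OF cont_F, of "of_real s"] by (simp add: F_real)
    qed
  qed
  moreover have "f x = complex_of_real ((4 * pi) powr (- (?k / 2)) * (Gamma ((?n - ?k) / 2) / Gamma (?n / 2))) * L"
  proof -
    have "(4 * pi) powr (- (?k / 2)) * (Gamma ((?n - ?k) / 2) / Gamma (?n / 2)) * (q * H ?k) = 1"
      unfolding q_def H_def by (rule kplane_const_riesz_H) (use k in auto)
    then have "complex_of_real ((4 * pi) powr (- (?k / 2)) * (Gamma ((?n - ?k) / 2) / Gamma (?n / 2))) * complex_of_real (q * H ?k) = 1"
      by (simp only: of_real_mult[symmetric] of_real_1)
    then show ?thesis by (simp only: L_def mult.assoc[symmetric] mult_1_left)
  qed
  ultimately show ?thesis unfolding g_def by blast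
qed

end
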